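(* Let $X$ be a P-complex in $V$ with compact cells and $S=\bigwedge^*V$. The ring $\mathcal{R}^*(X,S)=\mathcal{R}^0(X,S)\oplus\cdots\oplus\mathcal{R}^n(X,S)$ with multiplication $\smile_v$ does not depend on the choice of the convenient point $v$: for all convenient $u,v\in\mathcal{U}(X)$ and all $r,s\in\mathcal{R}^*(X,S)$, $r\smile_u s=r\smile_v s$.
   Context: $V$ is a real vector space of finite dimension $n$, $V^*$ its dual. P-complex: a finite set $X$ of closed convex polyhedra in $V$ (its cells) such that every face of a cell is a cell and every non-empty intersection of two cells is a common face of both. All cells are assumed compact. Cochains: $S$ is a supercommutative ring ($\mathbb{Z}/2$-graded, $ab=(-1)^{|a||b|}ba$ for homogeneous $a,b$); here $S=\bigwedge^*V$. $C^p(X,S)$ is the module of functions from oriented $p$-dimensional cells to $S$ that change sign when the orientation of the cell is reversed; $d\colon C^p(X,S)\to C^{p+1}(X,S)$ is the usual coboundary: $(dr)(\mu)$ is the sum of $r$ over the facets of $\mu$ with induced boundary orientation (outward normal first). For a cell $\delta$, $V_\delta\subset V$ is the linear subspace generated by differences of points of $\delta$. For a cell $\gamma$, let $X_\gamma$ be the P-complex in $V_\gamma$ of faces of $\gamma$ ($\gamma$ translated into $V_\gamma$; the choice is immaterial). For a face $\delta$ of $\gamma$ the dual cone $\delta^*\subset (V_\gamma)^*$ consists of all $w\in(V_\gamma)^*$ for which the maximum of $w$ on $\gamma$ is attained at every point of $\delta$; $\dim\delta^*=\dim\gamma-\dim\delta$. These cones form the dual fan $X_\gamma^*$, with $j$-dimensional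 skeleton $(X_\gamma^* )^j$. Let $\pi_\gamma\colon V^*\to(V_\gamma)^*$ be the restriction map. Two P-complexes in a space are transversal if for any cells $\delta_1,\delta_2$ of them with $\delta_1\cap\delta_2\ne\emptyset$ one has $\operatorname{codim}(V_{\delta_1}\cap V_{\delta_2})=\operatorname{codim}V_{\delta_1}+\operatorname{codim}V_{\delta_2}$. A point $v\in V^*$ is $(p,q)$-convenient if $\pi_\gamma(v)+(X_\gamma^* )^q$ and $(X_\gamma^* )^p$ are transversal for every $\gamma\in X$ with $\dim\gamma=p+q$; $\mathcal{U}_{p,q}(X)$ is the set of such points, and $\mathcal{U}(X)=\bigcap_{p,q}\mathcal{U}_{p,q}(X)$ is the set of convenient points. Product: for $v\in\mathcal{U}_{p,q}(X)$ and an oriented cell $\gamma$ of dimension $p+q$, $(r_p\smile_v r_q)(\gamma)=\sum_{(\delta,\lambda)\in\mathcal{P}(p,q,\gamma,v)}r_p(\delta)r_q(\lambda)$, where $\mathcal{P}(p,q,\gamma,v)$ is the set of pairs $(\delta,\lambda)$ of faces of $\gamma$ of dimensions $p,q$ with $(\pi_\gamma(v)+\delta^* )\cap\lambda^*\neq\emptyset$, oriented so that $V_\gamma=V_\delta\oplus V_\lambda$ as oriented spaces; extended bilinearly to sums over degrees. $\mathcal{R}^p(X,S)$ is the set of cocycles $r_p\in C^p(X,S)$ such that $r_p(\delta)\in\bigwedge^pV_\delta$ for every $p$-cell $\delta$. *)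

theory Defs
  imports
    "HOL-Analysis.Analysis"
    "HOL-Library.Poly_Mapping"
    "HOL-Library.Function_Algebras"
    "Jordan_Normal_Form.Determinant"
begin

section \<open>The exterior algebra\<close>

text \<open>
  The free associative real algebra on the set \<open>V\<close> is the monoid algebra of the free monoid
  of words over \<open>V\<close>; concatenation is written additively, as required by the
  convolution product on \<^typ>\<open>'w \<Rightarrow>\<^sub>0 real\<close>.
\<close>

instantiation list :: (type) monoid_add
begin

definition zero_list :: "'a list" where "zero_list = []"
definition plus_list :: "'a list \<Rightarrow> 'a list \<Rightarrow> 'a list" where "plus_list = (@)"

instance by standard (simp_all add: zero_list_def plus_list_def)

end

text \<open>
  The exterior algebra is the quotient of the free algebra by the two-sided ideal generated by
  the linearity relations between the generators and by the squares of the generators.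
\<close>

inductive_set ext_ideal :: "('a::real_vector list \<Rightarrow>\<^sub>0 real) set" where
  add: "Poly_Mapping.single [x + y] 1 - Poly_Mapping.single [x] 1 - Poly_Mapping.single [y] 1
          \<in> ext_ideal"
| scale: "Poly_Mapping.single [c *\<^sub>R x] 1 - Poly_Mapping.single [x] c \<in> ext_ideal"
| square: "Poly_Mapping.single [x, x] 1 \<in> ext_ideal"
| zero: "0 \<in> ext_ideal"
| plus: "f \<in> ext_ideal \<Longrightarrow> g \<in> ext_ideal \<Longrightarrow> f + g \<in> ext_ideal"
| mult_left: "f \<in> ext_ideal \<Longrightarrow> h * f \<in> ext_ideal"
| mult_right: "f \<in> ext_ideal \<Longrightarrow> f * h \<in> ext_ideal"

definition ext_rel :: "('a::real_vector list \<Rightarrow>\<^sub>0 real) \<Rightarrow> ('a list \<Rightarrow>\<^sub>0 real) \<Rightarrow> bool" where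
  "ext_rel f g \<longleftrightarrow> f - g \<in> ext_ideal"

lemma ext_ideal_uminus: "f \<in> ext_ideal \<Longrightarrow> - f \<in> ext_ideal"
  using ext_ideal.mult_left[of f "-1"] by simp

lemma equivp_ext_rel: "equivp (ext_rel :: ('a::real_vector list \<Rightarrow>\<^sub>0 real) \<Rightarrow> _)"
proof (rule equivpI)
  show "reflp (ext_rel :: ('a list \<Rightarrow>\<^sub>0 real) \<Rightarrow> _)" by (simp add: reflp_def ext_rel_def ext_ideal.zero)
  show "symp (ext_rel :: ('a list \<Rightarrow>\<^sub>0 real) \<Rightarrow> _)"
  proof (rule sympI)
    fix f g :: "'a list \<Rightarrow>\<^sub>0 real"
    assume "ext_rel f g"
    then show "ext_rel g f"
      unfolding ext_rel_def using ext_ideal_uminus[of "f - g"] by simp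
  qed
  show "transp (ext_rel :: ('a list \<Rightarrow>\<^sub>0 real) \<Rightarrow> _)"
  proof (rule transpI)
    fix f g h :: "'a list \<Rightarrow>\<^sub>0 real"
    assume "ext_rel f g" "ext_rel g h"
    then have "(f - g) + (g - h) \<in> ext_ideal"
      unfolding ext_rel_def by (rule ext_ideal.plus)
    then show "ext_rel f h" by (simp add: ext_rel_def)
  qed
qed

quotient_type (overloaded) 'a ext = "'a::real_vector list \<Rightarrow>\<^sub>0 real" / ext_rel
  by (rule equivp_ext_rel)

lemma ext_lookup_mult_0:
  "Poly_Mapping.lookup (f * g) 0 = Poly_Mapping.lookup f 0 * Poly_Mapping.lookup g 0"
  for f g :: "'a::type list \<Rightarrow>\<^sub>0 real"
proof -
  have split: "(0 = l + q) = (l = 0 \<and> q = 0)" for l q :: "'a list"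
    by (auto simp: zero_list_def plus_list_def)
  have "Poly_Mapping.lookup (f * g) 0 =
      Sum_any (\<lambda>l. Poly_Mapping.lookup f l * Sum_any (\<lambda>q. Poly_Mapping.lookup g q when l = 0 \<and> q = 0))"
    by (simp only: lookup_mult split)
  also have "\<dots> = Sum_any (\<lambda>l. (Poly_Mapping.lookup f l * Poly_Mapping.lookup g 0) when l = 0)"
  proof (rule Sum_any.cong)
    fix l
    show "Poly_Mapping.lookup f l * Sum_any (\<lambda>q. Poly_Mapping.lookup g q when l = 0 \<and> q = 0) =
        (Poly_Mapping.lookup f l * Poly_Mapping.lookup g 0 when l = 0)"
      by (cases "l = 0") simp_all
  qed
  finally show ?thesis by simp
qed

lemma ext_ideal_lookup_0: "f \<in> ext_ideal \<Longrightarrow> Poly_Mapping.lookup f 0 = 0"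
  by (induction rule: ext_ideal.induct)
    (simp_all add: lookup_add lookup_minus lookup_single zero_list_def
      ext_lookup_mult_0[unfolded zero_list_def])

lemma ext_single_0_central: "f * Poly_Mapping.single 0 c = Poly_Mapping.single 0 c * f"
  for f :: "'a::type list \<Rightarrow>\<^sub>0 real"
proof (induction f rule: update_induct)
  case const
  show ?case by simp
next
  case (update f a b)
  have "Poly_Mapping.update a b f = f + Poly_Mapping.single a b"
    using update.hyps
    by (intro poly_mapping_eqI) (auto simp: lookup_update lookup_add lookup_single in_keys_iff when_def)
  then show ?case
    using update.IH by (simp add: distrib_left distrib_right mult_single mult.commute)
qed

instantiation ext :: (real_vector) real_algebra_1
begin

lift_definition zero_ext :: "'a ext" is 0 .
lift_definition one_ext :: "'a ext" is 1 .
lift_definition plus_ext :: "'a ext \<Rightarrow> 'a ext \<Rightarrow> 'a ext" is "(+)"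
proof -
  fix f f' g g' :: "'a list \<Rightarrow>\<^sub>0 real"
  assume "ext_rel f f'" "ext_rel g g'"
  then have "(f - f') + (g - g') \<in> ext_ideal"
    unfolding ext_rel_def by (rule ext_ideal.plus)
  then show "ext_rel (f + g) (f' + g')"
    unfolding ext_rel_def by (simp add: algebra_simps)
qed
lift_definition uminus_ext :: "'a ext \<Rightarrow> 'a ext" is uminus
proof -
  fix f g :: "'a list \<Rightarrow>\<^sub>0 real"
  assume "ext_rel f g"
  then show "ext_rel (- f) (- g)"
    unfolding ext_rel_def using ext_ideal_uminus[of "f - g"] by simp
qed
lift_definition minus_ext :: "'a ext \<Rightarrow> 'a ext \<Rightarrow> 'a ext" is "(-)"
proof -
  fix f f' g g' :: "'a list \<Rightarrow>\<^sub>0 real"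
  assume "ext_rel f f'" "ext_rel g g'"
  then have "(f - f') + - (g - g') \<in> ext_ideal"
    unfolding ext_rel_def by (intro ext_ideal.plus ext_ideal_uminus)
  then show "ext_rel (f - g) (f' - g')"
    unfolding ext_rel_def by (simp add: algebra_simps)
qed
lift_definition times_ext :: "'a ext \<Rightarrow> 'a ext \<Rightarrow> 'a ext" is "(*)"
proof -
  fix f f' g g' :: "'a list \<Rightarrow>\<^sub>0 real"
  assume "ext_rel f f'" "ext_rel g g'"
  then have "f * (g - g') + (f - f') * g' \<in> ext_ideal"
    unfolding ext_rel_def by (intro ext_ideal.plus ext_ideal.mult_left ext_ideal.mult_right)
  then show "ext_rel (f * g) (f' * g')"
    unfolding ext_rel_def by (simp add: algebra_simps)
qed
lift_definition scaleR_ext :: "real \<Rightarrow> 'a ext \<Rightarrow> 'a ext"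
  is "\<lambda>c f. Poly_Mapping.single 0 c * f"
  unfolding ext_rel_def by (simp add: ext_ideal.mult_left flip: right_diff_distrib)

instance
proof
  have refl: "ext_rel f f" for f :: "'a list \<Rightarrow>\<^sub>0 real"
    by (simp add: ext_rel_def ext_ideal.zero)
  fix a b c :: "'a ext" and x y :: real
  show "a + b + c = a + (b + c)" by transfer (simp add: refl add.assoc)
  show "a + b = b + a" by transfer (simp add: refl add.commute)
  show "0 + a = a" by transfer (simp add: refl)
  show "- a + a = 0" by transfer (simp add: refl)
  show "a - b = a + - b" by transfer (simp add: refl)
  show "a * b * c = a * (b * c)" by transfer (simp add: refl mult.assoc)
  show "(a + b) * c = a * c + b * c" by transfer (simp add: refl distrib_right)
  show "a * (b + c) = a * b + a * c" by transfer (simp add: refl distrib_left)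
  show "1 * a = a" by transfer (simp add: refl)
  show "a * 1 = a" by transfer (simp add: refl)
  show "(0::'a ext) \<noteq> 1"
    by transfer (auto simp: ext_rel_def lookup_minus lookup_one dest: ext_ideal_lookup_0)
  show "x *\<^sub>R (a + b) = x *\<^sub>R a + x *\<^sub>R b" by transfer (simp add: refl distrib_left)
  show "(x + y) *\<^sub>R a = x *\<^sub>R a + y *\<^sub>R a"
    by transfer (simp add: refl single_add distrib_right)
  show "x *\<^sub>R y *\<^sub>R a = (x * y) *\<^sub>R a"
    by transfer (simp add: refl mult.assoc[symmetric] mult_single)
  show "1 *\<^sub>R a = a" by transfer (simp add: refl)
  show "x *\<^sub>R a * b = x *\<^sub>R (a * b)" by transfer (simp add: refl mult.assoc)
  show "a * x *\<^sub>R b = x *\<^sub>R (a * b)"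
  proof transfer
    fix f g :: "'a list \<Rightarrow>\<^sub>0 real" and x :: real
    have "f * (Poly_Mapping.single 0 x * g) = Poly_Mapping.single 0 x * (f * g)"
      by (simp only: mult.assoc[symmetric] ext_single_0_central)
    then show "ext_rel (f * (Poly_Mapping.single 0 x * g)) (Poly_Mapping.single 0 x * (f * g))"
      by (simp add: refl)
  qed
qed

end

lift_definition ext_vec :: "'a::real_vector \<Rightarrow> 'a ext" is "\<lambda>x. Poly_Mapping.single [x] 1" .

lemma linear_ext_vec: "linear ext_vec"
proof
  fix x y :: 'a and c :: real
  show "ext_vec (x + y) = ext_vec x + ext_vec y"
    by transfer (simp add: ext_rel_def diff_diff_eq[symmetric] ext_ideal.add)
  show "ext_vec (c *\<^sub>R x) = c *\<^sub>R ext_vec x"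
    by transfer (simp add: ext_rel_def mult_single ext_ideal.scale)
qed

lemma ext_vec_square: "ext_vec x * ext_vec x = 0"
  by transfer (simp add: ext_rel_def mult_single plus_list_def ext_ideal.square)

text \<open>
  For a subspace \<open>U\<close> the algebra \<open>\<Lambda>\<^sup>*U\<close> and its degree \<open>p\<close> part are identified with their
  (isomorphic) images in the exterior algebra of the ambient space.
\<close>

definition ext_alg :: "'a::real_vector set \<Rightarrow> 'a ext set" where
  "ext_alg U = span {prod_list (map ext_vec xs) | xs. set xs \<subseteq> U}"

definition ext_power :: "nat \<Rightarrow> 'a::real_vector set \<Rightarrow> 'a ext set" where
  "ext_power p U = span {prod_list (map ext_vec xs) | xs. length xs = p \<and> set xs \<subseteq> U}"

section \<open>P-complexes\<close>

definition P_complex :: "'a::euclidean_space set \<Rightarrow> 'a set set \<Rightarrow> bool" where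
  "P_complex V X \<longleftrightarrow>
     finite X \<and>
     (\<forall>C\<in>X. polyhedron C \<and> C \<noteq> {} \<and> C \<subseteq> V) \<and>
     (\<forall>C\<in>X. \<forall>F. F face_of C \<and> F \<noteq> {} \<longrightarrow> F \<in> X) \<and>
     (\<forall>C\<in>X. \<forall>D\<in>X. C \<inter> D \<noteq> {} \<longrightarrow> (C \<inter> D) face_of C \<and> (C \<inter> D) face_of D)"

definition dir_space :: "'a::real_vector set \<Rightarrow> 'a set" where
  "dir_space C = span {x - y | x y. x \<in> C \<and> y \<in> C}"

section \<open>Oriented cells and cochains\<close>

definition ordered_basis :: "'a::real_vector set \<Rightarrow> 'a list \<Rightarrow> bool" where
  "ordered_basis U bs \<longleftrightarrow> distinct bs \<and> independent (set bs) \<and> span (set bs) = U"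

definition change_of_basis :: "'a::real_vector list \<Rightarrow> 'a list \<Rightarrow> real mat" where
  "change_of_basis bs cs =
     Matrix.mat (length bs) (length cs) (\<lambda>(i, j). representation (set bs) (cs ! j) (bs ! i))"

text \<open>
  An orientation assigns a sign to each ordered basis, compatibly with the determinants of base
  changes. It is encoded as a function on all lists that vanishes on those that are not ordered
  bases. The zero space, whose only ordered basis is \<open>[]\<close>, also has exactly two
  orientations. The reversed orientation is \<open>- \<epsilon>\<close>.
\<close>

type_synonym 'a orient = "'a list \<Rightarrow> real"

definition orientation :: "'a::real_vector set \<Rightarrow> 'a orient \<Rightarrow> bool" where
  "orientation U \<epsilon> \<longleftrightarrow>
     (\<forall>bs. ordered_basis U bs \<longrightarrow> \<epsilon> bs \<in> {1, - 1}) \<and>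
     (\<forall>bs. \<not> ordered_basis U bs \<longrightarrow> \<epsilon> bs = 0) \<and>
     (\<forall>bs cs. ordered_basis U bs \<and> ordered_basis U cs \<longrightarrow>
        \<epsilon> cs = sgn (Determinant.det (change_of_basis bs cs)) * \<epsilon> bs)"

definition oriented_cell :: "'a::euclidean_space set set \<Rightarrow> nat \<Rightarrow> 'a set \<Rightarrow> 'a orient \<Rightarrow> bool" where
  "oriented_cell X p C \<epsilon> \<longleftrightarrow> C \<in> X \<and> aff_dim C = int p \<and> orientation (dir_space C) \<epsilon>"

text \<open>
  Cochains are functions of a cell and an orientation of it, extended by \<open>0\<close> to arguments that
  are not oriented cells of the right dimension.
\<close>

type_synonym 'a cochain = "'a set \<Rightarrow> 'a orient \<Rightarrow> 'a ext"

definition cochains ::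
    "'a::euclidean_space set set \<Rightarrow> 'a ext set \<Rightarrow> nat \<Rightarrow> 'a cochain set" where
  "cochains X S p =
     {r. (\<forall>C \<epsilon>. oriented_cell X p C \<epsilon> \<longrightarrow> r C \<epsilon> \<in> S \<and> r C (- \<epsilon>) = - r C \<epsilon>) \<and>
         (\<forall>C \<epsilon>. \<not> oriented_cell X p C \<epsilon> \<longrightarrow> r C \<epsilon> = 0)}"

text \<open>
  If \<open>F\<close> is a facet of \<open>C\<close>, all vectors \<open>x - y\<close> with \<open>x \<in> F\<close> and \<open>y \<in> C - F\<close> point out
  of \<open>C\<close> across \<open>F\<close>, i.e. they agree modulo \<open>dir_space F\<close> with a positive multiple of the
  outward normal, so the induced orientation does not depend on the one that is chosen.
\<close>

definition outward_vector :: "'a::real_vector set \<Rightarrow> 'a set \<Rightarrow> 'a" where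
  "outward_vector C F = (SOME w. \<exists>x\<in>F. \<exists>y\<in>C - F. w = x - y)"

definition boundary_orientation ::
    "'a::real_vector set \<Rightarrow> 'a orient \<Rightarrow> 'a set \<Rightarrow> 'a orient" where
  "boundary_orientation C \<epsilon> F =
     (\<lambda>bs. if ordered_basis (dir_space F) bs then \<epsilon> (outward_vector C F # bs) else 0)"

definition coboundary ::
    "'a::euclidean_space set set \<Rightarrow> nat \<Rightarrow> 'a cochain \<Rightarrow> 'a cochain" where
  "coboundary X p r =
     (\<lambda>C \<epsilon>. if oriented_cell X (p + 1) C \<epsilon>
            then \<Sum>F | F facet_of C. r F (boundary_orientation C \<epsilon> F)
            else 0)"

section \<open>Dual fans and convenient points\<close>

instantiation "fun" :: (type, real_vector) real_vector
begin

definition scaleR_fun :: "real \<Rightarrow> ('a \<Rightarrow> 'b) \<Rightarrow> 'a \<Rightarrow> 'b" where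
  "scaleR_fun c f = (\<lambda>x. c *\<^sub>R f x)"

instance
  by standard (simp_all add: scaleR_fun_def fun_eq_iff scaleR_add_right scaleR_add_left)

end

text \<open>
  The dual of a subspace \<open>U\<close> consists of the linear functionals on \<open>U\<close>, encoded as functions
  on the ambient space that vanish outside of \<open>U\<close>.
\<close>

definition dual_space :: "'a::real_vector set \<Rightarrow> ('a \<Rightarrow> real) set" where
  "dual_space U =
     {w. (\<forall>x\<in>U. \<forall>y\<in>U. w (x + y) = w x + w y) \<and>
         (\<forall>c. \<forall>x\<in>U. w (c *\<^sub>R x) = c * w x) \<and>
         (\<forall>x. x \<notin> U \<longrightarrow> w x = 0)}"

definition dual_restrict :: "'a set \<Rightarrow> ('a \<Rightarrow> real) \<Rightarrow> 'a \<Rightarrow> real" where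
  "dual_restrict U w = (\<lambda>x. if x \<in> U then w x else 0)"

text \<open>
  After translating \<open>C\<close> into \<open>dir_space C\<close>, \<open>w\<close> attains its maximum at the point
  corresponding to \<open>x\<close> iff \<open>w (y - x) \<le> 0\<close> for all \<open>y \<in> C\<close>.
\<close>

definition dual_cone :: "'a::real_vector set \<Rightarrow> 'a set \<Rightarrow> ('a \<Rightarrow> real) set" where
  "dual_cone C F = {w \<in> dual_space (dir_space C). \<forall>x\<in>F. \<forall>y\<in>C. w (y - x) \<le> 0}"

definition dual_fan :: "'a::real_vector set \<Rightarrow> ('a \<Rightarrow> real) set set" where
  "dual_fan C = {dual_cone C F | F. F face_of C \<and> F \<noteq> {}}"

definition skeleton :: "nat \<Rightarrow> 'b::real_vector set set \<Rightarrow> 'b set set" where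
  "skeleton j K = {D \<in> K. dim (dir_space D) \<le> j}"

definition codim_in :: "'b::real_vector set \<Rightarrow> 'b set \<Rightarrow> int" where
  "codim_in W U = int (dim W) - int (dim U)"

definition transversal :: "'b::real_vector set \<Rightarrow> 'b set set \<Rightarrow> 'b set set \<Rightarrow> bool" where
  "transversal W K L \<longleftrightarrow>
     (\<forall>C\<in>K. \<forall>D\<in>L. C \<inter> D \<noteq> {} \<longrightarrow>
        codim_in W (dir_space C \<inter> dir_space D) =
          codim_in W (dir_space C) + codim_in W (dir_space D))"

definition pq_convenient ::
    "'a::euclidean_space set \<Rightarrow> 'a set set \<Rightarrow> nat \<Rightarrow> nat \<Rightarrow> ('a \<Rightarrow> real) set" where
  "pq_convenient V X p q =
     {v \<in> dual_space V. \<forall>C\<in>X. aff_dim C = int (p + q) \<longrightarrow>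
        transversal (dual_space (dir_space C))
          ((\<lambda>D. (+) (dual_restrict (dir_space C) v) ` D) ` skeleton q (dual_fan C))
          (skeleton p (dual_fan C))}"

definition convenient :: "'a::euclidean_space set \<Rightarrow> 'a set set \<Rightarrow> ('a \<Rightarrow> real) set" where
  "convenient V X = (\<Inter>p. \<Inter>q. pq_convenient V X p q)"

section \<open>The product of cochains\<close>

definition face_pairs ::
    "nat \<Rightarrow> nat \<Rightarrow> 'a::euclidean_space set \<Rightarrow> ('a \<Rightarrow> real) \<Rightarrow> ('a set \<times> 'a set) set" where
  "face_pairs p q C v =
     {(F, G). F face_of C \<and> aff_dim F = int p \<and> G face_of C \<and> aff_dim G = int q \<and>
        ((+) (dual_restrict (dir_space C) v) ` dual_cone C F) \<inter> dual_cone C G \<noteq> {}}"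

text \<open>
  The condition expresses that the ambient oriented space is the direct sum of the two oriented
  subspaces. It determines \<open>(\<epsilon>\<^sub>1, \<epsilon>\<^sub>2)\<close> up to simultaneous reversal, which does not affect
  the products of the values of two cochains.
\<close>

definition oriented_sum ::
    "'a::real_vector set \<Rightarrow> 'a orient \<Rightarrow> 'a set \<Rightarrow> 'a orient \<Rightarrow> 'a orient \<Rightarrow> bool" where
  "oriented_sum U\<^sub>1 \<epsilon>\<^sub>1 U\<^sub>2 \<epsilon>\<^sub>2 \<epsilon> \<longleftrightarrow>
     orientation U\<^sub>1 \<epsilon>\<^sub>1 \<and> orientation U\<^sub>2 \<epsilon>\<^sub>2 \<and>
     (\<forall>bs cs. ordered_basis U\<^sub>1 bs \<and> ordered_basis U\<^sub>2 cs \<longrightarrow> \<epsilon> (bs @ cs) = \<epsilon>\<^sub>1 bs * \<epsilon>\<^sub>2 cs)"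

definition orient_pair :: "'a::real_vector orient \<Rightarrow> 'a set \<Rightarrow> 'a set \<Rightarrow> 'a orient \<times> 'a orient" where
  "orient_pair \<epsilon> F G =
     (SOME (\<epsilon>\<^sub>1, \<epsilon>\<^sub>2). oriented_sum (dir_space F) \<epsilon>\<^sub>1 (dir_space G) \<epsilon>\<^sub>2 \<epsilon>)"

definition cup_pq ::
    "'a::euclidean_space set set \<Rightarrow> ('a \<Rightarrow> real) \<Rightarrow> nat \<Rightarrow> nat \<Rightarrow>
      'a cochain \<Rightarrow> 'a cochain \<Rightarrow> 'a cochain" where
  "cup_pq X v p q a b =
     (\<lambda>C \<epsilon>. if oriented_cell X (p + q) C \<epsilon>
            then \<Sum>(F, G)\<in>face_pairs p q C v.
                   (case orient_pair \<epsilon> F G of (\<epsilon>\<^sub>1, \<epsilon>\<^sub>2) \<Rightarrow> a F \<epsilon>\<^sub>1 * b G \<epsilon>\<^sub>2)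
            else 0)"

text \<open>Elements of direct sums over degrees are represented by their families of components.\<close>

definition cup ::
    "'a::euclidean_space set set \<Rightarrow> ('a \<Rightarrow> real) \<Rightarrow>
      (nat \<Rightarrow> 'a cochain) \<Rightarrow> (nat \<Rightarrow> 'a cochain) \<Rightarrow> nat \<Rightarrow> 'a cochain" where
  "cup X v r s =
     (\<lambda>k C \<epsilon>. \<Sum>p\<le>k. cup_pq X v p (k - p) (r p) (s (k - p)) C \<epsilon>)"

definition R_deg :: "'a::euclidean_space set \<Rightarrow> 'a set set \<Rightarrow> nat \<Rightarrow> 'a cochain set" where
  "R_deg V X p =
     {r \<in> cochains X (ext_alg V) p.
        coboundary X p r = (\<lambda>C \<epsilon>. 0) \<and>
        (\<forall>F \<epsilon>. oriented_cell X p F \<epsilon> \<longrightarrow> r F \<epsilon> \<in> ext_power p (dir_space F))}"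

definition R_ring :: "'a::euclidean_space set \<Rightarrow> 'a set set \<Rightarrow> (nat \<Rightarrow> 'a cochain) set" where
  "R_ring V X =
     {r. (\<forall>p\<le>dim V. r p \<in> R_deg V X p) \<and> (\<forall>p>dim V. r p = (\<lambda>C \<epsilon>. 0))}"

end

theory Submission
  imports Defs
begin

text \<open>
  Fix a cell \<open>C\<close> of dimension \<open>k\<close> with direction space \<open>U\<close>, and represent functionals by
  vectors. A pair \<open>(F, G)\<close> of faces with \<open>dim F + dim G = k\<close> contributes to the product at \<open>C\<close>
  iff there are \<open>a\<close> and \<open>b\<close> with \<open>b - a = v\<close> on \<open>U\<close> such that \<open>a\<close> is maximal on \<open>F\<close> and \<open>b\<close> is
  maximal on \<open>G\<close>. In other words, \<open>F \<times> G\<close> is a \<open>k\<close>-dimensional face of the polytope \<open>C \<times> C\<close>, and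
  some functional \<open>(a, b)\<close> that is maximal on it restricts to \<open>v\<close> on the antidiagonal
  \<open>\<Delta> = {(-x, x) | x \<in> U}\<close>. The product is thus a sum of weights \<open>r(F) s(G)\<close> over the \<open>k\<close>-faces that
  are selected in this way (\<open>cup_eq_sum_selected\<close>), and convenience of \<open>v\<close> says that the prescribed
  restriction is in general position (\<open>convenient_imp_generic\<close>).

  The independence is a fact about any polytope \<open>Q\<close>, any subspace \<open>\<Delta>\<close> of codimension \<open>k\<close> in its
  direction space, and any weight on the \<open>k\<close>-faces that is balanced
  (\<open>sum_selected_independent\<close>); it is the argument behind the fan displacement rule of toric and
  tropical geometry. Let the prescribed restriction move along a generic segment. For a
  \<open>k\<close>-face \<open>H\<close> transverse to \<open>\<Delta>\<close> there is, up to functionals constant on \<open>Q\<close>, exactly one functional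
  that is constant on \<open>H\<close> and has this restriction, and it depends affinely on the parameter.
  So \<open>H\<close> is selected for the parameters in an interval. An endpoint of the interval is a
  parameter at which \<open>H\<close> is a facet of a face \<open>A\<close> of dimension \<open>k + 1\<close> on which the functional
  is maximal; then \<open>\<Delta>\<close> meets the direction space of \<open>A\<close> in a line, and \<open>H\<close> appears or disappears
  according to whether the line, suitably directed, leaves or enters \<open>A\<close> through \<open>H\<close>
  (\<open>crossing_iff_wall\<close>). A weight is balanced if the facets of \<open>A\<close> through which such a line leaves
  have the same total weight as those through which it enters. Hence the changes cancel
  at every wall. A segment is generic enough if it runs along no wall and no functional with a
  restriction on it is maximal on a face whose direction space meets \<open>\<Delta>\<close> in dimension two or more.

  It remains to see that \<open>r(F) s(G)\<close> is balanced. The facets of \<open>A \<times> B\<close> are the products \<open>F \<times> B\<close>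
  and \<open>A \<times> G\<close> with facets of one factor, so the condition splits into one for \<open>r\<close> on the facets of \<open>A\<close>
  and one for \<open>s\<close> on the facets of \<open>B\<close>. The first is the cocycle equation of \<open>r\<close> at \<open>A\<close>, multiplied by
  \<open>s(B)\<close>, provided two things hold. The comparison of the boundary orientation of \<open>F\<close> with the one
  induced by the splitting of \<open>U\<close> gives exactly the sign that distinguishes leaving from entering
  (\<open>cocycle_balanced\<close>). And the facets parallel to the line do not contribute: there
  the direction spaces of \<open>F\<close> and \<open>B\<close> span less than \<open>k\<close> dimensions, so that the product of an
  element of \<open>\<Lambda>\<^sup>p\<close> of the first and of \<open>\<Lambda>\<^sup>q\<close> of the second vanishes
  (\<open>ext_power_mult_eq_0\<close>). Here the values of \<open>r\<close> and \<open>s\<close> have to be multivectors in the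
  directions of the cells.
\<close>

no_notation Matrix.scalar_prod (infix "\<bullet>" 70)

section \<open>Direction spaces and faces of maximizers\<close>

lemma subspace_dir_space: "subspace (dir_space S)"
  by (simp add: dir_space_def)

lemma diff_in_dir_space: "x \<in> S \<Longrightarrow> y \<in> S \<Longrightarrow> x - y \<in> dir_space S"
  unfolding dir_space_def by (intro span_base) blast

lemma dir_space_mono: "S \<subseteq> T \<Longrightarrow> dir_space S \<subseteq> dir_space T"
  unfolding dir_space_def by (intro span_mono) blast

lemma dir_space_eq_span:
  assumes "a \<in> S"
  shows "dir_space S = span ((\<lambda>x. x - a) ` S)"
proof
  show "dir_space S \<subseteq> span ((\<lambda>x. x - a) ` S)"
    unfolding dir_space_def
  proof (rule span_minimal, clarsimp)
    fix x y assume "x \<in> S" "y \<in> S"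
    then have "(x - a) - (y - a) \<in> span ((\<lambda>x. x - a) ` S)"
      by (intro span_diff span_base) auto
    then show "x - y \<in> span ((\<lambda>x. x - a) ` S)" by simp
  qed simp
  show "span ((\<lambda>x. x - a) ` S) \<subseteq> dir_space S"
    by (rule span_minimal) (use assms in \<open>auto intro: diff_in_dir_space subspace_dir_space\<close>)
qed

lemma dim_dir_space:
  fixes S :: "'a::euclidean_space set"
  assumes "S \<noteq> {}"
  shows "int (dim (dir_space S)) = aff_dim S"
proof -
  obtain a where "a \<in> S" using assms by blast
  then show ?thesis
    using aff_dim_eq_dim_subtract[of a S] hull_subset[of S affine]
    by (auto simp: dir_space_eq_span[OF \<open>a \<in> S\<close>])
qed

lemma orthogonal_dir_space:
  assumes "\<And>x y. x \<in> S \<Longrightarrow> y \<in> S \<Longrightarrow> c \<bullet> x = c \<bullet> y" and "e \<in> dir_space S"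
  shows "c \<bullet> e = 0"
proof -
  have "dir_space S \<subseteq> {e. c \<bullet> e = 0}"
    unfolding dir_space_def
  proof (rule span_minimal)
    show "{x - y |x y. x \<in> S \<and> y \<in> S} \<subseteq> {e. c \<bullet> e = 0}"
    proof clarify
      fix x y assume "x \<in> S" "y \<in> S"
      then have "c \<bullet> x = c \<bullet> y" by (rule assms(1))
      then show "c \<bullet> (x - y) = 0" by (simp add: inner_diff_right)
    qed
  qed (rule subspace_hyperplane)
  with assms(2) show ?thesis by blast
qed

definition maximizers :: "'a::real_inner set \<Rightarrow> 'a \<Rightarrow> 'a set" where
  "maximizers Q c = {x \<in> Q. \<forall>y\<in>Q. c \<bullet> y \<le> c \<bullet> x}"

lemma maximizers_face_of:
  fixes Q :: "'a::euclidean_space set"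
  assumes "convex Q"
  shows "maximizers Q c face_of Q"
proof (cases "maximizers Q c = {}")
  case False
  then obtain x where x: "x \<in> Q" "\<And>y. y \<in> Q \<Longrightarrow> c \<bullet> y \<le> c \<bullet> x"
    by (auto simp: maximizers_def)
  have "maximizers Q c = Q \<inter> {y. c \<bullet> y = c \<bullet> x}"
    using x by (force simp: maximizers_def)
  then show ?thesis
    using face_of_Int_supporting_hyperplane_le[OF assms x(2)] by simp
qed simp

lemma maximizers_nonempty:
  fixes Q :: "'a::euclidean_space set"
  assumes "compact Q" "Q \<noteq> {}"
  shows "maximizers Q c \<noteq> {}"
proof -
  have "continuous_on Q (\<lambda>x. c \<bullet> x)" by (intro continuous_intros)
  then show ?thesis
    using continuous_attains_sup[OF assms] by (fastforce simp: maximizers_def)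
qed

lemma orthogonal_maximizers: "e \<in> dir_space (maximizers Q c) \<Longrightarrow> c \<bullet> e = 0"
  by (erule orthogonal_dir_space[rotated]) (force simp: maximizers_def intro: antisym)

lemma maximizers_cong:
  assumes "\<And>e. e \<in> dir_space Q \<Longrightarrow> c \<bullet> e = c' \<bullet> e"
  shows "maximizers Q c = maximizers Q c'"
proof -
  have "c \<bullet> y \<le> c \<bullet> x \<longleftrightarrow> c' \<bullet> y \<le> c' \<bullet> x"
    if "x \<in> Q" "y \<in> Q" for x y
    using assms[OF diff_in_dir_space[OF that]] by (simp add: inner_diff_right) linarith
  then show ?thesis by (auto simp: maximizers_def)
qed

lemma subset_maximizers_iff:
  assumes "\<And>e. e \<in> dir_space H \<Longrightarrow> c \<bullet> e = 0" "H \<subseteq> Q" "x0 \<in> H"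
  shows "H \<subseteq> maximizers Q c \<longleftrightarrow> (\<forall>y\<in>Q. c \<bullet> (y - x0) \<le> 0)"
proof -
  have "c \<bullet> x = c \<bullet> x0" if "x \<in> H" for x
    using assms(1)[OF diff_in_dir_space[OF that assms(3)]] by (simp add: inner_diff_right)
  note eq = this
  show ?thesis
  proof
    assume "H \<subseteq> maximizers Q c"
    then show "\<forall>y\<in>Q. c \<bullet> (y - x0) \<le> 0"
      using assms(3) by (auto simp: maximizers_def inner_diff_right)
  next
    assume *: "\<forall>y\<in>Q. c \<bullet> (y - x0) \<le> 0"
    show "H \<subseteq> maximizers Q c"
    proof
      fix x assume "x \<in> H"
      then show "x \<in> maximizers Q c"
        using eq[of x] * assms(2) by (auto simp: maximizers_def inner_diff_right)
    qed
  qed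
qed

lemma face_eq_if_aff_dim_le:
  fixes Q :: "'a::euclidean_space set"
  assumes "H face_of Q" "A face_of Q" "H \<subseteq> A" "aff_dim A \<le> aff_dim H"
  shows "H = A"
  using assms face_of_aff_dim_lt[of A H]
  by (metis face_of_imp_convex face_of_imp_subset face_of_subset not_less)

text \<open>
  The vector \<open>e\<close> points out of \<open>A\<close> across its facet \<open>H\<close>: modulo the direction space of \<open>H\<close>, every
  \<open>x - y\<close> with \<open>x\<close> in \<open>H\<close> and \<open>y\<close> in \<open>A\<close> outside of \<open>H\<close> is a positive multiple of the outward normal.
\<close>

definition exits :: "'a::real_vector set \<Rightarrow> 'a set \<Rightarrow> 'a \<Rightarrow> bool" where
  "exits A H e \<longleftrightarrow> (\<exists>t>0. \<exists>x\<in>H. \<exists>y\<in>A - H. e - t *\<^sub>R (x - y) \<in> dir_space H)"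

text \<open>
  A facet has codimension one and lies in a supporting hyperplane of \<open>A\<close>, so the coefficient of
  \<open>e\<close> along \<open>x - y\<close> has the sign of the outer normal evaluated at \<open>e\<close>; in particular its sign
  does not depend on \<open>x\<close> and \<open>y\<close>.
\<close>

lemma facet_complement:
  fixes A :: "'a::euclidean_space set"
  assumes "polyhedron A" "H facet_of A" "x \<in> H" "y \<in> A - H" "e \<in> dir_space A"
  obtains t where "e - t *\<^sub>R (x - y) \<in> dir_space H" "exits A H e \<longleftrightarrow> t > 0"
    "exits A H (- e) \<longleftrightarrow> t < 0" "e \<in> dir_space H \<longleftrightarrow> t = 0"
proof -
  have H: "H face_of A" "H \<noteq> {}" "aff_dim H = aff_dim A - 1"
    using assms(2) by (auto simp: facet_of_def)
  then have HA: "H \<subseteq> A" by (simp add: face_of_imp_subset)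
  have "H exposed_face_of A"
    using H(1) assms(1) by (simp add: exposed_face_of_polyhedron)
  then obtain a b where ab: "A \<subseteq> {x. a \<bullet> x \<le> b}" "H = A \<inter> {x. a \<bullet> x = b}"
    by (auto simp: exposed_face_of_def)
  have a0: "a \<bullet> h = 0" if "h \<in> dir_space H" for h
    by (rule orthogonal_dir_space[OF _ that]) (use ab(2) in auto)
  \<comment> \<open>The normal \<open>a\<close> of a supporting hyperplane that cuts out \<open>H\<close> is positive on all outward vectors.\<close>
  have apos: "a \<bullet> (x' - y') > 0" if "x' \<in> H" "y' \<in> A - H" for x' y'
  proof -
    have "a \<bullet> y' \<le> b" "a \<bullet> y' \<noteq> b" "a \<bullet> x' = b" using that ab by auto
    then show ?thesis by (simp add: inner_diff_right)
  qed
  have pos: "a \<bullet> (x - y) > 0" using apos assms by blast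
  then have nin: "x - y \<notin> dir_space H" using a0 by force
  have "span (insert (x - y) (dir_space H)) = span (dir_space A)"
  proof (rule dim_eq_span)
    show "insert (x - y) (dir_space H) \<subseteq> dir_space A"
      using dir_space_mono[OF HA] assms HA by (auto intro: diff_in_dir_space)
    have "int (dim (dir_space A)) = int (dim (dir_space H)) + 1"
      using dim_dir_space[OF H(2)] dim_dir_space[of A] H HA by auto
    then show "dim (dir_space A) \<le> dim (insert (x - y) (dir_space H))"
      using nin by (simp add: dim_insert span_eq_iff[THEN iffD2, OF subspace_dir_space])
  qed
  then obtain t where t: "e - t *\<^sub>R (x - y) \<in> dir_space H"
    using assms(5) span_breakdown_eq[of e "x - y" "dir_space H"]
      span_eq_iff[THEN iffD2, OF subspace_dir_space[of A]]
      span_eq_iff[THEN iffD2, OF subspace_dir_space[of H]] by auto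
  have ae: "a \<bullet> e = t * (a \<bullet> (x - y))"
    using a0[OF t] by (simp add: inner_diff_right)
  have ex: "exits A H e' \<Longrightarrow> a \<bullet> e' > 0" for e'
  proof -
    assume "exits A H e'"
    then obtain s x' y' where s: "s > 0" "x' \<in> H" "y' \<in> A - H" "e' - s *\<^sub>R (x' - y') \<in> dir_space H"
      by (auto simp: exits_def)
    have "a \<bullet> e' = s * (a \<bullet> (x' - y'))"
      using a0[OF s(4)] by (simp add: inner_diff_right)
    then show ?thesis using s(1) apos[OF s(2,3)] by simp
  qed
  have 1: "exits A H e \<longleftrightarrow> t > 0"
  proof
    assume "exits A H e"
    then show "t > 0" using ex[of e] ae pos by (simp add: zero_less_mult_iff)
  next
    assume "t > 0"
    then show "exits A H e" using t assms by (auto simp: exits_def)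
  qed
  have t': "- e - (- t) *\<^sub>R (x - y) \<in> dir_space H"
    using subspace_neg[OF subspace_dir_space t] by simp
  have 2: "exits A H (- e) \<longleftrightarrow> t < 0"
  proof
    assume "exits A H (- e)"
    then have "- (t * (a \<bullet> (x - y))) > 0" using ex[of "- e"] ae by simp
    then show "t < 0" using pos by (simp add: mult_less_0_iff)
  next
    assume "t < 0"
    then show "exits A H (- e)"
      unfolding exits_def using t' assms by (intro exI[of _ "- t"] bexI[of _ x] bexI[of _ y] conjI) auto
  qed
  have 3: "e \<in> dir_space H \<longleftrightarrow> t = 0"
  proof
    assume "e \<in> dir_space H"
    then show "t = 0" using a0 ae pos by force
  next
    assume "t = 0" then show "e \<in> dir_space H" using t by simp
  qed
  show ?thesis by (rule that[OF t 1 2 3])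
qed

section \<open>Entrances and departures of an affine path\<close>

lemma affine_signs_persist_left:
  fixes \<alpha> \<beta> :: "'i \<Rightarrow> real"
  assumes "finite S" "\<forall>y\<in>S. \<alpha> y + t * \<beta> y \<le> 0" "\<forall>y\<in>S. \<alpha> y + t * \<beta> y = 0 \<longrightarrow> \<beta> y \<ge> 0"
    and "l < t"
  obtains s where "l < s" "s < t" "\<forall>y\<in>S. \<alpha> y + s * \<beta> y \<le> 0"
proof -
  have "eventually (\<lambda>s. \<alpha> y + s * \<beta> y \<le> 0) (at_left t)" if "y \<in> S" for y
  proof (cases "\<alpha> y + t * \<beta> y = 0")
    case True
    then have "\<alpha> y = - (t * \<beta> y)" "\<beta> y \<ge> 0" using assms(3) that by auto
    then have "\<alpha> y + s * \<beta> y \<le> 0" if "s < t" for s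
      using that mult_right_mono[of s t "\<beta> y"] by simp
    then show ?thesis by (auto simp: eventually_at_left_field intro: exI[of _ "t - 1"])
  next
    case False
    then have "\<alpha> y + t * \<beta> y < 0" using assms(2) that by force
    moreover have "((\<lambda>s. \<alpha> y + s * \<beta> y) \<longlongrightarrow> \<alpha> y + t * \<beta> y) (at_left t)"
      by (intro tendsto_intros)
    ultimately have "eventually (\<lambda>s. \<alpha> y + s * \<beta> y < 0) (at_left t)"
      by (metis order_tendstoD(2))
    then show ?thesis by (rule eventually_mono) simp
  qed
  then have "eventually (\<lambda>s. \<forall>y\<in>S. \<alpha> y + s * \<beta> y \<le> 0) (at_left t)"
    using assms(1) by (simp add: eventually_ball_finite)
  moreover have "eventually (\<lambda>s. s \<in> {l<..<t}) (at_left t)"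
    using assms(4) by (rule eventually_at_left_real)
  ultimately have "eventually (\<lambda>s. s \<in> {l<..<t} \<and> (\<forall>y\<in>S. \<alpha> y + s * \<beta> y \<le> 0)) (at_left t)"
    by (simp add: eventually_conj_iff)
  from eventually_happens'[OF _ this] obtain s
    where "s \<in> {l<..<t}" "\<forall>y\<in>S. \<alpha> y + s * \<beta> y \<le> 0" by auto
  then show ?thesis using that by auto
qed

text \<open>
  The solution set of finitely many affine inequalities is a closed interval, and \<open>t\<close> is its left
  endpoint iff some inequality is tight at \<open>t\<close> with negative slope. The hypothesis at \<open>1\<close> keeps the
  left endpoint, which has to lie strictly between \<open>0\<close> and \<open>1\<close> to be counted, away from \<open>1\<close>.
\<close>

lemma count_entrances:
  fixes \<alpha> \<beta> :: "'i \<Rightarrow> real"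
  assumes "finite S"
    and I: "\<And>t. I t \<longleftrightarrow> (\<forall>y\<in>S. \<alpha> y + t * \<beta> y \<le> 0)"
    and end1: "\<And>y. I 1 \<Longrightarrow> y \<in> S \<Longrightarrow> \<alpha> y + \<beta> y = 0 \<Longrightarrow> \<beta> y = 0"
  shows "card {t. 0 < t \<and> t < 1 \<and> I t \<and> (\<exists>y\<in>S. \<alpha> y + t * \<beta> y = 0 \<and> \<beta> y < 0)} =
    of_bool (\<not> I 0 \<and> (\<exists>t\<in>{0..1}. I t))" (is "card ?E = _")
proof (cases "\<not> I 0 \<and> (\<exists>t\<in>{0..1}. I t)")
  case False
  have "?E = {}"
  proof (rule ccontr)
    assume "?E \<noteq> {}"
    then obtain t y where t: "0 < t" "t < 1" "I t" "y \<in> S" "\<alpha> y + t * \<beta> y = 0" "\<beta> y < 0"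
      by auto
    then have "I 0" using False by force
    then have "\<alpha> y \<le> 0" using t I[of 0] by simp
    moreover have "t * \<beta> y < 0" using t by (simp add: mult_less_0_iff)
    ultimately show False using t by linarith
  qed
  then have "card ?E = 0" by (simp only: card.empty)
  then show ?thesis using False by (simp only: of_bool_eq simp_thms)
next
  case True
  have "closed {t. I t}"
    unfolding I Collect_ball_eq using assms(1)
    by (intro closed_INT ballI closed_Collect_le continuous_intros)
  then have "compact ({0..1} \<inter> {t. I t})"
    using compact_Int_closed[OF compact_Icc] by blast
  moreover have "{0..1} \<inter> {t. I t} \<noteq> {}" using True by blast
  ultimately obtain a where a: "a \<in> {0..1} \<inter> {t. I t}" "\<And>t. t \<in> {0..1} \<inter> {t. I t} \<Longrightarrow> a \<le> t"
    using compact_attains_inf by metis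
  have a0: "a > 0" using a(1) True by (cases "a = 0") auto
  have ent: "\<exists>y\<in>S. \<alpha> y + a * \<beta> y = 0 \<and> \<beta> y < 0"
  proof (rule ccontr)
    assume "\<not> ?thesis"
    then have "\<forall>y\<in>S. \<alpha> y + a * \<beta> y = 0 \<longrightarrow> \<beta> y \<ge> 0" by force
    then obtain s where "0 < s" "s < a" "\<forall>y\<in>S. \<alpha> y + s * \<beta> y \<le> 0"
      using affine_signs_persist_left[OF assms(1), of \<alpha> a \<beta> 0] a a0 I by blast
    then show False using a(2)[of s] I a(1) by auto
  qed
  have a1: "a < 1"
  proof (rule ccontr)
    assume "\<not> a < 1"
    then have "a = 1" using a(1) by auto
    then show False using ent end1 a(1) by fastforce
  qed
  have "?E = {a}"
  proof
    show "{a} \<subseteq> ?E" using a a0 a1 ent by auto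
    show "?E \<subseteq> {a}"
    proof clarsimp
      fix t y assume t: "0 < t" "t < 1" "I t" "y \<in> S" "\<alpha> y + t * \<beta> y = 0" "\<beta> y < 0"
      have "a \<le> t" using a(2)[of t] t by auto
      moreover have "\<not> a < t"
      proof
        assume "a < t"
        then have "a * \<beta> y > t * \<beta> y" using t(6) by simp
        then have "\<alpha> y + a * \<beta> y > 0" using t(5) by linarith
        moreover have "I a" using a(1) by simp
        ultimately show False using t(4) I[of a] by (meson not_less)
      qed
      ultimately show "t = a" by simp
    qed
  qed
  then have "card ?E = 1" by (simp only: is_singletonI is_singleton_altdef[symmetric])
  then show ?thesis using True by (simp only: of_bool_eq simp_thms)
qed

text \<open>
  An interval inside \<open>[0, 1]\<close> is entered and left once each, except that an endpoint at \<open>0\<close> or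
  \<open>1\<close> is not counted.
\<close>

lemma count_crossings:
  fixes \<alpha> \<beta> :: "'i \<Rightarrow> real"
  assumes "finite S"
    and I: "\<And>t. I t \<longleftrightarrow> (\<forall>y\<in>S. \<alpha> y + t * \<beta> y \<le> 0)"
    and end0: "\<And>y. I 0 \<Longrightarrow> y \<in> S \<Longrightarrow> \<alpha> y = 0 \<Longrightarrow> \<beta> y = 0"
    and end1: "\<And>y. I 1 \<Longrightarrow> y \<in> S \<Longrightarrow> \<alpha> y + \<beta> y = 0 \<Longrightarrow> \<beta> y = 0"
  shows "real (card {t. 0 < t \<and> t < 1 \<and> I t \<and> (\<exists>y\<in>S. \<alpha> y + t * \<beta> y = 0 \<and> \<beta> y < 0)}) -
      real (card {t. 0 < t \<and> t < 1 \<and> I t \<and> (\<exists>y\<in>S. \<alpha> y + t * \<beta> y = 0 \<and> \<beta> y > 0)}) =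
    of_bool (I 1) - of_bool (I 0)" (is "real (card ?E) - real (card ?L) = _")
proof -
  \<comment> \<open>Reversing the parameter turns departures into entrances.\<close>
  let ?L' = "{t. 0 < t \<and> t < 1 \<and> I (1 - t) \<and>
      (\<exists>y\<in>S. (\<alpha> y + \<beta> y) + t * (- \<beta> y) = 0 \<and> - \<beta> y < 0)}"
  have "card ?L' = of_bool (\<not> I (1 - 0) \<and> (\<exists>t\<in>{0..1}. I (1 - t)))"
    by (rule count_entrances[OF assms(1)]) (use I end0 in \<open>auto simp: algebra_simps\<close>)
  moreover have "card ?L = card ?L'"
  proof (rule bij_betw_same_card)
    show "bij_betw (\<lambda>t. 1 - t) ?L ?L'"
      by (rule bij_betw_byWitness[where f' = "\<lambda>t. 1 - t"]) (auto simp: algebra_simps)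
  qed
  moreover have "card ?E = of_bool (\<not> I 0 \<and> (\<exists>t\<in>{0..1}. I t))"
    by (rule count_entrances[OF assms(1) I end1])
  moreover have "(\<exists>t\<in>{0..1}. I (1 - t)) \<longleftrightarrow> (\<exists>t\<in>{0..1}. I t)"
  proof
    assume "\<exists>t\<in>{0..1}. I (1 - t)"
    then obtain t where "t \<in> {0..1}" "I (1 - t)" by blast
    then show "\<exists>t\<in>{0..1}. I t" by (intro bexI[of _ "1 - t"]) auto
  next
    assume "\<exists>t\<in>{0..1}. I t"
    then obtain t where "t \<in> {0..1}" "I t" by blast
    then show "\<exists>t\<in>{0..1}. I (1 - t)" by (intro bexI[of _ "1 - t"]) auto
  qed
  moreover have "I 0 \<or> I 1 \<Longrightarrow> \<exists>t\<in>{0..1}. I t" by force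
  ultimately show ?thesis by (auto simp: of_bool_def)
qed

section \<open>Faces selected by functionals with a prescribed restriction\<close>

text \<open>
  Every functional is the sum of one that vanishes on \<open>S\<close> and one that vanishes on \<open>T\<close>, because a
  vector orthogonal to all such sums lies in \<open>S \<inter> T\<close>.
\<close>

lemma exists_orthogonal_splitting:
  fixes S T :: "'a::euclidean_space set"
  assumes "subspace S" "subspace T" "S \<inter> T = {0}"
  obtains c where "\<And>x. x \<in> S \<Longrightarrow> c \<bullet> x = 0" "\<And>x. x \<in> T \<Longrightarrow> c \<bullet> x = \<phi> \<bullet> x"
proof -
  define P where "P = {a + b | a b. (\<forall>x\<in>S. x \<bullet> a = 0) \<and> (\<forall>x\<in>T. x \<bullet> b = 0)}"
  have S': "subspace {a. \<forall>x\<in>S. x \<bullet> a = 0}" and T': "subspace {a. \<forall>x\<in>T. x \<bullet> a = 0}"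
    by (auto simp: subspace_def inner_add_right)
  have sP: "subspace P"
    using subspace_sums[OF S' T'] by (simp add: P_def)
  have "P = UNIV"
  proof (rule ccontr)
    assume "P \<noteq> UNIV"
    then have "span P \<subset> span UNIV"
      using sP by (metis span_UNIV span_eq_iff top.not_eq_extremum)
    then obtain z where z: "z \<noteq> 0" "\<And>y. y \<in> span P \<Longrightarrow> z \<bullet> y = 0"
      using orthogonal_to_subspace_exists_gen[of P UNIV]
      by (metis Linear_Algebra.orthogonal_def)
    have "z \<in> S"
      if "subspace S" "\<forall>y. (\<forall>x\<in>S. x \<bullet> y = 0) \<longrightarrow> y \<in> P" for S
    proof -
      obtain y w where yw: "z = y + w" "y \<in> span S" "\<And>x. x \<in> span S \<Longrightarrow> w \<bullet> x = 0"
        using orthogonal_subspace_decomp_exists[of S z] by (metis Linear_Algebra.orthogonal_def)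
      have "w \<in> P" using that yw(3) by (metis inner_commute span_base)
      then have "z \<bullet> w = 0" using z(2) span_base by blast
      moreover have "w \<bullet> y = 0" using yw by blast
      ultimately have "w \<bullet> w = 0"
        using yw(1) by (simp add: inner_add_left inner_add_right inner_commute)
      then show ?thesis using yw that(1) by (metis add.right_neutral inner_eq_zero_iff span_eq_iff)
    qed
    moreover have "y \<in> P" if "\<forall>x\<in>S. x \<bullet> y = 0" for y
      unfolding P_def using that by (intro CollectI exI[of _ y] exI[of _ 0]) auto
    moreover have "y \<in> P" if "\<forall>x\<in>T. x \<bullet> y = 0" for y
      unfolding P_def using that by (intro CollectI exI[of _ 0] exI[of _ y]) auto
    ultimately have "z \<in> S \<inter> T" using assms by blast
    with assms(3) z(1) show False by blast
  qed
  then obtain a b where ab: "\<phi> = a + b" "\<forall>x\<in>S. x \<bullet> a = 0" "\<forall>x\<in>T. x \<bullet> b = 0"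
    unfolding P_def by blast
  show ?thesis
    by (rule that[of a]) (use ab in \<open>auto simp: inner_commute inner_add_right\<close>)
qed

lemma sum_subset_of_bool:
  fixes m :: "'a \<Rightarrow> 'b::real_vector"
  assumes "finite T" "X \<subseteq> T"
  shows "(\<Sum>H\<in>X. m H) = (\<Sum>H\<in>T. (of_bool (H \<in> X) :: real) *\<^sub>R m H)"
  by (rule sum.mono_neutral_cong_left) (use assms in auto)

lemma negligible_orthogonal:
  fixes L :: "'a::euclidean_space set"
  assumes "e \<in> L" "e \<noteq> 0"
  shows "negligible {z. \<forall>x\<in>L. z \<bullet> x = 0}"
proof (rule negligible_subset)
  show "negligible {z. e \<bullet> z = 0}" by (rule negligible_hyperplane) (use assms in auto)
qed (use assms in \<open>auto simp: inner_commute\<close>)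

text \<open>
  The lines through \<open>w\<close> and a point of the orthogonal complement of \<open>L\<close> lie in a proper
  subspace, since a complement of codimension at least two leaves room for a vector \<open>e\<close> of \<open>L\<close>
  that is orthogonal to \<open>w\<close>.
\<close>

lemma negligible_cone_over_orthogonal:
  fixes L :: "'a::euclidean_space set"
  assumes "subspace L" "dim L \<ge> 2"
  shows "negligible {z. \<exists>s. s \<noteq> 1 \<and> (\<forall>x\<in>L. (s *\<^sub>R w + (1 - s) *\<^sub>R z) \<bullet> x = 0)}"
proof -
  obtain e where e: "e \<in> L" "e \<noteq> 0" "w \<bullet> e = 0"
  proof -
    have nsub: "\<not> L \<subseteq> span {v}" for v
    proof
      assume "L \<subseteq> span {v}"
      then have "dim L \<le> dim (span {v})" by (rule dim_subset)
      also have "\<dots> \<le> 1" unfolding dim_span by (simp add: dim_singleton)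
      finally show False using assms(2) by simp
    qed
    obtain a where a: "a \<in> L" "a \<noteq> 0" using nsub[of 0] by auto
    obtain b where b: "b \<in> L" "b \<notin> span {a}" using nsub[of a] by blast
    note ab = a(1) b a(2)
    show ?thesis
    proof (cases "w \<bullet> a = 0")
      case True
      then show ?thesis using that ab by blast
    next
      case False
      let ?e = "b - ((w \<bullet> b) / (w \<bullet> a)) *\<^sub>R a"
      have "?e \<in> L" using ab assms(1) by (simp add: subspace_diff subspace_scale)
      moreover have "?e \<noteq> 0"
      proof
        assume "?e = 0"
        then have "b = ((w \<bullet> b) / (w \<bullet> a)) *\<^sub>R a" by simp
        then show False using ab(3) by (metis insertI1 span_base span_scale)
      qed
      moreover have "w \<bullet> ?e = 0" using False by (simp add: inner_diff_right)
      ultimately show ?thesis using that by blast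
    qed
  qed
  show ?thesis
  proof (rule negligible_subset)
    show "negligible {z. e \<bullet> z = 0}" by (rule negligible_hyperplane) (use e in auto)
    show "{z. \<exists>s. s \<noteq> 1 \<and> (\<forall>x\<in>L. (s *\<^sub>R w + (1 - s) *\<^sub>R z) \<bullet> x = 0)} \<subseteq> {z. e \<bullet> z = 0}"
    proof clarify
      fix z s assume s: "s \<noteq> 1" "\<forall>x\<in>L. (s *\<^sub>R w + (1 - s) *\<^sub>R z) \<bullet> x = 0"
      then have "(s *\<^sub>R w + (1 - s) *\<^sub>R z) \<bullet> e = 0" using e(1) by blast
      then show "e \<bullet> z = 0"
        using s(1) e(3) by (simp add: inner_add_left inner_add_right inner_commute)
    qed
  qed
qed

text \<open>
  Only the restriction of \<open>\<phi>\<close> to \<open>\<Delta>\<close> matters. A face is selected iff its normal cone contains an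
  extension of this restriction, that is, iff the image of the normal cone in the dual of \<open>\<Delta>\<close>
  contains \<open>\<phi>\<close>.
\<close>

definition selected_faces ::
    "'a::euclidean_space set \<Rightarrow> 'a set \<Rightarrow> nat \<Rightarrow> 'a \<Rightarrow> 'a set set" where
  "selected_faces Q \<Delta> k \<phi> =
     {H. H face_of Q \<and> aff_dim H = int k \<and>
         (\<exists>c. (\<forall>x\<in>\<Delta>. c \<bullet> x = \<phi> \<bullet> x) \<and> H \<subseteq> maximizers Q c)}"

definition generic_functional ::
    "'a::euclidean_space set \<Rightarrow> 'a set \<Rightarrow> nat \<Rightarrow> 'a \<Rightarrow> bool" where
  "generic_functional Q \<Delta> k \<phi> \<longleftrightarrow>
     (\<forall>c. (\<forall>x\<in>\<Delta>. c \<bullet> x = \<phi> \<bullet> x) \<and> aff_dim (maximizers Q c) \<ge> int k \<longrightarrow>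
        aff_dim (maximizers Q c) = int k \<and> dir_space (maximizers Q c) \<inter> \<Delta> = {0})"

text \<open>
  The balancing condition for the weighted normal fan, projected to the dual of \<open>\<Delta>\<close>. The normal cone of a
  face \<open>A\<close> of dimension \<open>k + 1\<close> maps into a hyperplane when \<open>\<Delta>\<close> meets the direction of \<open>A\<close> in a line, and
  the normal cones of the facets through which the line leaves or enters map to opposite sides of it.
\<close>

definition balanced_weight ::
    "'a::euclidean_space set \<Rightarrow> 'a set \<Rightarrow> nat \<Rightarrow> ('a set \<Rightarrow> 'b::real_vector) \<Rightarrow> bool" where
  "balanced_weight Q \<Delta> k m \<longleftrightarrow>
     (\<forall>A e. A face_of Q \<and> aff_dim A = int k + 1 \<and> e \<noteq> 0 \<and> dir_space A \<inter> \<Delta> = span {e} \<longrightarrow>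
        (\<Sum>H | H facet_of A \<and> exits A H e. m H) = (\<Sum>H | H facet_of A \<and> exits A H (- e). m H))"

definition transverse_faces ::
    "'a::euclidean_space set \<Rightarrow> 'a set \<Rightarrow> nat \<Rightarrow> 'a set set" where
  "transverse_faces Q \<Delta> k =
     {H. H face_of Q \<and> aff_dim H = int k \<and> dir_space H \<inter> \<Delta> = {0}}"

text \<open>
  For a generic restriction the selecting functional lies in the relative interior of the normal
  cone of the selected face.
\<close>

lemma selected_face_eq_maximizers:
  assumes "convex Q" "generic_functional Q \<Delta> k \<phi>" "H face_of Q" "aff_dim H = int k"
    "\<forall>x\<in>\<Delta>. c \<bullet> x = \<phi> \<bullet> x" "H \<subseteq> maximizers Q c"
  shows "H = maximizers Q c" "H \<in> transverse_faces Q \<Delta> k"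
proof -
  have "aff_dim (maximizers Q c) \<ge> int k" using aff_dim_subset[OF assms(6)] assms(4) by simp
  then have *: "aff_dim (maximizers Q c) = int k" "dir_space (maximizers Q c) \<inter> \<Delta> = {0}"
    using assms(2,5) by (auto simp: generic_functional_def)
  then show H: "H = maximizers Q c"
    using face_eq_if_aff_dim_le[OF assms(3) maximizers_face_of[OF assms(1)] assms(6)] assms(4) by simp
  show "H \<in> transverse_faces Q \<Delta> k"
    using * H assms(3,4) by (simp add: transverse_faces_def)
qed

text \<open>
  The dimension formula makes a \<open>k\<close>-face transverse to \<open>\<Delta>\<close> complementary to it, so that the selecting
  functional is determined on the direction space of \<open>Q\<close> by its restriction to \<open>\<Delta>\<close>.
\<close>

locale sliced_polytope =
  fixes Q \<Delta> :: "'a::euclidean_space set" and k :: nat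
  assumes polytope_Q: "polytope Q" and subspace_\<Delta>: "subspace \<Delta>"
    and \<Delta>_subset: "\<Delta> \<subseteq> dir_space Q" and nonempty_Q: "Q \<noteq> {}"
    and dim_Q: "dim (dir_space Q) = dim \<Delta> + k"
begin

lemma convex_Q: "convex Q" and compact_Q: "compact Q"
  using polytope_Q by (auto intro: polytope_imp_convex polytope_imp_compact)

lemma finite_transverse_faces: "finite (transverse_faces Q \<Delta> k)"
  by (rule finite_subset[OF _ finite_polytope_faces[OF polytope_Q]]) (auto simp: transverse_faces_def)

lemma dim_face_Int:
  assumes "A face_of Q" "A \<noteq> {}"
  shows "aff_dim A \<le> int k + int (dim (dir_space A \<inter> \<Delta>))"
proof -
  have "dim {x + y |x y. x \<in> dir_space A \<and> y \<in> \<Delta>} \<le> dim (dir_space Q)"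
    using dir_space_mono[OF face_of_imp_subset[OF assms(1)]] \<Delta>_subset
    by (intro dim_subset) (auto intro: subspace_add[OF subspace_dir_space])
  then show ?thesis
    using dim_sums_Int[OF subspace_dir_space[of A] subspace_\<Delta>] dim_Q dim_dir_space[OF assms(2)]
      by linarith
qed

lemma transverse_span:
  assumes "H \<in> transverse_faces Q \<Delta> k"
    and "\<And>x. x \<in> dir_space H \<Longrightarrow> c \<bullet> x = 0" "\<And>x. x \<in> \<Delta> \<Longrightarrow> c \<bullet> x = 0"
    and "e \<in> dir_space Q"
  shows "c \<bullet> e = 0"
proof -
  have H: "H face_of Q" "aff_dim H = int k" "dir_space H \<inter> \<Delta> = {0}"
    using assms(1) by (auto simp: transverse_faces_def)
  have "H \<noteq> {}" using H(2) by auto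
  then have "dim (dir_space H) = k" using dim_dir_space[of H] H(2) by simp
  then have "dim {x + y |x y. x \<in> dir_space H \<and> y \<in> \<Delta>} = dim (dir_space Q)"
    using dim_sums_Int[OF subspace_dir_space[of H] subspace_\<Delta>] dim_Q H(3) by simp
  moreover have "{x + y |x y. x \<in> dir_space H \<and> y \<in> \<Delta>} \<subseteq> dir_space Q"
    using dir_space_mono[OF face_of_imp_subset[OF H(1)]] \<Delta>_subset
    by (auto intro: subspace_add[OF subspace_dir_space])
  ultimately have "{x + y |x y. x \<in> dir_space H \<and> y \<in> \<Delta>} = dir_space Q"
    by (intro subspace_dim_equal subspace_sums subspace_dir_space subspace_\<Delta>) auto
  then obtain x y where "e = x + y" "x \<in> dir_space H" "y \<in> \<Delta>" using assms(4) by blast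
  then show ?thesis using assms(2,3) by (simp add: inner_add_right)
qed

text \<open>
  Two functionals that are constant on \<open>H\<close> and agree on \<open>\<Delta>\<close> agree on all directions of \<open>Q\<close>, which are
  sums of directions of \<open>H\<close> and elements of \<open>\<Delta>\<close>.
\<close>

lemma maximizers_unique:
  assumes "H \<in> transverse_faces Q \<Delta> k"
    and "\<And>x. x \<in> dir_space H \<Longrightarrow> c \<bullet> x = 0" "\<forall>x\<in>\<Delta>. c \<bullet> x = \<phi> \<bullet> x"
    and "\<forall>x\<in>\<Delta>. c' \<bullet> x = \<phi> \<bullet> x" "H \<subseteq> maximizers Q c'"
  shows "maximizers Q c' = maximizers Q c"
proof (rule maximizers_cong)
  fix e assume e: "e \<in> dir_space Q"
  have "(c' - c) \<bullet> e = 0"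
  proof (rule transverse_span[OF assms(1) _ _ e])
    fix x assume "x \<in> dir_space H"
    then show "(c' - c) \<bullet> x = 0"
      using assms(2) orthogonal_maximizers dir_space_mono[OF assms(5)] by (fastforce simp: inner_diff_left)
  next
    fix x assume "x \<in> \<Delta>"
    then show "(c' - c) \<bullet> x = 0" using assms by (simp add: inner_diff_left)
  qed
  then show "c' \<bullet> e = c \<bullet> e" by (simp add: inner_diff_left)
qed

lemma selected_iff:
  assumes "H \<in> transverse_faces Q \<Delta> k"
    and "\<And>x. x \<in> dir_space H \<Longrightarrow> c \<bullet> x = 0" "\<forall>x\<in>\<Delta>. c \<bullet> x = \<phi> \<bullet> x"
  shows "H \<in> selected_faces Q \<Delta> k \<phi> \<longleftrightarrow> H \<subseteq> maximizers Q c"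
proof
  assume "H \<in> selected_faces Q \<Delta> k \<phi>"
  then obtain c' where "\<forall>x\<in>\<Delta>. c' \<bullet> x = \<phi> \<bullet> x" "H \<subseteq> maximizers Q c'"
    unfolding selected_faces_def by blast
  then show "H \<subseteq> maximizers Q c" using maximizers_unique[OF assms] by metis
next
  assume "H \<subseteq> maximizers Q c"
  then show "H \<in> selected_faces Q \<Delta> k \<phi>"
    unfolding selected_faces_def using assms(1,3) unfolding transverse_faces_def by blast
qed

text \<open>
  While the restriction moves from \<open>\<phi>\<close> in a generic direction \<open>d\<close>, the selected faces can change only when
  a functional with this restriction is maximal on a face \<open>A\<close> of dimension \<open>k + 1\<close>.
\<close>

definition wall :: "'a \<Rightarrow> 'a \<Rightarrow> real \<Rightarrow> 'a set \<Rightarrow> bool" where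
  "wall \<phi> d t A \<longleftrightarrow> 0 < t \<and> t < 1 \<and> A face_of Q \<and> aff_dim A = int k + 1 \<and>
     (\<exists>e. e \<noteq> 0 \<and> dir_space A \<inter> \<Delta> = span {e}) \<and>
     (\<exists>c. (\<forall>x\<in>\<Delta>. c \<bullet> x = (\<phi> + t *\<^sub>R d) \<bullet> x) \<and> A = maximizers Q c)"

text \<open>
  The line in which \<open>\<Delta>\<close> meets the direction of \<open>A\<close>, directed so that the motion increases the value on it.
\<close>

definition wall_dir :: "'a \<Rightarrow> 'a set \<Rightarrow> 'a" where
  "wall_dir d A = (SOME e. dir_space A \<inter> \<Delta> = span {e} \<and> d \<bullet> e > 0)"

lemma wall_dir:
  assumes "e \<noteq> 0" "dir_space A \<inter> \<Delta> = span {e}"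
    and "\<exists>x\<in>dir_space A \<inter> \<Delta>. d \<bullet> x \<noteq> 0"
  shows "dir_space A \<inter> \<Delta> = span {wall_dir d A}" "d \<bullet> wall_dir d A > 0"
proof -
  have "d \<bullet> e \<noteq> 0" using assms(2,3) by (auto simp: span_singleton)
  have "- e \<in> span {e}" by (intro span_neg span_base) simp
  moreover have "e \<in> span {- e}" using span_neg[OF span_base[of "- e" "{- e}"]] by simp
  ultimately have neg: "span {- e} = span {e}" unfolding span_eq by simp
  have "\<exists>e. dir_space A \<inter> \<Delta> = span {e} \<and> d \<bullet> e > 0"
  proof (cases "d \<bullet> e > 0")
    case True
    then show ?thesis using assms(2) by blast
  next
    case False
    then have "d \<bullet> (- e) > 0" using \<open>d \<bullet> e \<noteq> 0\<close> by simp
    then show ?thesis using assms(2) neg by metis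
  qed
  then show "dir_space A \<inter> \<Delta> = span {wall_dir d A}" "d \<bullet> wall_dir d A > 0"
    unfolding wall_dir_def by (metis (mono_tags, lifting) someI_ex)+
qed

text \<open>
  The functional \<open>c0 + t c1\<close> is the one that is constant on \<open>H\<close> and has the restriction \<open>\<phi> + t d\<close>. If
  one of the inequalities that express its maximality on \<open>H\<close> is tight with nonzero slope, then the
  maximizers form a larger face \<open>A\<close>, and the avoidance of double intersections forces its dimension to
  be \<open>k + 1\<close>. The sign \<open>\<sigma>\<close> treats entrances (\<open>\<sigma> = 1\<close>) and departures (\<open>\<sigma> = -1\<close>) at once.
\<close>

lemma crossing_iff_wall:
  assumes path: "\<And>A t. A face_of Q \<Longrightarrow> dim (dir_space A \<inter> \<Delta>) \<ge> 2 \<Longrightarrow> 0 < t \<Longrightarrow> t < 1 \<Longrightarrow>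
      \<exists>x\<in>dir_space A \<inter> \<Delta>. (\<phi> + t *\<^sub>R d) \<bullet> x \<noteq> 0"
    and moving: "\<And>A. A face_of Q \<Longrightarrow> dir_space A \<inter> \<Delta> \<noteq> {0} \<Longrightarrow> \<exists>x\<in>dir_space A \<inter> \<Delta>. d \<bullet> x \<noteq> 0"
    and S: "finite S" "Q = convex hull S"
    and H: "H \<in> transverse_faces Q \<Delta> k" and x0: "x0 \<in> H"
    and c0: "\<And>x. x \<in> dir_space H \<Longrightarrow> c0 \<bullet> x = 0" "\<And>x. x \<in> \<Delta> \<Longrightarrow> c0 \<bullet> x = \<phi> \<bullet> x"
    and c1: "\<And>x. x \<in> dir_space H \<Longrightarrow> c1 \<bullet> x = 0" "\<And>x. x \<in> \<Delta> \<Longrightarrow> c1 \<bullet> x = d \<bullet> x"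
    and t: "0 < t" "t < 1" and \<sigma>: "\<sigma> = 1 \<or> \<sigma> = - 1"
  shows "H \<subseteq> maximizers Q (c0 + t *\<^sub>R c1) \<and>
      (\<exists>y\<in>S. (c0 + t *\<^sub>R c1) \<bullet> (y - x0) = 0 \<and> \<sigma> * (c1 \<bullet> (y - x0)) < 0) \<longleftrightarrow>
    (\<exists>A. wall \<phi> d t A \<and> H facet_of A \<and> exits A H (\<sigma> *\<^sub>R wall_dir d A))" (is "?L \<longleftrightarrow> ?R")
proof -
  let ?c = "c0 + t *\<^sub>R c1"
  have Hf: "H face_of Q" "aff_dim H = int k" "dir_space H \<inter> \<Delta> = {0}"
    using H by (auto simp: transverse_faces_def)
  have c: "?c \<bullet> x = 0" if "x \<in> dir_space H" for x
    using c0(1) c1(1) that by (simp add: inner_add_left)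
  have c\<Delta>: "\<forall>x\<in>\<Delta>. ?c \<bullet> x = (\<phi> + t *\<^sub>R d) \<bullet> x"
    using c0(2) c1(2) by (simp add: inner_add_left)
  have x0Q: "x0 \<in> Q" using x0 face_of_imp_subset[OF Hf(1)] by blast
  \<comment> \<open>The restriction to \<open>\<Delta>\<close> gives \<open>c1\<close> a positive value at the wall direction. Since \<open>c1\<close> vanishes on
    \<open>H\<close>, this value is the slope \<open>c1 \<bullet> (x0 - y)\<close> times the coefficient of the direction along \<open>x0 - y\<close>.\<close>
  have sign: "\<sigma> * (c1 \<bullet> (y - x0)) < 0 \<longleftrightarrow> exits A H (\<sigma> *\<^sub>R wall_dir d A)"
    if A: "A face_of Q" "H facet_of A" "e \<noteq> 0" "dir_space A \<inter> \<Delta> = span {e}" and y: "y \<in> A" "y \<notin> H" for A e y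
  proof -
    have "dir_space A \<inter> \<Delta> \<noteq> {0}" using A(3,4) span_base[of e "{e}"] by auto
    note w = wall_dir[OF A(3,4) moving[OF A(1) this]]
    have wA: "wall_dir d A \<in> dir_space A" "wall_dir d A \<in> \<Delta>"
      using w(1) span_base[of "wall_dir d A" "{wall_dir d A}"] by auto
    have "polyhedron A"
      using face_of_polyhedron_polyhedron[OF polytope_imp_polyhedron[OF polytope_Q] A(1)] .
    then obtain \<tau> where \<tau>: "wall_dir d A - \<tau> *\<^sub>R (x0 - y) \<in> dir_space H"
      "exits A H (wall_dir d A) \<longleftrightarrow> \<tau> > 0" "exits A H (- wall_dir d A) \<longleftrightarrow> \<tau> < 0"
      using facet_complement[OF _ A(2) x0 _ wA(1), of y] y by blast
    have "c1 \<bullet> wall_dir d A = \<tau> * (c1 \<bullet> (x0 - y))"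
      using c1(1)[OF \<tau>(1)] by (simp add: inner_diff_right)
    then have "- \<tau> * (c1 \<bullet> (y - x0)) > 0"
      using w(2) c1(2)[OF wA(2)] by (simp add: inner_diff_right algebra_simps)
    then show ?thesis using \<sigma> \<tau>(2,3) by (auto simp: zero_less_mult_iff mult_less_0_iff)
  qed
  show ?thesis
  proof
    assume ?L
    then obtain y where y: "H \<subseteq> maximizers Q ?c" "y \<in> S" "?c \<bullet> (y - x0) = 0"
        "\<sigma> * (c1 \<bullet> (y - x0)) < 0" by blast
    define A where "A = maximizers Q ?c"
    have A: "A face_of Q" using maximizers_face_of[OF convex_Q] by (simp add: A_def)
    have HA: "H \<subseteq> A" using y(1) by (simp add: A_def)
    have "y \<in> Q" using y(2) S(2) by (simp add: hull_inc)
    then have yA: "y \<in> A"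
      using HA x0 y(3) unfolding A_def maximizers_def by (auto simp: inner_diff_right)
    have yH: "y \<notin> H" using c1(1)[OF diff_in_dir_space[OF _ x0]] y(4) by fastforce
    have Ane: "A \<noteq> {}" using yA by blast
    have dimA: "aff_dim A \<ge> int k + 1"
      using face_eq_if_aff_dim_le[OF Hf(1) A HA] yA yH Hf(2) by fastforce
    have dimL: "\<not> dim (dir_space A \<inter> \<Delta>) \<ge> 2"
    proof
      assume "dim (dir_space A \<inter> \<Delta>) \<ge> 2"
      then obtain x where "x \<in> dir_space A" "x \<in> \<Delta>" "(\<phi> + t *\<^sub>R d) \<bullet> x \<noteq> 0"
        using path[OF A _ t] by blast
      then show False using orthogonal_maximizers[of x Q ?c] c\<Delta> unfolding A_def by metis
    qed
    then have dims: "aff_dim A = int k + 1" "dim (dir_space A \<inter> \<Delta>) = 1"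
      using dim_face_Int[OF A Ane] dimA by linarith+
    have sub: "subspace (dir_space A \<inter> \<Delta>)"
      by (intro subspace_inter subspace_dir_space subspace_\<Delta>)
    have "\<not> dir_space A \<inter> \<Delta> \<subseteq> {0}"
      using dims(2) dim_eq_0[of "dir_space A \<inter> \<Delta>"] by linarith
    then obtain e where e0: "e \<in> dir_space A \<inter> \<Delta>" "e \<noteq> 0" by blast
    have "span {e} \<subseteq> dir_space A \<inter> \<Delta>" using e0 sub by (intro span_minimal) auto
    then have "span {e} = dir_space A \<inter> \<Delta>"
      using dims(2) sub e0 by (intro subspace_dim_equal) (auto simp: dim_singleton)
    then have e: "e \<noteq> 0" "dir_space A \<inter> \<Delta> = span {e}" using e0 by auto
    have facet: "H facet_of A"
      using face_of_subset[OF Hf(1) HA face_of_imp_subset[OF A]] x0 Hf(2) dims(1)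
      by (auto simp: facet_of_def)
    have "wall \<phi> d t A"
      unfolding wall_def using t A dims(1) e c\<Delta> by (auto simp: A_def)
    then show ?R using sign[OF A facet e yA yH] y(4) facet by blast
  next
    assume ?R
    then obtain A e c' where A: "A face_of Q" "H facet_of A" "exits A H (\<sigma> *\<^sub>R wall_dir d A)"
        "aff_dim A = int k + 1" "e \<noteq> 0" "dir_space A \<inter> \<Delta> = span {e}"
        "\<forall>x\<in>\<Delta>. c' \<bullet> x = (\<phi> + t *\<^sub>R d) \<bullet> x" "A = maximizers Q c'"
      unfolding wall_def by blast
    have HA: "H \<subseteq> A" using A(2) by (simp add: facet_of_imp_subset)
    have Ac: "A = maximizers Q ?c"
      using maximizers_unique[OF H c c\<Delta> A(7)] HA A(8) by simp
    obtain S' where S': "S' \<subseteq> S" "A = convex hull S'"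
      using face_of_convex_hull_subset[of S A] S A(1) finite_imp_compact by blast
    have "\<not> S' \<subseteq> H"
    proof
      assume "S' \<subseteq> H"
      then have "A \<subseteq> H"
        using S'(2) face_of_imp_convex[OF Hf(1)] by (simp add: hull_minimal)
      then have "A = H" using HA by blast
      then show False using A(4) Hf(2) by simp
    qed
    then obtain y where y: "y \<in> S'" "y \<notin> H" by blast
    then have yA: "y \<in> A" using S'(2) by (simp add: hull_inc)
    have "?c \<bullet> (y - x0) = 0"
      using orthogonal_maximizers[of "y - x0" Q ?c] diff_in_dir_space[of y A x0] yA HA x0 Ac by blast
    moreover have "\<sigma> * (c1 \<bullet> (y - x0)) < 0"
      using sign[OF A(1,2,5,6) yA y(2)] A(3) by blast
    ultimately show ?L using HA Ac y(1) S'(1) by blast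
  qed
qed

text \<open>
  Every transverse face is selected for an interval of parameters, so its contribution to the
  difference of the two sums is the number of its entrances minus the number of its departures.
  Interchanging the sums over faces and walls leaves at each wall a difference
  that vanishes by balancing.
\<close>

lemma sum_selected_along_path:
  fixes m :: "'a set \<Rightarrow> 'b::real_vector"
  assumes path: "\<And>A t. A face_of Q \<Longrightarrow> dim (dir_space A \<inter> \<Delta>) \<ge> 2 \<Longrightarrow> 0 < t \<Longrightarrow> t < 1 \<Longrightarrow>
      \<exists>x\<in>dir_space A \<inter> \<Delta>. (\<phi> + t *\<^sub>R (\<psi> - \<phi>)) \<bullet> x \<noteq> 0"
    and moving: "\<And>A. A face_of Q \<Longrightarrow> dir_space A \<inter> \<Delta> \<noteq> {0} \<Longrightarrow>
      \<exists>x\<in>dir_space A \<inter> \<Delta>. (\<psi> - \<phi>) \<bullet> x \<noteq> 0"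
    and gen: "generic_functional Q \<Delta> k \<phi>" "generic_functional Q \<Delta> k \<psi>"
    and bal: "balanced_weight Q \<Delta> k m"
  shows "(\<Sum>H\<in>selected_faces Q \<Delta> k \<phi>. m H) = (\<Sum>H\<in>selected_faces Q \<Delta> k \<psi>. m H)"
proof -
  define d where "d = \<psi> - \<phi>"
  note path = path[folded d_def] and moving = moving[folded d_def]
  let ?T = "transverse_faces Q \<Delta> k"
  define W where "W = {A. \<exists>t. wall \<phi> d t A}"
  have finW: "finite W"
    by (rule finite_subset[OF _ finite_polytope_faces[OF polytope_Q]]) (auto simp: W_def wall_def)
  obtain S where S: "finite S" "Q = convex hull S"
    using polytope_Q by (auto simp: polytope_def)
  have Wdir: "d \<bullet> wall_dir d A > 0" "(\<phi> + t *\<^sub>R d) \<bullet> wall_dir d A = 0"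
      "wall_dir d A \<noteq> 0" "dir_space A \<inter> \<Delta> = span {wall_dir d A}" "A face_of Q" "aff_dim A = int k + 1"
    if wt: "wall \<phi> d t A" for t A
  proof -
    obtain e c where A: "A face_of Q" "aff_dim A = int k + 1" "e \<noteq> 0" "dir_space A \<inter> \<Delta> = span {e}"
        "\<forall>x\<in>\<Delta>. c \<bullet> x = (\<phi> + t *\<^sub>R d) \<bullet> x" "A = maximizers Q c"
      using wt unfolding wall_def by blast
    have "dir_space A \<inter> \<Delta> \<noteq> {0}" using A(3,4) span_base[of e "{e}"] by auto
    note w = wall_dir[OF A(3,4) moving[OF A(1) this]]
    have "wall_dir d A \<in> dir_space A \<inter> \<Delta>"
      unfolding w(1) by (rule span_base) simp
    then have "wall_dir d A \<in> dir_space (maximizers Q c)" "wall_dir d A \<in> \<Delta>"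
      using A(6) by auto
    then have "(\<phi> + t *\<^sub>R d) \<bullet> wall_dir d A = 0"
      using orthogonal_maximizers A(5) by metis
    then show "d \<bullet> wall_dir d A > 0" "(\<phi> + t *\<^sub>R d) \<bullet> wall_dir d A = 0"
      "wall_dir d A \<noteq> 0" "dir_space A \<inter> \<Delta> = span {wall_dir d A}" "A face_of Q" "aff_dim A = int k + 1"
      using w A(1,2) by auto
  qed
  have jump: "of_bool (H \<in> selected_faces Q \<Delta> k \<psi>) - of_bool (H \<in> selected_faces Q \<Delta> k \<phi>) =
     (\<Sum>A\<in>W. of_bool (H facet_of A \<and> exits A H (wall_dir d A)) -
        of_bool (H facet_of A \<and> exits A H (- wall_dir d A)) :: real)"
    if H: "H \<in> ?T" for H
  proof -
    have Hf: "H face_of Q" "aff_dim H = int k" "dir_space H \<inter> \<Delta> = {0}"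
      using H by (auto simp: transverse_faces_def)
    have HQ: "H \<subseteq> Q" by (rule face_of_imp_subset[OF Hf(1)])
    have "H \<noteq> {}" using Hf(2) by auto
    then obtain x0 where x0: "x0 \<in> H" by blast
    obtain c0 where c0: "\<And>x. x \<in> dir_space H \<Longrightarrow> c0 \<bullet> x = 0" "\<And>x. x \<in> \<Delta> \<Longrightarrow> c0 \<bullet> x = \<phi> \<bullet> x"
      using exists_orthogonal_splitting[OF subspace_dir_space subspace_\<Delta> Hf(3)] by metis
    obtain c1 where c1: "\<And>x. x \<in> dir_space H \<Longrightarrow> c1 \<bullet> x = 0" "\<And>x. x \<in> \<Delta> \<Longrightarrow> c1 \<bullet> x = d \<bullet> x"
      using exists_orthogonal_splitting[OF subspace_dir_space subspace_\<Delta> Hf(3)] by metis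
    define I where "I t \<longleftrightarrow> H \<subseteq> maximizers Q (c0 + t *\<^sub>R c1)" for t
    have ct: "(c0 + t *\<^sub>R c1) \<bullet> x = 0" if "x \<in> dir_space H" for t x
      using c0(1) c1(1) that by (simp add: inner_add_left)
    have ct\<Delta>: "\<forall>x\<in>\<Delta>. (c0 + t *\<^sub>R c1) \<bullet> x = (\<phi> + t *\<^sub>R d) \<bullet> x" for t
      using c0(2) c1(2) by (simp add: inner_add_left)
    have sel: "H \<in> selected_faces Q \<Delta> k (\<phi> + t *\<^sub>R d) \<longleftrightarrow> I t" for t
      unfolding I_def using selected_iff[OF H ct ct\<Delta>] .
    have I: "I t \<longleftrightarrow> (\<forall>y\<in>S. c0 \<bullet> (y - x0) + t * (c1 \<bullet> (y - x0)) \<le> 0)" for t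
    proof -
      have "I t \<longleftrightarrow> (\<forall>y\<in>Q. (c0 + t *\<^sub>R c1) \<bullet> (y - x0) \<le> 0)"
        unfolding I_def using subset_maximizers_iff[OF ct HQ x0] .
      also have "\<dots> \<longleftrightarrow> Q \<subseteq> {y. (c0 + t *\<^sub>R c1) \<bullet> y \<le> (c0 + t *\<^sub>R c1) \<bullet> x0}"
        by (auto simp: inner_diff_right)
      also have "\<dots> \<longleftrightarrow> S \<subseteq> {y. (c0 + t *\<^sub>R c1) \<bullet> y \<le> (c0 + t *\<^sub>R c1) \<bullet> x0}"
        unfolding S(2) by (rule subset_hull) (rule convex_halfspace_le)
      also have "\<dots> \<longleftrightarrow> (\<forall>y\<in>S. c0 \<bullet> (y - x0) + t * (c1 \<bullet> (y - x0)) \<le> 0)"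
        by (auto simp: inner_add_left inner_diff_right algebra_simps)
      finally show ?thesis .
    qed
    have endp: "c1 \<bullet> (y - x0) = 0"
      if "I t" "y \<in> S" "c0 \<bullet> (y - x0) + t * (c1 \<bullet> (y - x0)) = 0"
        "generic_functional Q \<Delta> k (\<phi> + t *\<^sub>R d)" for t y
    proof -
      have Hm: "H = maximizers Q (c0 + t *\<^sub>R c1)"
        using selected_face_eq_maximizers(1)[OF convex_Q that(4) Hf(1,2) ct\<Delta>] that(1)
          by (simp add: I_def)
      have "y \<in> Q" using that(2) S(2) by (simp add: hull_inc)
      moreover have "(c0 + t *\<^sub>R c1) \<bullet> y = (c0 + t *\<^sub>R c1) \<bullet> x0"
        using that(3) by (simp add: inner_add_left inner_diff_right algebra_simps)
      moreover have "x0 \<in> maximizers Q (c0 + t *\<^sub>R c1)" using x0 Hm by blast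
      ultimately have "y \<in> maximizers Q (c0 + t *\<^sub>R c1)" by (simp add: maximizers_def)
      then have "y \<in> H" using Hm by blast
      then show ?thesis using c1(1) diff_in_dir_space x0 by blast
    qed
    have card_eq: "card {t. 0 < t \<and> t < 1 \<and> I t \<and>
          (\<exists>y\<in>S. c0 \<bullet> (y - x0) + t * (c1 \<bullet> (y - x0)) = 0 \<and> \<sigma> * (c1 \<bullet> (y - x0)) < 0)} =
        card {A \<in> W. H facet_of A \<and> exits A H (\<sigma> *\<^sub>R wall_dir d A)}" (is "card ?X = card ?Y")
      if \<sigma>: "\<sigma> = 1 \<or> \<sigma> = - 1" for \<sigma>
    proof -
      have X: "t \<in> ?X \<longleftrightarrow> (\<exists>A. wall \<phi> d t A \<and> H facet_of A \<and> exits A H (\<sigma> *\<^sub>R wall_dir d A))" for t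
      proof (cases "0 < t \<and> t < 1")
        case True
        then show ?thesis
          using crossing_iff_wall[OF path moving S H x0 c0 c1 _ _ \<sigma>, of t]
          by (simp add: I_def inner_add_left)
      next
        case False
        then show ?thesis by (auto simp: wall_def)
      qed
      \<comment> \<open>The parameter of a wall is determined by its face, as the restriction vanishes on the wall direction.\<close>
      define f where "f A = - (\<phi> \<bullet> wall_dir d A) / (d \<bullet> wall_dir d A)" for A
      have f: "f A = t" if "wall \<phi> d t A" for A t
        using Wdir(1,2)[OF that] by (simp add: f_def inner_add_left field_simps)
      have inj: "inj_on f ?Y"
      proof (rule inj_onI)
        fix A B assume AB: "A \<in> ?Y" "B \<in> ?Y" "f A = f B"
        then obtain t where t: "wall \<phi> d t A" "wall \<phi> d t B"
          using f by (auto simp: W_def)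
        have "C = maximizers Q (c0 + t *\<^sub>R c1)" if C: "wall \<phi> d t C" "H facet_of C" for C
        proof -
          obtain c' where "\<forall>x\<in>\<Delta>. c' \<bullet> x = (\<phi> + t *\<^sub>R d) \<bullet> x" "C = maximizers Q c'"
            using C(1) unfolding wall_def by blast
          then show ?thesis
            using maximizers_unique[OF H ct ct\<Delta>] facet_of_imp_subset[OF C(2)] by blast
        qed
        then show "A = B" using AB t by blast
      qed
      have img: "f ` ?Y = ?X"
      proof
        show "f ` ?Y \<subseteq> ?X" using X f unfolding W_def by blast
        show "?X \<subseteq> f ` ?Y"
        proof
          fix t assume "t \<in> ?X"
          then obtain A where "wall \<phi> d t A" "H facet_of A" "exits A H (\<sigma> *\<^sub>R wall_dir d A)"
            using X by blast
          then show "t \<in> f ` ?Y"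
            unfolding W_def using f by (intro image_eqI[of _ _ A]) auto
        qed
      qed
      show ?thesis using card_image[OF inj] unfolding img .
    qed
    have "real (card {t. 0 < t \<and> t < 1 \<and> I t \<and>
          (\<exists>y\<in>S. c0 \<bullet> (y - x0) + t * (c1 \<bullet> (y - x0)) = 0 \<and> c1 \<bullet> (y - x0) < 0)}) -
        real (card {t. 0 < t \<and> t < 1 \<and> I t \<and>
          (\<exists>y\<in>S. c0 \<bullet> (y - x0) + t * (c1 \<bullet> (y - x0)) = 0 \<and> c1 \<bullet> (y - x0) > 0)}) =
        of_bool (I 1) - of_bool (I 0)"
    proof (rule count_crossings[OF S(1) I])
      show "c1 \<bullet> (y - x0) = 0" if "I 0" "y \<in> S" "c0 \<bullet> (y - x0) = 0" for y
        using endp[of 0 y] that gen(1) by simp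
      show "c1 \<bullet> (y - x0) = 0"
        if "I 1" "y \<in> S" "c0 \<bullet> (y - x0) + c1 \<bullet> (y - x0) = 0" for y
        using endp[of 1 y] that gen(2) by (simp add: d_def)
    qed
    then have "real (card {A \<in> W. H facet_of A \<and> exits A H (wall_dir d A)}) -
        real (card {A \<in> W. H facet_of A \<and> exits A H (- wall_dir d A)}) = of_bool (I 1) - of_bool (I 0)"
      using card_eq[of 1] card_eq[of "- 1"] by simp
    moreover have "I 1 \<longleftrightarrow> H \<in> selected_faces Q \<Delta> k \<psi>" "I 0 \<longleftrightarrow> H \<in> selected_faces Q \<Delta> k \<phi>"
      using sel[of 0] sel[of 1] by (auto simp: d_def)
    ultimately show ?thesis
      using finW by (simp add: sum_subtractf Int_def conj_commute)
  qed
  have balA: "(\<Sum>H\<in>?T. (of_bool (H facet_of A \<and> exits A H (wall_dir d A)) -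
        of_bool (H facet_of A \<and> exits A H (- wall_dir d A)) :: real) *\<^sub>R m H) = 0"
    if AW: "A \<in> W" for A
  proof -
    obtain t where t: "wall \<phi> d t A" using AW by (auto simp: W_def)
    note A = Wdir[OF t]
    have sub: "{H. H facet_of A \<and> exits A H e} \<subseteq> ?T"
      if e: "e = wall_dir d A \<or> e = - wall_dir d A" for e
    proof clarify
      fix H assume H: "H facet_of A" "exits A H e"
      have HA: "H face_of A" "aff_dim H = int k" using H(1) A(6) by (auto simp: facet_of_def)
      have "H face_of Q" using face_of_trans[OF HA(1) A(5)] .
      moreover have "dir_space H \<inter> \<Delta> = {0}"
      proof -
        obtain x y where xy: "x \<in> H" "y \<in> A - H"
          using H(2) by (auto simp: exits_def)
        have w: "wall_dir d A \<in> dir_space A"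
          using A(4) span_base[of "wall_dir d A" "{wall_dir d A}"] by blast
        have "polyhedron A"
          using face_of_polyhedron_polyhedron[OF polytope_imp_polyhedron[OF polytope_Q] A(5)] .
        from facet_complement[OF this H(1) xy w]
        have "wall_dir d A \<notin> dir_space H" using e H(2) by (metis less_irrefl)
        then have notin: "c *\<^sub>R wall_dir d A \<notin> dir_space H" if "c \<noteq> 0" for c
          using subspace_scale[OF subspace_dir_space[of H], of "c *\<^sub>R wall_dir d A" "1/c"] that by auto
        have inc: "dir_space H \<inter> \<Delta> \<subseteq> span {wall_dir d A}"
          using A(4) dir_space_mono[OF face_of_imp_subset[OF HA(1)]] by blast
        have "dir_space H \<inter> \<Delta> \<subseteq> {0}"
        proof
          fix x assume x: "x \<in> dir_space H \<inter> \<Delta>"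
          then obtain c where "x = c *\<^sub>R wall_dir d A"
            using inc unfolding span_singleton by blast
          then show "x \<in> {0}" using x notin[of c] by (cases "c = 0") auto
        qed
        then show ?thesis
          using subspace_0[OF subspace_dir_space[of H]] subspace_0[OF subspace_\<Delta>] by blast
      qed
      ultimately show "H \<in> ?T" using HA(2) by (simp add: transverse_faces_def)
    qed
    have one: "(\<Sum>H\<in>?T. (of_bool (H facet_of A \<and> exits A H e) :: real) *\<^sub>R m H) =
        (\<Sum>H | H facet_of A \<and> exits A H e. m H)" if e: "e = wall_dir d A \<or> e = - wall_dir d A" for e
      using sum_subset_of_bool[OF finite_transverse_faces sub[OF e], of m] by simp
    have "(\<Sum>H | H facet_of A \<and> exits A H (wall_dir d A). m H) =
        (\<Sum>H | H facet_of A \<and> exits A H (- wall_dir d A). m H)"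
      using bal A(3-6) unfolding balanced_weight_def by blast
    then show ?thesis by (simp add: scaleR_left_diff_distrib sum_subtractf one)
  qed
  have sel_sum: "(\<Sum>H\<in>selected_faces Q \<Delta> k \<theta>. m H) =
      (\<Sum>H\<in>?T. (of_bool (H \<in> selected_faces Q \<Delta> k \<theta>) :: real) *\<^sub>R m H)"
    if "generic_functional Q \<Delta> k \<theta>" for \<theta>
  proof -
    have "selected_faces Q \<Delta> k \<theta> \<subseteq> ?T"
      using selected_face_eq_maximizers(2)[OF convex_Q that] unfolding selected_faces_def by blast
    then show ?thesis by (rule sum_subset_of_bool[OF finite_transverse_faces])
  qed
  have "(\<Sum>H\<in>selected_faces Q \<Delta> k \<psi>. m H) - (\<Sum>H\<in>selected_faces Q \<Delta> k \<phi>. m H) =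
      (\<Sum>H\<in>?T. (of_bool (H \<in> selected_faces Q \<Delta> k \<psi>) - of_bool (H \<in> selected_faces Q \<Delta> k \<phi>) :: real) *\<^sub>R m H)"
    unfolding sel_sum[OF gen(1)] sel_sum[OF gen(2)] by (simp add: scaleR_left_diff_distrib sum_subtractf)
  also have "\<dots> = (\<Sum>H\<in>?T. \<Sum>A\<in>W. (of_bool (H facet_of A \<and> exits A H (wall_dir d A)) -
        of_bool (H facet_of A \<and> exits A H (- wall_dir d A)) :: real) *\<^sub>R m H)"
    by (rule sum.cong[OF refl]) (simp only: jump scaleR_sum_left)
  also have "\<dots> = (\<Sum>A\<in>W. \<Sum>H\<in>?T. (of_bool (H facet_of A \<and> exits A H (wall_dir d A)) -
        of_bool (H facet_of A \<and> exits A H (- wall_dir d A)) :: real) *\<^sub>R m H)"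
    by (rule sum.swap)
  also have "\<dots> = 0" using balA by (intro sum.neutral) blast
  finally show ?thesis by simp
qed

text \<open>
  Two generic restrictions are joined by two segments through a third point \<open>z\<close>. The conditions on
  \<open>z\<close> exclude only finitely many negligible sets: \<open>z\<close> itself is generic, walls are crossed and not
  followed, and the segments do not meet the orthogonal complement of an intersection of dimension at least two.
\<close>

theorem sum_selected_independent:
  fixes m :: "'a set \<Rightarrow> 'b::real_vector"
  assumes gen: "generic_functional Q \<Delta> k \<phi>" "generic_functional Q \<Delta> k \<psi>"
    and bal: "balanced_weight Q \<Delta> k m"
  shows "(\<Sum>H\<in>selected_faces Q \<Delta> k \<phi>. m H) = (\<Sum>H\<in>selected_faces Q \<Delta> k \<psi>. m H)"
proof -
  \<comment> \<open>Outside of \<open>B1 0\<close> the functional \<open>z\<close> is generic, outside of \<open>B1 w\<close> the segment from \<open>w\<close> to \<open>z\<close> follows no wall,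
    and outside of \<open>B2 w\<close> it has no point but \<open>w\<close> in a complement of codimension two or more.\<close>
  define B1 where "B1 w = (\<Union>A\<in>{A. A face_of Q \<and> dir_space A \<inter> \<Delta> \<noteq> {0}}.
    {z. \<forall>x\<in>dir_space A \<inter> \<Delta>. (z - w) \<bullet> x = 0})" for w
  define B2 where "B2 w = (\<Union>A\<in>{A. A face_of Q \<and> dim (dir_space A \<inter> \<Delta>) \<ge> 2}.
    {z. \<exists>s. s \<noteq> 1 \<and> (\<forall>x\<in>dir_space A \<inter> \<Delta>. (s *\<^sub>R w + (1 - s) *\<^sub>R z) \<bullet> x = 0)})" for w
  have fin: "finite {A. A face_of Q \<and> P A}" for P
    by (rule finite_subset[OF _ finite_polytope_faces[OF polytope_Q]]) auto
  have sub: "subspace (dir_space A \<inter> \<Delta>)" for A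
    by (intro subspace_inter subspace_dir_space subspace_\<Delta>)
  have B1: "negligible (B1 w)" for w
    unfolding B1_def
  proof (intro negligible_Union finite_imageI fin, clarify)
    fix A assume "dir_space A \<inter> \<Delta> \<noteq> {0}"
    then obtain e where e: "e \<in> dir_space A \<inter> \<Delta>" "e \<noteq> 0"
      using subspace_0[OF sub[of A]] by blast
    have "{z. \<forall>x\<in>dir_space A \<inter> \<Delta>. (z - w) \<bullet> x = 0} = (+) w ` {z. \<forall>x\<in>dir_space A \<inter> \<Delta>. z \<bullet> x = 0}"
      by (auto intro!: image_eqI[of _ _ "_ - w"])
    then show "negligible {z. \<forall>x\<in>dir_space A \<inter> \<Delta>. (z - w) \<bullet> x = 0}"
      using negligible_translation[OF negligible_orthogonal[OF e]] by simp
  qed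
  have B2: "negligible (B2 w)" for w
    unfolding B2_def
      by (intro negligible_Union finite_imageI fin) (auto intro: negligible_cone_over_orthogonal sub)
  have "negligible (B1 0 \<union> B1 \<phi> \<union> B1 \<psi> \<union> B2 \<phi> \<union> B2 \<psi>)"
    by (intro negligible_Un B1 B2)
  then have "B1 0 \<union> B1 \<phi> \<union> B1 \<psi> \<union> B2 \<phi> \<union> B2 \<psi> \<noteq> UNIV"
    by (rule contrapos_pn) (simp only: non_negligible_UNIV not_False_eq_True)
  then obtain z where z: "z \<notin> B1 0" "z \<notin> B1 \<phi>" "z \<notin> B1 \<psi>" "z \<notin> B2 \<phi>" "z \<notin> B2 \<psi>"
    by blast
  have gz: "generic_functional Q \<Delta> k z"
    unfolding generic_functional_def
  proof (intro allI impI, elim conjE)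
    fix c assume c: "\<forall>x\<in>\<Delta>. c \<bullet> x = z \<bullet> x" "int k \<le> aff_dim (maximizers Q c)"
    let ?A = "maximizers Q c"
    have A: "?A face_of Q" by (rule maximizers_face_of[OF convex_Q])
    have 0: "dir_space ?A \<inter> \<Delta> = {0}"
    proof (rule ccontr)
      assume "dir_space ?A \<inter> \<Delta> \<noteq> {0}"
      then obtain x where x: "x \<in> dir_space ?A" "x \<in> \<Delta>" "z \<bullet> x \<noteq> 0"
        using z(1) A by (auto simp: B1_def)
      then show False using c(1) orthogonal_maximizers[OF x(1)] by simp
    qed
    moreover have "?A \<noteq> {}" using maximizers_nonempty[OF compact_Q nonempty_Q] .
    ultimately show "aff_dim ?A = int k \<and> dir_space ?A \<inter> \<Delta> = {0}"
      using dim_face_Int[OF A] c(2) by simp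
  qed
  have "(\<Sum>H\<in>selected_faces Q \<Delta> k w. m H) = (\<Sum>H\<in>selected_faces Q \<Delta> k z. m H)"
    if w: "generic_functional Q \<Delta> k w" "z \<notin> B1 w" "z \<notin> B2 w" for w
  proof (rule sum_selected_along_path[OF _ _ w(1) gz bal])
    fix A t assume A: "A face_of Q" "dim (dir_space A \<inter> \<Delta>) \<ge> 2" and t: "0 < t" "t < (1::real)"
    have "w + t *\<^sub>R (z - w) = (1 - t) *\<^sub>R w + (1 - (1 - t)) *\<^sub>R z"
      by (simp add: algebra_simps)
    moreover have "1 - t \<noteq> 1" using t by simp
    moreover have "\<not> (\<exists>s. s \<noteq> 1 \<and> (\<forall>x\<in>dir_space A \<inter> \<Delta>. (s *\<^sub>R w + (1 - s) *\<^sub>R z) \<bullet> x = 0))"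
      using w(3) A unfolding B2_def by blast
    ultimately show "\<exists>x\<in>dir_space A \<inter> \<Delta>. (w + t *\<^sub>R (z - w)) \<bullet> x \<noteq> 0"
      by metis
  next
    fix A assume "A face_of Q" "dir_space A \<inter> \<Delta> \<noteq> {0}"
    then show "\<exists>x\<in>dir_space A \<inter> \<Delta>. (z - w) \<bullet> x \<noteq> 0"
      using w(2) unfolding B1_def by blast
  qed
  then show ?thesis using gen z by metis
qed

end

section \<open>Vanishing of products in the exterior algebra\<close>

lemma ext_vec_add: "ext_vec (x + y) = ext_vec x + ext_vec y"
  using linear_add[OF linear_ext_vec] .

lemma ext_vec_anticommute: "ext_vec x * ext_vec y = - (ext_vec y * ext_vec x)"
proof -
  have "ext_vec (x + y) * ext_vec (x + y) = 0" by (rule ext_vec_square)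
  then have "ext_vec x * ext_vec y + ext_vec y * ext_vec x = 0"
    by (simp add: ext_vec_add algebra_simps ext_vec_square)
  then show ?thesis by (simp add: eq_neg_iff_add_eq_0)
qed

text \<open>
  The factor \<open>x\<close> anticommutes past the others until it meets itself.
\<close>

lemma ext_vec_mult_prod_mem: "x \<in> set xs \<Longrightarrow> ext_vec x * prod_list (map ext_vec xs) = 0"
proof (induction xs)
  case (Cons y ys)
  have "ext_vec x * (ext_vec y * prod_list (map ext_vec ys)) =
      - (ext_vec y * (ext_vec x * prod_list (map ext_vec ys)))"
    unfolding mult.assoc[symmetric] ext_vec_anticommute[of x y] by simp
  moreover have "ext_vec x * (ext_vec x * p) = 0" for p
    by (simp add: ext_vec_square mult.assoc[symmetric])
  ultimately show ?case using Cons by (cases "x = y") auto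
qed simp

lemma ext_vec_mult_prod_span:
  assumes "x \<in> span (set xs)"
  shows "ext_vec x * prod_list (map ext_vec xs) = 0"
proof -
  have "subspace {x. ext_vec x * prod_list (map ext_vec xs) = 0}"
    by (rule subspaceI)
      (simp_all add: linear_0[OF linear_ext_vec] ext_vec_add linear_scale[OF linear_ext_vec] distrib_right)
  then have "span (set xs) \<subseteq> {x. ext_vec x * prod_list (map ext_vec xs) = 0}"
    by (intro span_minimal) (auto simp: ext_vec_mult_prod_mem)
  then show ?thesis using assms by blast
qed

lemma independent_if_ext_prod_nonzero:
  "prod_list (map ext_vec xs) \<noteq> 0 \<Longrightarrow> distinct xs \<and> independent (set xs)"
proof (induction xs)
  case (Cons x xs)
  have "prod_list (map ext_vec xs) \<noteq> 0" using Cons.prems by auto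
  moreover have "x \<notin> span (set xs)" using Cons.prems ext_vec_mult_prod_span by auto
  ultimately show ?case
    using Cons.IH span_base[of x "set xs"] by (auto simp: independent_insert)
qed (simp add: independent_empty)

text \<open>
  More vectors than the dimension of \<open>U\<close> are dependent, and a product of dependent vectors vanishes.
\<close>

lemma ext_power_eq_0:
  fixes U :: "'a::euclidean_space set"
  assumes "dim U < p" "a \<in> ext_power p U"
  shows "a = 0"
proof -
  have "prod_list (map ext_vec xs) = 0" if "length xs = p" "set xs \<subseteq> U" for xs
  proof (rule ccontr)
    assume "prod_list (map ext_vec xs) \<noteq> 0"
    then have "distinct xs" "independent (set xs)" using independent_if_ext_prod_nonzero by blast+
    then have "length xs \<le> dim U"
      using independent_card_le_dim[OF that(2)] distinct_card by metis
    then show False using assms(1) that(1) by simp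
  qed
  then have "{prod_list (map ext_vec xs) | xs. length xs = p \<and> set xs \<subseteq> U} \<subseteq> {0}"
    by blast
  then have "ext_power p U \<subseteq> span {0}" unfolding ext_power_def by (rule span_mono)
  then show ?thesis using assms(2) by auto
qed

lemma ext_power_mult:
  assumes a: "a \<in> ext_power p U" and b: "b \<in> ext_power q W" and sub: "U \<subseteq> S" "W \<subseteq> S"
  shows "a * b \<in> ext_power (p + q) S"
proof -
  have S: "subspace (ext_power (p + q) S)" by (simp add: ext_power_def)
  have 1: "prod_list (map ext_vec xs) * b \<in> ext_power (p + q) S"
    if xs: "length xs = p" "set xs \<subseteq> U" for xs
  proof -
    have "subspace {b. prod_list (map ext_vec xs) * b \<in> ext_power (p + q) S}"
      by (rule subspaceI) (auto simp: subspace_0[OF S] distrib_left intro: subspace_add[OF S] subspace_scale[OF S])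
    moreover have "prod_list (map ext_vec xs) * prod_list (map ext_vec ys) \<in> ext_power (p + q) S"
      if "length ys = q" "set ys \<subseteq> W" for ys
    proof -
      have "prod_list (map ext_vec (xs @ ys)) \<in> ext_power (p + q) S"
        unfolding ext_power_def using xs that sub by (intro span_base CollectI exI[of _ "xs @ ys"]) auto
      then show ?thesis by simp
    qed
    ultimately have "ext_power q W \<subseteq> {b. prod_list (map ext_vec xs) * b \<in> ext_power (p + q) S}"
      unfolding ext_power_def[of q W] by (intro span_minimal) auto
    then show ?thesis using b by blast
  qed
  have "subspace {a. a * b \<in> ext_power (p + q) S}"
    by (rule subspaceI) (auto simp: subspace_0[OF S] distrib_right intro: subspace_add[OF S] subspace_scale[OF S])
  then have "ext_power p U \<subseteq> {a. a * b \<in> ext_power (p + q) S}"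
    unfolding ext_power_def[of p U] by (intro span_minimal) (use 1 in auto)
  then show ?thesis using a by blast
qed

text \<open>
  The product has degree \<open>p + q\<close> over a sum of subspaces that is not direct, hence of dimension less than
  \<open>p + q\<close>.
\<close>

lemma ext_power_mult_eq_0:
  fixes F G :: "'a::euclidean_space set"
  assumes "a \<in> ext_power p (dir_space F)" "b \<in> ext_power q (dir_space G)"
    "dim (dir_space F) \<le> p" "dim (dir_space G) \<le> q"
    "x \<in> dir_space F" "x \<in> dir_space G" "x \<noteq> 0"
  shows "a * b = 0"
proof -
  let ?S = "{x + y |x y. x \<in> dir_space F \<and> y \<in> dir_space G}"
  have "dim (dir_space F \<inter> dir_space G) \<noteq> 0" using assms(5-7) by (auto simp: dim_eq_0)
  then have "dim ?S < p + q"
    using dim_sums_Int[OF subspace_dir_space[of F] subspace_dir_space[of G]] assms(3,4) by linarith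
  moreover have "a * b \<in> ext_power (p + q) ?S"
  proof (rule ext_power_mult[OF assms(1,2)])
    show "dir_space F \<subseteq> ?S" using subspace_0[OF subspace_dir_space[of G]] by force
    show "dir_space G \<subseteq> ?S" using subspace_0[OF subspace_dir_space[of F]] by force
  qed
  ultimately show ?thesis by (rule ext_power_eq_0)
qed

section \<open>Ordered bases and base changes\<close>

lemma ordered_basis_length:
  fixes U :: "'a::euclidean_space set"
  assumes "ordered_basis U bs" shows "length bs = dim U"
  using assms dim_span_eq_card_independent[of "set bs"] distinct_card[of bs] by (auto simp: ordered_basis_def)

text \<open>
  For lists of the right length, distinctness and independence are automatic, which reduces
  the exchange of parts of bases to a computation with spans.
\<close>

lemma ordered_basis_iff:
  fixes U :: "'a::euclidean_space set"
  shows "ordered_basis U bs \<longleftrightarrow> span (set bs) = U \<and> length bs = dim U"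
proof
  assume "ordered_basis U bs"
  then show "span (set bs) = U \<and> length bs = dim U"
    using ordered_basis_length[of U bs] unfolding ordered_basis_def by blast
next
  assume *: "span (set bs) = U \<and> length bs = dim U"
  then have "card (set bs) \<le> dim U" using card_length[of bs] by simp
  then have i: "independent (set bs)"
    using * card_le_dim_spanning[of "set bs" U] span_superset[of "set bs"] by auto
  then have "card (set bs) = length bs"
    using * dim_span_eq_card_independent[OF i] by simp
  then show "ordered_basis U bs" using * i card_distinct[of bs] unfolding ordered_basis_def by blast
qed

lemma ordered_basis_exists:
  fixes U :: "'a::euclidean_space set"
  assumes "subspace U" shows "\<exists>bs. ordered_basis U bs"
proof -
  obtain B where B: "B \<subseteq> U" "independent B" "U \<subseteq> span B" "card B = dim U"
    using basis_exists[of U] by blast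
  obtain bs where "set bs = B" "distinct bs"
    using finite_distinct_list[of B] B(2) independent_imp_finite by blast
  moreover have "span B = U" using B assms span_minimal by blast
  ultimately show ?thesis using B(2) by (auto simp: ordered_basis_def)
qed

lemma ordered_basis_extend_vector:
  fixes U :: "'a::euclidean_space set"
  assumes "subspace U" "x \<in> U" "x \<noteq> 0"
  obtains bs where "ordered_basis U (x # bs)"
proof -
  have "independent {x}" using assms(3) by (simp add: independent_insert independent_empty)
  then obtain B where B: "{x} \<subseteq> B" "B \<subseteq> U" "independent B" "U \<subseteq> span B"
    using maximal_independent_subset_extend[of "{x}" U] assms(2) by blast
  have "finite (B - {x})" using B(3) independent_imp_finite by blast
  then obtain bs where bs: "set bs = B - {x}" "distinct bs"
    using finite_distinct_list by blast
  have "set (x # bs) = B" using B(1) bs(1) by auto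
  moreover have "span B = U" using B assms(1) span_minimal by blast
  ultimately have "ordered_basis U (x # bs)"
    unfolding ordered_basis_def using bs B(3) by auto
  then show ?thesis by (rule that)
qed

lemma ordered_basis_append_replace:
  fixes U :: "'a::euclidean_space set"
  assumes "ordered_basis U (P @ bs @ S)" "ordered_basis U' bs" "ordered_basis U' cs"
  shows "ordered_basis U (P @ cs @ S)"
proof -
  have "span (set P \<union> (set cs \<union> set S)) = span (set P \<union> (set bs \<union> set S))"
    using assms(2,3) by (simp add: span_Un ordered_basis_def)
  then show ?thesis
    using assms ordered_basis_length[OF assms(2)] ordered_basis_length[OF assms(3)]
    by (simp add: ordered_basis_iff)
qed

lemma change_of_basis_carrier [simp]:
  "change_of_basis bs cs \<in> carrier_mat (length bs) (length cs)"
  by (simp add: change_of_basis_def)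

lemma change_of_basis_expand:
  assumes "distinct bs" "independent (set bs)" "j < length cs" "cs ! j \<in> span (set bs)"
  shows "cs ! j = (\<Sum>i<length bs. change_of_basis bs cs $$ (i, j) *\<^sub>R bs ! i)"
proof -
  have "cs ! j = (\<Sum>b\<in>set bs. representation (set bs) (cs ! j) b *\<^sub>R b)"
    using sum_representation_eq[OF assms(2,4), of "set bs"] by simp
  also have "\<dots> = (\<Sum>i<length bs. representation (set bs) (cs ! j) (bs ! i) *\<^sub>R bs ! i)"
    by (rule sum.reindex_bij_betw[symmetric]) (rule bij_betw_nth[OF assms(1)], auto)
  also have "\<dots> = (\<Sum>i<length bs. change_of_basis bs cs $$ (i, j) *\<^sub>R bs ! i)"
    using assms(3) by (intro sum.cong) (auto simp: change_of_basis_def)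
  finally show ?thesis .
qed

lemma change_of_basis_eqI:
  assumes "distinct bs" "independent (set bs)" "M \<in> carrier_mat (length bs) (length cs)"
    "\<And>j. j < length cs \<Longrightarrow> cs ! j = (\<Sum>i<length bs. M $$ (i, j) *\<^sub>R bs ! i)"
  shows "change_of_basis bs cs = M"
proof (rule eq_matI)
  fix i j assume ij: "i < dim_row M" "j < dim_col M"
  then have ij': "i < length bs" "j < length cs" using assms(3) by auto
  have sp: "bs ! l \<in> span (set bs)" if "l < length bs" for l
    using that by (intro span_base) auto
  have "representation (set bs) (cs ! j) (bs ! i) =
      representation (set bs) (\<Sum>l<length bs. M $$ (l, j) *\<^sub>R bs ! l) (bs ! i)"
    using assms(4)[OF ij'(2)] by simp
  also have "\<dots> = (\<Sum>l<length bs. representation (set bs) (M $$ (l, j) *\<^sub>R bs ! l) (bs ! i))"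
    using sp by (subst representation_sum[OF assms(2)]) (auto intro: span_scale)
  also have "\<dots> = (\<Sum>l<length bs. M $$ (l, j) * (if i = l then 1 else 0))"
  proof (rule sum.cong[OF refl])
    fix l assume l: "l \<in> {..<length bs}"
    then have "representation (set bs) (bs ! l) = (\<lambda>v. if v = bs ! l then 1 else 0)"
      using representation_basis[OF assms(2), of "bs ! l"] by simp
    then show "representation (set bs) (M $$ (l, j) *\<^sub>R bs ! l) (bs ! i) = M $$ (l, j) * (if i = l then 1 else 0)"
      using l ij'(1) representation_scale[OF assms(2) sp, of l "M $$ (l, j)"] assms(1)
      by (simp add: nth_eq_iff_index_eq)
  qed
  also have "\<dots> = M $$ (i, j)" using ij'(1) by (simp add: if_distrib cong: if_cong)
  finally show "change_of_basis bs cs $$ (i, j) = M $$ (i, j)"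
    using ij' by (simp add: change_of_basis_def)
qed (use assms(3) in \<open>auto simp: change_of_basis_def\<close>)

lemma change_of_basis_mult:
  assumes "distinct bs" "independent (set bs)" "distinct cs" "independent (set cs)"
    "set cs \<subseteq> span (set bs)" "set ds \<subseteq> span (set cs)"
  shows "change_of_basis bs ds = change_of_basis bs cs * change_of_basis cs ds"
proof (rule change_of_basis_eqI[OF assms(1,2)])
  let ?A = "change_of_basis bs cs" and ?B = "change_of_basis cs ds"
  show "?A * ?B \<in> carrier_mat (length bs) (length ds)" by (rule mult_carrier_mat[of _ _ "length cs"]) auto
  fix j assume j: "j < length ds"
  have prod: "(?A * ?B) $$ (i, j) = (\<Sum>l<length cs. ?A $$ (i, l) * ?B $$ (l, j))" if "i < length bs" for i
    using that j by (simp add: change_of_basis_def scalar_prod_def lessThan_atLeast0)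
  have "ds ! j = (\<Sum>l<length cs. ?B $$ (l, j) *\<^sub>R cs ! l)"
    using assms j by (intro change_of_basis_expand) auto
  also have "\<dots> = (\<Sum>l<length cs. ?B $$ (l, j) *\<^sub>R (\<Sum>i<length bs. ?A $$ (i, l) *\<^sub>R bs ! i))"
    using assms by (intro sum.cong refl arg_cong[of _ _ "scaleR _"] change_of_basis_expand) auto
  also have "\<dots> = (\<Sum>l<length cs. \<Sum>i<length bs. (?A $$ (i, l) * ?B $$ (l, j)) *\<^sub>R bs ! i)"
    by (simp add: scaleR_sum_right mult.commute)
  also have "\<dots> = (\<Sum>i<length bs. \<Sum>l<length cs. (?A $$ (i, l) * ?B $$ (l, j)) *\<^sub>R bs ! i)"
    by (rule sum.swap)
  also have "\<dots> = (\<Sum>i<length bs. (?A * ?B) $$ (i, j) *\<^sub>R bs ! i)"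
    by (intro sum.cong refl) (simp add: prod scaleR_sum_left)
  finally show "ds ! j = (\<Sum>i<length bs. (?A * ?B) $$ (i, j) *\<^sub>R bs ! i)" .
qed

lemma change_of_basis_self:
  assumes "distinct bs" "independent (set bs)"
  shows "change_of_basis bs bs = 1\<^sub>m (length bs)"
proof (rule change_of_basis_eqI[OF assms])
  fix j assume j: "j < length bs"
  have "(\<Sum>i<length bs. (1\<^sub>m (length bs) :: real mat) $$ (i, j) *\<^sub>R bs ! i) =
      (\<Sum>i<length bs. if i = j then bs ! i else 0)"
    using j by (intro sum.cong) auto
  also have "\<dots> = bs ! j" using j by simp
  finally show "bs ! j = (\<Sum>i<length bs. (1\<^sub>m (length bs) :: real mat) $$ (i, j) *\<^sub>R bs ! i)"
    by simp
qed simp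

lemma det_change_of_basis_mult:
  fixes U :: "'a::euclidean_space set"
  assumes "ordered_basis U bs" "ordered_basis U cs" "ordered_basis U ds"
  shows "Determinant.det (change_of_basis bs ds) =
    Determinant.det (change_of_basis bs cs) * Determinant.det (change_of_basis cs ds)"
proof -
  have l: "length bs = dim U" "length cs = dim U" "length ds = dim U"
    using assms ordered_basis_length by blast+
  have "change_of_basis bs ds = change_of_basis bs cs * change_of_basis cs ds"
    using assms by (intro change_of_basis_mult) (auto simp: ordered_basis_def intro: span_base)
  moreover have "change_of_basis bs cs \<in> carrier_mat (dim U) (dim U)"
      "change_of_basis cs ds \<in> carrier_mat (dim U) (dim U)"
    using l change_of_basis_carrier[of bs cs] change_of_basis_carrier[of cs ds] by simp_all
  ultimately show ?thesis using Determinant.det_mult by metis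
qed

lemma det_change_of_basis_self:
  "ordered_basis U bs \<Longrightarrow> Determinant.det (change_of_basis bs bs) = 1"
  by (simp add: change_of_basis_self ordered_basis_def)

lemma det_change_of_basis_nonzero:
  fixes U :: "'a::euclidean_space set"
  assumes "ordered_basis U bs" "ordered_basis U cs"
  shows "Determinant.det (change_of_basis bs cs) \<noteq> 0"
  using det_change_of_basis_mult[OF assms assms(1)] det_change_of_basis_self[OF assms(1)] by auto

lemma sum_lessThan_add:
  "(\<Sum>i<a + n. f i) = (\<Sum>i<a. f i) + (\<Sum>i<n. f (a + i))" for a n :: nat and f :: "nat \<Rightarrow> 'b::comm_monoid_add"
  by (induction n) (simp_all add: add.assoc)

text \<open>
  Replacing the middle part of a basis is a base change with the block diagonal matrix \<open>diag(1, M, 1)\<close>.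
\<close>

lemma det_change_of_basis_append:
  fixes U :: "'a::euclidean_space set"
  assumes b: "ordered_basis U (P @ bs @ S)" and bs: "ordered_basis U' bs" and cs: "ordered_basis U' cs"
  shows "Determinant.det (change_of_basis (P @ bs @ S) (P @ cs @ S)) = Determinant.det (change_of_basis bs cs)"
proof -
  let ?n = "length bs" and ?p = "length P" and ?s = "length S"
  have l: "length cs = ?n" using ordered_basis_length[OF bs] ordered_basis_length[OF cs] by simp
  let ?C = "change_of_basis bs cs"
  have C: "?C \<in> carrier_mat ?n ?n" using change_of_basis_carrier[of bs cs] l by simp
  define N where "N = four_block_mat ?C (0\<^sub>m ?n ?s) (0\<^sub>m ?s ?n) (1\<^sub>m ?s :: real mat)"
  define M where "M = four_block_mat (1\<^sub>m ?p) (0\<^sub>m ?p (?n + ?s)) (0\<^sub>m (?n + ?s) ?p) N"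
  have N: "N \<in> carrier_mat (?n + ?s) (?n + ?s)"
    using C by (simp add: N_def)
  have "change_of_basis (P @ bs @ S) (P @ cs @ S) = M"
  proof (rule change_of_basis_eqI)
    show "distinct (P @ bs @ S)" "independent (set (P @ bs @ S))"
      using b unfolding ordered_basis_def by blast+
    show "M \<in> carrier_mat (length (P @ bs @ S)) (length (P @ cs @ S))"
      using N l by (simp add: M_def)
    fix j assume "j < length (P @ cs @ S)"
    then have j: "j < ?p + (?n + ?s)" using l by simp
    have split: "(\<Sum>i<length (P @ bs @ S). M $$ (i, j) *\<^sub>R (P @ bs @ S) ! i) =
        (\<Sum>i<?p. M $$ (i, j) *\<^sub>R P ! i) + ((\<Sum>i<?n. M $$ (?p + i, j) *\<^sub>R bs ! i) +
          (\<Sum>i<?s. M $$ (?p + (?n + i), j) *\<^sub>R S ! i))"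
      by (simp add: sum_lessThan_add nth_append)
    consider "j < ?p" | "?p \<le> j" "j < ?p + ?n" | "?p + ?n \<le> j" by linarith
    then show "(P @ cs @ S) ! j = (\<Sum>i<length (P @ bs @ S). M $$ (i, j) *\<^sub>R (P @ bs @ S) ! i)"
    proof cases
      case 1
      have "(\<Sum>i<?p. M $$ (i, j) *\<^sub>R P ! i) = (\<Sum>i<?p. if i = j then P ! i else 0)"
        using 1 N by (intro sum.cong) (auto simp: M_def)
      moreover have "(\<Sum>i<?n. M $$ (?p + i, j) *\<^sub>R bs ! i) = 0"
        using 1 N by (intro sum.neutral) (auto simp: M_def)
      moreover have "(\<Sum>i<?s. M $$ (?p + (?n + i), j) *\<^sub>R S ! i) = 0"
        using 1 N by (intro sum.neutral) (auto simp: M_def)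
      ultimately show ?thesis using 1 unfolding split by (simp add: nth_append)
    next
      case 2
      have "(\<Sum>i<?p. M $$ (i, j) *\<^sub>R P ! i) = 0"
        using 2 N by (intro sum.neutral) (auto simp: M_def)
      moreover have "(\<Sum>i<?n. M $$ (?p + i, j) *\<^sub>R bs ! i) = (\<Sum>i<?n. ?C $$ (i, j - ?p) *\<^sub>R bs ! i)"
        using 2 N C by (intro sum.cong) (auto simp: M_def N_def)
      moreover have "(\<Sum>i<?s. M $$ (?p + (?n + i), j) *\<^sub>R S ! i) = 0"
        using 2 N C by (intro sum.neutral) (auto simp: M_def N_def)
      moreover have "cs ! (j - ?p) = (\<Sum>i<?n. ?C $$ (i, j - ?p) *\<^sub>R bs ! i)"
      proof (rule change_of_basis_expand)
        show "distinct bs" "independent (set bs)" using bs by (auto simp: ordered_basis_def)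
        show "j - ?p < length cs" using 2 l by simp
        then have "cs ! (j - ?p) \<in> span (set cs)" by (intro span_base) simp
        then show "cs ! (j - ?p) \<in> span (set bs)" using bs cs by (simp add: ordered_basis_def)
      qed
      moreover have "j - ?p < ?n" using 2 by linarith
      ultimately show ?thesis using 2 l unfolding split by (simp add: nth_append)
    next
      case 3
      have "(\<Sum>i<?p. M $$ (i, j) *\<^sub>R P ! i) = 0"
        using 3 j N by (intro sum.neutral) (auto simp: M_def)
      moreover have "(\<Sum>i<?n. M $$ (?p + i, j) *\<^sub>R bs ! i) = 0"
        using 3 j N C by (intro sum.neutral) (auto simp: M_def N_def)
      moreover have "(\<Sum>i<?s. M $$ (?p + (?n + i), j) *\<^sub>R S ! i) =
          (\<Sum>i<?s. if i = j - ?p - ?n then S ! i else 0)"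
        using 3 j N C by (intro sum.cong) (auto simp: M_def N_def)
      moreover have "\<not> j - ?p < ?n" "j - ?p - ?n < ?s" "\<not> j < ?p" using 3 j by linarith+
      ultimately show ?thesis using l unfolding split by (simp add: nth_append)
    qed
  qed
  moreover have "Determinant.det M = Determinant.det N"
    unfolding M_def using N by (subst det_four_block_mat_lower_left_zero[of _ ?p _ "?n + ?s"]) auto
  moreover have "Determinant.det N = Determinant.det ?C"
    unfolding N_def using C by (subst det_four_block_mat_lower_left_zero[of _ ?n _ ?s]) auto
  ultimately show ?thesis by simp
qed

text \<open>
  The matrix is block triangular with the diagonal blocks \<open>c\<close> and the identity.
\<close>

lemma det_change_of_basis_first:
  fixes x w :: "'a::euclidean_space"
  assumes b: "ordered_basis U (w # bs)" and x: "x - c *\<^sub>R w \<in> span (set bs)"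
  shows "Determinant.det (change_of_basis (w # bs) (x # bs)) = c"
proof -
  let ?n = "length bs"
  have bs: "distinct bs" "independent (set bs)"
    using b independent_mono[of "set (w # bs)" "set bs"] by (auto simp: ordered_basis_def)
  define C where "C = change_of_basis bs [x - c *\<^sub>R w]"
  have C: "C \<in> carrier_mat ?n 1"
    unfolding C_def using change_of_basis_carrier[of bs "[x - c *\<^sub>R w]"] by simp
  define M where "M = four_block_mat (Matrix.mat 1 1 (\<lambda>_. c)) (0\<^sub>m 1 ?n) C (1\<^sub>m ?n)"
  have "change_of_basis (w # bs) (x # bs) = M"
  proof (rule change_of_basis_eqI)
    show "distinct (w # bs)" "independent (set (w # bs))"
      using b unfolding ordered_basis_def by blast+
    show "M \<in> carrier_mat (length (w # bs)) (length (x # bs))"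
      unfolding M_def
        using four_block_carrier_mat[of "Matrix.mat 1 1 (\<lambda>_. c)" 1 1 "1\<^sub>m ?n" ?n ?n] by simp
    fix j assume j: "j < length (x # bs)"
    have split: "(\<Sum>i<length (w # bs). M $$ (i, j) *\<^sub>R (w # bs) ! i) =
        M $$ (0, j) *\<^sub>R w + (\<Sum>i<?n. M $$ (Suc i, j) *\<^sub>R bs ! i)"
      by (simp only: length_Cons sum.lessThan_Suc_shift nth_Cons_0 nth_Cons_Suc)
    show "(x # bs) ! j = (\<Sum>i<length (w # bs). M $$ (i, j) *\<^sub>R (w # bs) ! i)"
    proof (cases j)
      case 0
      have "[x - c *\<^sub>R w] ! 0 = (\<Sum>i<?n. C $$ (i, 0) *\<^sub>R bs ! i)"
        unfolding C_def using x by (intro change_of_basis_expand bs) auto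
      moreover have "(\<Sum>i<?n. M $$ (Suc i, j) *\<^sub>R bs ! i) = (\<Sum>i<?n. C $$ (i, 0) *\<^sub>R bs ! i)"
        using 0 C by (intro sum.cong) (auto simp: M_def)
      moreover have "M $$ (0, j) = c" using 0 C by (simp add: M_def)
      ultimately show ?thesis using 0 unfolding split by (simp add: diff_eq_eq add.commute)
    next
      case (Suc j')
      then have j': "j' < ?n" using j by simp
      have "(\<Sum>i<?n. M $$ (Suc i, j) *\<^sub>R bs ! i) = (\<Sum>i<?n. if i = j' then bs ! i else 0)"
        using Suc C j' by (intro sum.cong) (auto simp: M_def)
      moreover have "M $$ (0, j) = 0" using Suc C j' by (simp add: M_def)
      ultimately show ?thesis using Suc j' unfolding split by simp
    qed
  qed
  moreover have "Determinant.det M = c"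
    unfolding M_def using C
    by (subst det_four_block_mat_upper_right_zero[of _ 1 _ ?n]) (auto simp: det_single)
  ultimately show ?thesis by simp
qed

text \<open>
  The rotation of a basis is a base change with a permutation matrix that depends on the
  length only.
\<close>

lemma change_of_basis_rotate:
  assumes b: "distinct (bs @ [e])" "independent (set (bs @ [e]))"
  shows "change_of_basis (bs @ [e]) (e # bs) =
    Matrix.mat (Suc (length bs)) (Suc (length bs))
      (\<lambda>(i, j). if i = (if j = 0 then length bs else j - 1) then 1 else 0)" (is "_ = ?M")
proof (rule change_of_basis_eqI[OF b])
  show "?M \<in> carrier_mat (length (bs @ [e])) (length (e # bs))" by simp
  fix j assume j: "j < length (e # bs)"
  let ?k = "if j = 0 then length bs else j - 1"
  have "(\<Sum>i<length (bs @ [e]). ?M $$ (i, j) *\<^sub>R (bs @ [e]) ! i) =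
      (\<Sum>i<length (bs @ [e]). if i = ?k then (bs @ [e]) ! i else 0)"
    using j by (intro sum.cong) auto
  also have "\<dots> = (bs @ [e]) ! ?k"
  proof -
    have "?k < length (bs @ [e])" using j by auto
    then show ?thesis by (simp only: sum.delta' sum.delta finite_lessThan lessThan_iff if_True)
  qed
  also have "\<dots> = (e # bs) ! j" using j by (cases j) (auto simp: nth_append)
  finally show "(e # bs) ! j = (\<Sum>i<length (bs @ [e]). ?M $$ (i, j) *\<^sub>R (bs @ [e]) ! i)" by simp
qed

section \<open>Orientations\<close>

lemma orientation_change:
  assumes "orientation U \<epsilon>" "ordered_basis U bs" "ordered_basis U cs"
  shows "\<epsilon> cs = sgn (Determinant.det (change_of_basis bs cs)) * \<epsilon> bs"
  using assms unfolding orientation_def by blast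

lemma orientation_eqI:
  assumes "orientation U \<epsilon>" "orientation U \<epsilon>'" "ordered_basis U bs" "\<epsilon> bs = \<epsilon>' bs"
  shows "\<epsilon> = \<epsilon>'"
proof
  fix cs
  show "\<epsilon> cs = \<epsilon>' cs"
  proof (cases "ordered_basis U cs")
    case True
    then show ?thesis
      using assms(4) orientation_change[OF assms(1,3) True] orientation_change[OF assms(2,3) True] by simp
  next
    case False
    then show ?thesis using assms(1,2) by (simp add: orientation_def)
  qed
qed

lemma orientation_uminus: "orientation U \<epsilon> \<Longrightarrow> orientation U (- \<epsilon>)"
  unfolding orientation_def
proof (intro conjI allI impI)
  assume \<epsilon>: "(\<forall>bs. ordered_basis U bs \<longrightarrow> \<epsilon> bs \<in> {1, - 1}) \<and>
     (\<forall>bs. \<not> ordered_basis U bs \<longrightarrow> \<epsilon> bs = 0) \<and>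
     (\<forall>bs cs. ordered_basis U bs \<and> ordered_basis U cs \<longrightarrow>
        \<epsilon> cs = sgn (Determinant.det (change_of_basis bs cs)) * \<epsilon> bs)"
  show "(- \<epsilon>) bs \<in> {1, - 1}" if "ordered_basis U bs" for bs
  proof -
    have "\<epsilon> bs \<in> {1, - 1}" using \<epsilon> that by blast
    then show ?thesis by auto
  qed
  show "(- \<epsilon>) bs = 0" if "\<not> ordered_basis U bs" for bs
  proof -
    have "\<epsilon> bs = 0" using \<epsilon> that by blast
    then show ?thesis by simp
  qed
  show "(- \<epsilon>) cs = sgn (Determinant.det (change_of_basis bs cs)) * (- \<epsilon>) bs"
    if "ordered_basis U bs \<and> ordered_basis U cs" for bs cs
  proof -
    have "\<epsilon> cs = sgn (Determinant.det (change_of_basis bs cs)) * \<epsilon> bs"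
      using \<epsilon> that by blast
    then show ?thesis by simp
  qed
qed

lemma orientation_sign: "orientation U \<epsilon> \<Longrightarrow> ordered_basis U bs \<Longrightarrow> \<epsilon> bs = 1 \<or> \<epsilon> bs = - 1"
  unfolding orientation_def by blast

lemma orientation_exists:
  fixes U :: "'a::euclidean_space set"
  assumes b: "ordered_basis U bs"
  obtains \<epsilon> where "orientation U \<epsilon>" "\<epsilon> bs = 1"
proof
  let ?\<epsilon> = "\<lambda>cs. if ordered_basis U cs then sgn (Determinant.det (change_of_basis bs cs)) else 0"
  show "orientation U ?\<epsilon>"
    unfolding orientation_def
  proof (intro conjI allI impI)
    show "?\<epsilon> cs \<in> {1, - 1}" if "ordered_basis U cs" for cs
      using that det_change_of_basis_nonzero[OF b that] by (simp add: sgn_if)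
    show "?\<epsilon> ds = sgn (Determinant.det (change_of_basis cs ds)) * ?\<epsilon> cs"
      if "ordered_basis U cs \<and> ordered_basis U ds" for cs ds
      using that det_change_of_basis_mult[OF b, of cs ds] by (simp add: sgn_mult mult.commute)
  qed auto
  show "?\<epsilon> bs = 1" using b det_change_of_basis_self[OF b] by simp
qed

text \<open>
  Completing the bases of a subspace by fixed vectors to bases of \<open>U\<close> induces an orientation of the
  subspace. Boundary orientations and orientations of complements are both of this form.
\<close>

lemma orientation_restrict:
  fixes U :: "'a::euclidean_space set"
  assumes \<epsilon>: "orientation U \<epsilon>" and b: "ordered_basis U (P @ bs @ S)" "ordered_basis U' bs"
  shows "orientation U' (\<lambda>cs. if ordered_basis U' cs then \<epsilon> (P @ cs @ S) else 0)"
  unfolding orientation_def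
proof (intro conjI allI impI)
  have ob: "ordered_basis U (P @ cs @ S)" if "ordered_basis U' cs" for cs
    using ordered_basis_append_replace[OF b that] .
  show "(if ordered_basis U' cs then \<epsilon> (P @ cs @ S) else 0) \<in> {1, - 1}"
    if "ordered_basis U' cs" for cs
    using orientation_sign[OF \<epsilon> ob[OF that]] that by simp
  show "(if ordered_basis U' ds then \<epsilon> (P @ ds @ S) else 0) =
      sgn (Determinant.det (change_of_basis cs ds)) * (if ordered_basis U' cs then \<epsilon> (P @ cs @ S) else 0)"
    if "ordered_basis U' cs \<and> ordered_basis U' ds" for cs ds
  proof -
    have c: "ordered_basis U' cs" and d: "ordered_basis U' ds" using that by blast+
    show ?thesis
      using c d orientation_change[OF \<epsilon> ob[OF c] ob[OF d]] det_change_of_basis_append[OF ob[OF c] c d]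
        by simp
  qed
qed auto

lemma orientation_first:
  fixes U :: "'a::euclidean_space set"
  assumes \<epsilon>: "orientation U \<epsilon>" and b: "ordered_basis U (w # bs)" "ordered_basis U (x # bs)"
    and x: "x - c *\<^sub>R w \<in> span (set bs)"
  shows "\<epsilon> (x # bs) = sgn c * \<epsilon> (w # bs)"
  using orientation_change[OF \<epsilon> b] det_change_of_basis_first[OF b(1) x] by simp

text \<open>
  The sign is \<open>(-1)\<^sup>n\<close>, and it depends on \<open>n\<close> only because the matrix of the rotation does.
\<close>

lemma orientation_rotate:
  obtains \<kappa> :: real where "\<kappa> = 1 \<or> \<kappa> = - 1"
    "\<And>U \<epsilon> bs e. orientation U \<epsilon> \<Longrightarrow> ordered_basis U (bs @ [e]) \<Longrightarrow> ordered_basis U (e # bs) \<Longrightarrow>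
      length bs = n \<Longrightarrow> \<epsilon> (bs @ [e :: 'a::euclidean_space]) = \<kappa> * \<epsilon> (e # bs)"
proof (cases "\<exists>U \<epsilon> bs e. orientation U \<epsilon> \<and> ordered_basis U (bs @ [e :: 'a]) \<and> ordered_basis U (e # bs) \<and> length bs = n")
  case False
  then show ?thesis using that[of 1] by auto
next
  case True
  \<comment> \<open>The matrix of the rotation is invertible, as it relates two bases, so its determinant has a sign.\<close>
  define M :: "real mat" where "M = Matrix.mat (Suc n) (Suc n)
      (\<lambda>(i, j). if i = (if j = 0 then n else j - 1) then 1 else 0)"
  have *: "\<epsilon> (e # bs) = sgn (Determinant.det M) * \<epsilon> (bs @ [e])"
    if "orientation U \<epsilon>" "ordered_basis U (bs @ [e])" "ordered_basis U (e # bs)" "length bs = n"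
    for U \<epsilon> bs and e :: 'a
  proof -
    have "change_of_basis (bs @ [e]) (e # bs) = M"
      using change_of_basis_rotate[of bs e] that(2)
        unfolding M_def that(4)[symmetric] ordered_basis_def by blast
    then show ?thesis using orientation_change[OF that(1-3)] by simp
  qed
  obtain U \<epsilon> bs and e :: 'a where w: "orientation U \<epsilon>" "ordered_basis U (bs @ [e])" "ordered_basis U (e # bs)" "length bs = n"
    using True by blast
  have "Determinant.det M \<noteq> 0"
    using *[OF w] orientation_sign[OF w(1,3)] by auto
  then have sg: "sgn (Determinant.det M) = 1 \<or> sgn (Determinant.det M) = - 1"
    by (auto simp: sgn_if)
  show ?thesis
  proof (rule that[OF sg])
    fix U \<epsilon> bs and e :: 'a
    assume "orientation U \<epsilon>" "ordered_basis U (bs @ [e])" "ordered_basis U (e # bs)" "length bs = n"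
    then have "\<epsilon> (e # bs) = sgn (Determinant.det M) * \<epsilon> (bs @ [e])" by (rule *)
    then show "\<epsilon> (bs @ [e]) = sgn (Determinant.det M) * \<epsilon> (e # bs)" using sg by auto
  qed
qed

lemma orientation_append_change:
  fixes U :: "'a::euclidean_space set"
  assumes "orientation U \<epsilon>" "ordered_basis U (P @ bs @ S)" "ordered_basis U' bs" "ordered_basis U' cs"
  shows "\<epsilon> (P @ cs @ S) = sgn (Determinant.det (change_of_basis bs cs)) * \<epsilon> (P @ bs @ S)"
  using orientation_change[OF assms(1,2) ordered_basis_append_replace[OF assms(2-4)]]
    det_change_of_basis_append[OF assms(2-4)] by simp

text \<open>
  Both sides change by the same determinants, so the sign relation for one pair of bases
  implies it for all of them.
\<close>

lemma oriented_sum_if_bases: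
  fixes U :: "'a::euclidean_space set"
  assumes \<epsilon>: "orientation U \<epsilon>" "orientation U\<^sub>1 \<epsilon>\<^sub>1" "orientation U\<^sub>2 \<epsilon>\<^sub>2"
    and b: "ordered_basis U\<^sub>1 bs" "ordered_basis U\<^sub>2 cs" "ordered_basis U (bs @ cs)"
    and eq: "\<epsilon> (bs @ cs) = \<epsilon>\<^sub>1 bs * \<epsilon>\<^sub>2 cs"
  shows "oriented_sum U\<^sub>1 \<epsilon>\<^sub>1 U\<^sub>2 \<epsilon>\<^sub>2 \<epsilon>"
  unfolding oriented_sum_def
proof (intro conjI allI impI \<epsilon>(2,3))
  fix bs' cs' assume "ordered_basis U\<^sub>1 bs' \<and> ordered_basis U\<^sub>2 cs'"
  then have b': "ordered_basis U\<^sub>1 bs'" and c': "ordered_basis U\<^sub>2 cs'" by blast+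
  have ob: "ordered_basis U (bs' @ cs)"
    using ordered_basis_append_replace[of U "[]" bs cs, OF _ b(1) b'] b(3) by simp
  have "\<epsilon> (bs' @ cs) = sgn (Determinant.det (change_of_basis bs bs')) * \<epsilon> (bs @ cs)"
    using orientation_append_change[OF \<epsilon>(1) _ b(1) b', of "[]" cs] b(3) by simp
  moreover have "\<epsilon> (bs' @ cs') = sgn (Determinant.det (change_of_basis cs cs')) * \<epsilon> (bs' @ cs)"
    using orientation_append_change[OF \<epsilon>(1) _ b(2) c', of bs' "[]"] ob by simp
  ultimately show "\<epsilon> (bs' @ cs') = \<epsilon>\<^sub>1 bs' * \<epsilon>\<^sub>2 cs'"
    using eq orientation_change[OF \<epsilon>(2) b(1) b'] orientation_change[OF \<epsilon>(3) b(2) c'] by simp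
qed

lemma orientation_eq_or_uminus:
  assumes "orientation U \<epsilon>" "orientation U \<epsilon>'" "ordered_basis U bs"
  shows "\<epsilon> = \<epsilon>' \<and> \<epsilon> bs = \<epsilon>' bs \<or> \<epsilon> = - \<epsilon>' \<and> \<epsilon> bs = - \<epsilon>' bs"
proof (cases "\<epsilon> bs = \<epsilon>' bs")
  case True
  then show ?thesis using orientation_eqI[OF assms] by blast
next
  case False
  then have "\<epsilon> bs = (- \<epsilon>') bs"
    using orientation_sign[OF assms(1,3)] orientation_sign[OF assms(2,3)] by auto
  then show ?thesis using orientation_eqI[OF assms(1) orientation_uminus[OF assms(2)] assms(3)] by simp
qed

text \<open>
  Any two compatible pairs of orientations differ by a simultaneous reversal, which leaves the
  product of two odd values unchanged.
\<close>

lemma orient_pair_value: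
  fixes F G :: "'a::euclidean_space set" and a b :: "'a cochain"
  assumes os: "oriented_sum (dir_space F) \<epsilon>\<^sub>1 (dir_space G) \<epsilon>\<^sub>2 \<epsilon>"
    and a: "\<And>\<eta>. orientation (dir_space F) \<eta> \<Longrightarrow> a F (- \<eta>) = - a F \<eta>"
    and b: "\<And>\<eta>. orientation (dir_space G) \<eta> \<Longrightarrow> b G (- \<eta>) = - b G \<eta>"
  shows "(case orient_pair \<epsilon> F G of (\<eta>\<^sub>1, \<eta>\<^sub>2) \<Rightarrow> a F \<eta>\<^sub>1 * b G \<eta>\<^sub>2) = a F \<epsilon>\<^sub>1 * b G \<epsilon>\<^sub>2"
proof -
  obtain \<eta>\<^sub>1 \<eta>\<^sub>2 where \<eta>: "orient_pair \<epsilon> F G = (\<eta>\<^sub>1, \<eta>\<^sub>2)"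
    by (cases "orient_pair \<epsilon> F G")
  have "case orient_pair \<epsilon> F G of (\<eta>\<^sub>1, \<eta>\<^sub>2) \<Rightarrow> oriented_sum (dir_space F) \<eta>\<^sub>1 (dir_space G) \<eta>\<^sub>2 \<epsilon>"
    unfolding orient_pair_def
    by (rule someI_ex[of "\<lambda>x. case x of (\<eta>\<^sub>1, \<eta>\<^sub>2) \<Rightarrow> oriented_sum (dir_space F) \<eta>\<^sub>1 (dir_space G) \<eta>\<^sub>2 \<epsilon>"])
      (use os in auto)
  then have os': "oriented_sum (dir_space F) \<eta>\<^sub>1 (dir_space G) \<eta>\<^sub>2 \<epsilon>"
    by (simp add: \<eta>)
  obtain bs cs where b1: "ordered_basis (dir_space F) bs" and b2: "ordered_basis (dir_space G) cs"
    using ordered_basis_exists subspace_dir_space by metis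
  have o: "orientation (dir_space F) \<epsilon>\<^sub>1" "orientation (dir_space G) \<epsilon>\<^sub>2"
      "orientation (dir_space F) \<eta>\<^sub>1" "orientation (dir_space G) \<eta>\<^sub>2"
    using os os' unfolding oriented_sum_def by blast+
  have prod: "\<eta>\<^sub>1 bs * \<eta>\<^sub>2 cs = \<epsilon>\<^sub>1 bs * \<epsilon>\<^sub>2 cs"
    using os os' b1 b2 unfolding oriented_sum_def by metis
  have nz: "\<epsilon>\<^sub>1 bs \<noteq> 0" "\<epsilon>\<^sub>2 cs \<noteq> 0"
    using orientation_sign[OF o(1) b1] orientation_sign[OF o(2) b2] by auto
  have "a F \<eta>\<^sub>1 * b G \<eta>\<^sub>2 = a F \<epsilon>\<^sub>1 * b G \<epsilon>\<^sub>2"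
    using orientation_eq_or_uminus[OF o(3,1) b1] orientation_eq_or_uminus[OF o(4,2) b2]
  proof (elim disjE conjE)
    assume "\<eta>\<^sub>1 = \<epsilon>\<^sub>1" "\<eta>\<^sub>2 = \<epsilon>\<^sub>2" then show ?thesis
      by simp
  next
    assume "\<eta>\<^sub>1 = - \<epsilon>\<^sub>1" "\<eta>\<^sub>2 = - \<epsilon>\<^sub>2" then show ?thesis
      using a[OF o(1)] b[OF o(2)] by simp
  next
    assume "\<eta>\<^sub>1 bs = \<epsilon>\<^sub>1 bs" "\<eta>\<^sub>2 cs = - \<epsilon>\<^sub>2 cs"
    then show ?thesis using prod nz by simp
  next
    assume "\<eta>\<^sub>1 bs = - \<epsilon>\<^sub>1 bs" "\<eta>\<^sub>2 cs = \<epsilon>\<^sub>2 cs"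
    then show ?thesis using prod nz by simp
  qed
  then show ?thesis by (simp add: \<eta>)
qed

section \<open>Cocycles as balanced weights\<close>

lemma R_deg_uminus:
  assumes "r \<in> R_deg V X p" "F \<in> X" "aff_dim F = int p" "orientation (dir_space F) \<eta>"
  shows "r F (- \<eta>) = - r F \<eta>"
  using assms by (auto simp: R_deg_def cochains_def oriented_cell_def)

text \<open>
  The membership holds for all arguments, because the value is zero outside of the oriented cells.
\<close>

lemma R_deg_ext_power:
  assumes "r \<in> R_deg V X p"
  shows "r F \<eta> \<in> ext_power p (dir_space F)"
proof (cases "oriented_cell X p F \<eta>")
  case False
  then have "r F \<eta> = 0" using assms by (auto simp: R_deg_def cochains_def)
  then show ?thesis by (simp add: ext_power_def span_zero)
qed (use assms in \<open>auto simp: R_deg_def\<close>)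

lemma face_in_complex:
  "P_complex V X \<Longrightarrow> C \<in> X \<Longrightarrow> F face_of C \<Longrightarrow> F \<noteq> {} \<Longrightarrow> F \<in> X"
  unfolding P_complex_def by blast

lemma cell_in_complex: "P_complex V X \<Longrightarrow> C \<in> X \<Longrightarrow> polyhedron C \<and> C \<noteq> {} \<and> C \<subseteq> V"
  unfolding P_complex_def by blast

text \<open>
  Let \<open>c\<close> be the coefficient of \<open>x\<close> along the outward vector of the facet \<open>F\<close>. The orientation \<open>\<eta>\<close>
  of \<open>F\<close> with \<open>\<omega>(x, bs) = \<eta>(bs)\<close> is the boundary orientation multiplied by the sign of \<open>c\<close>. So \<open>val F\<close>
  is \<open>L\<close> of the boundary term where \<open>x\<close> leaves \<open>A\<close>, and its negative where \<open>x\<close> enters.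
  With the vanishing for facets parallel to \<open>x\<close>, the difference of the two sums is \<open>L\<close> of the
  coboundary at \<open>A\<close>.
\<close>

lemma cocycle_balanced:
  fixes X :: "'a::euclidean_space set set" and L :: "'a ext \<Rightarrow> 'a ext"
  assumes X: "P_complex V X" and r: "r \<in> R_deg V X p" and A: "A \<in> X" "aff_dim A = int p + 1"
    and \<omega>: "orientation (dir_space A) \<omega>" and x: "x \<in> dir_space A" and L: "linear L"
    and val: "\<And>F bs \<eta>. F facet_of A \<Longrightarrow> orientation (dir_space F) \<eta> \<Longrightarrow> ordered_basis (dir_space F) bs \<Longrightarrow>
      ordered_basis (dir_space A) (x # bs) \<Longrightarrow> \<omega> (x # bs) = \<eta> bs \<Longrightarrow> val F = L (r F \<eta>)"
    and zero: "\<And>F \<eta>. F facet_of A \<Longrightarrow> x \<in> dir_space F \<Longrightarrow> L (r F \<eta>) = 0"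
  shows "(\<Sum>F | F facet_of A \<and> exits A F x. val F) = (\<Sum>F | F facet_of A \<and> exits A F (- x). val F)"
proof -
  have poly: "polyhedron A" and Ane: "A \<noteq> {}" using cell_in_complex[OF X A(1)] by blast+
  define fac where "fac = {F. F facet_of A}"
  have fin: "finite fac" unfolding fac_def by (rule finite_polyhedron_facets[OF poly])
  let ?b = "boundary_orientation A \<omega>"
  have "oriented_cell X (p + 1) A \<omega>" using A \<omega> by (simp add: oriented_cell_def)
  moreover have "coboundary X p r A \<omega> = 0" using r by (auto simp: R_deg_def)
  ultimately have cocycle: "(\<Sum>F\<in>fac. r F (?b F)) = 0"
    by (simp add: coboundary_def fac_def)
  have dimA: "dim (dir_space A) = Suc p" using dim_dir_space[OF Ane] A(2) by simp
  have facet: "F \<in> X \<and> (x \<in> dir_space F \<longrightarrow> L (r F (?b F)) = 0 \<and> \<not> exits A F x \<and> \<not> exits A F (- x)) \<and>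
      (x \<notin> dir_space F \<longrightarrow> (exits A F x \<longleftrightarrow> \<not> exits A F (- x)) \<and>
        (exits A F x \<longrightarrow> val F = L (r F (?b F))) \<and> (exits A F (- x) \<longrightarrow> val F = - L (r F (?b F))))"
    if F: "F \<in> fac" for F
  proof -
    have Ff: "F facet_of A" using F by (simp add: fac_def)
    then have F': "F face_of A" "F \<noteq> {}" "aff_dim F = int p" using A(2) by (auto simp: facet_of_def)
    have FX: "F \<in> X" using face_in_complex[OF X A(1) F'(1,2)] .
    have dimF: "dim (dir_space F) = p" using dim_dir_space[OF F'(2)] F'(3) by simp
    have FA: "F \<subseteq> A" using F'(1) by (rule face_of_imp_subset)
    have "F \<noteq> A" using F'(3) A(2) by auto
    then have "\<exists>w. \<exists>x\<in>F. \<exists>y\<in>A - F. w = x - y" using F'(2) FA by blast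
    then have "\<exists>x\<in>F. \<exists>y\<in>A - F. outward_vector A F = x - y"
      unfolding outward_vector_def by (rule someI_ex)
    then obtain x0 y0 where w: "x0 \<in> F" "y0 \<in> A - F" "outward_vector A F = x0 - y0" by blast
    let ?w = "outward_vector A F"
    have wA: "?w \<in> dir_space A" unfolding w(3) using w(1,2) FA by (intro diff_in_dir_space) auto
    obtain bs where bs: "ordered_basis (dir_space F) bs"
      using ordered_basis_exists[OF subspace_dir_space] by blast
    have sbs: "span (set bs) = dir_space F" and lbs: "length bs = p"
      using bs ordered_basis_length[OF bs] dimF by (auto simp: ordered_basis_def)
    have ob: "ordered_basis (dir_space A) (e # bs)"
      if e: "e \<in> dir_space A" "\<And>y. y \<in> dir_space A \<Longrightarrow> \<exists>t. y - t *\<^sub>R e \<in> dir_space F" for e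
      unfolding ordered_basis_iff
    proof
      have "dir_space A \<subseteq> span (insert e (set bs))"
        using e(2) span_breakdown_eq[of _ e "set bs"] unfolding sbs by blast
      moreover have "span (insert e (set bs)) \<subseteq> dir_space A"
        using e(1) dir_space_mono[OF FA] sbs span_superset[of "set bs"]
        by (intro span_minimal subspace_dir_space) auto
      ultimately show "span (set (e # bs)) = dir_space A" by simp
      show "length (e # bs) = dim (dir_space A)" using lbs dimA by simp
    qed
    have wdec: "\<exists>t. y - t *\<^sub>R ?w \<in> dir_space F" if "y \<in> dir_space A" for y
      using facet_complement[OF poly Ff w(1,2) that] unfolding w(3) by metis
    have obw: "ordered_basis (dir_space A) (?w # bs)" by (rule ob[OF wA wdec])
    have b: "orientation (dir_space F) (?b F)"
      unfolding boundary_orientation_def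
        using orientation_restrict[OF \<omega> _ bs, of "[?w]" "[]", unfolded append_Cons append_Nil append_Nil2] obw
          by blast
    have bbs: "?b F bs = \<omega> (?w # bs)" using bs by (simp add: boundary_orientation_def)
    obtain t where t: "x - t *\<^sub>R (x0 - y0) \<in> dir_space F" "exits A F x \<longleftrightarrow> t > 0"
        "exits A F (- x) \<longleftrightarrow> t < 0" "x \<in> dir_space F \<longleftrightarrow> t = 0"
      using facet_complement[OF poly Ff w(1,2) x] by blast
    have "val F = sgn t *\<^sub>R L (r F (?b F))" if "t \<noteq> 0"
    proof -
      have obx: "ordered_basis (dir_space A) (x # bs)"
      proof (rule ob[OF x])
        fix y assume "y \<in> dir_space A"
        then obtain s where s: "y - s *\<^sub>R ?w \<in> dir_space F" using wdec by blast
        have "(y - s *\<^sub>R ?w) - (s / t) *\<^sub>R (x - t *\<^sub>R ?w) \<in> dir_space F"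
          by (rule subspace_diff[OF subspace_dir_space s subspace_scale[OF subspace_dir_space]])
            (use t(1) w(3) in simp)
        moreover have "(y - s *\<^sub>R ?w) - (s / t) *\<^sub>R (x - t *\<^sub>R ?w) = y - (s / t) *\<^sub>R x"
          using that by (simp add: algebra_simps)
        ultimately show "\<exists>t. y - t *\<^sub>R x \<in> dir_space F" by metis
      qed
      have \<omega>x: "\<omega> (x # bs) = sgn t * ?b F bs"
        unfolding bbs using orientation_first[OF \<omega> obw obx, of t] t(1) sbs w(3) by simp
      show ?thesis
      proof (cases "t > 0")
        case True
        then show ?thesis using val[OF Ff b bs obx] \<omega>x by simp
      next
        case False
        then have "\<omega> (x # bs) = (- ?b F) bs" using \<omega>x that by simp
        then have "val F = L (r F (- ?b F))"
          by (rule val[OF Ff orientation_uminus[OF b] bs obx])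
        then have "val F = L (- r F (?b F))"
          by (simp only: R_deg_uminus[OF r FX F'(3) b])
        then show ?thesis using False that by (simp add: linear_neg[OF L])
      qed
    qed
    then show ?thesis using FX t zero[OF Ff] by (cases "t = 0"; cases "t > 0") auto
  qed
  have "(\<Sum>F | F facet_of A \<and> exits A F x. val F) - (\<Sum>F | F facet_of A \<and> exits A F (- x). val F) =
      (\<Sum>F\<in>fac. (if exits A F x then val F else 0)) - (\<Sum>F\<in>fac. (if exits A F (- x) then val F else 0))"
    using fin by (simp add: fac_def sum.inter_filter[symmetric])
  also have "\<dots> = (\<Sum>F\<in>fac. (if exits A F x then val F else 0) - (if exits A F (- x) then val F else 0))"
    by (simp add: sum_subtractf)
  also have "\<dots> = (\<Sum>F\<in>fac. L (r F (?b F)))"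
  proof (rule sum.cong[OF refl])
    fix F assume "F \<in> fac"
    from facet[OF this]
    show "(if exits A F x then val F else 0) - (if exits A F (- x) then val F else 0) = L (r F (?b F))"
      by (cases "x \<in> dir_space F"; cases "exits A F x") auto
  qed
  also have "\<dots> = L (\<Sum>F\<in>fac. r F (?b F))" by (simp add: linear_sum[OF L])
  also have "\<dots> = 0" by (simp add: cocycle linear_0[OF L])
  finally show ?thesis by simp
qed

text \<open>
  The dimensions of \<open>F\<close> and \<open>G\<close> select the degrees, so that one weight serves all summands of the
  product on the direct sum.
\<close>

definition pair_weight :: "'a::euclidean_space orient \<Rightarrow> (nat \<Rightarrow> 'a cochain) \<Rightarrow> (nat \<Rightarrow> 'a cochain) \<Rightarrow>
    'a set \<Rightarrow> 'a set \<Rightarrow> 'a ext" where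
  "pair_weight \<epsilon> r s F G = (case orient_pair \<epsilon> F G of (\<epsilon>\<^sub>1, \<epsilon>\<^sub>2) \<Rightarrow>
     r (nat (aff_dim F)) F \<epsilon>\<^sub>1 * s (nat (aff_dim G)) G \<epsilon>\<^sub>2)"

text \<open>
  In the following context \<open>A \<times> B\<close> is a face of dimension \<open>k + 1\<close> of the square of \<open>C\<close>, and \<open>x\<close> spans the
  line of directions that \<open>A\<close> and \<open>B\<close> have in common.
\<close>

context
  fixes X :: "'a::euclidean_space set set" and V C :: "'a set" and r s :: "nat \<Rightarrow> 'a cochain"
    and \<epsilon> :: "'a orient" and A B :: "'a set" and x :: 'a and k :: nat
  assumes X: "P_complex V X" and r: "\<And>p. r p \<in> R_deg V X p" and s: "\<And>p. s p \<in> R_deg V X p"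
    and C: "C \<in> X" "aff_dim C = int k" and \<epsilon>: "orientation (dir_space C) \<epsilon>"
    and AB: "A face_of C" "B face_of C" "aff_dim A + aff_dim B = int k + 1" "A \<noteq> {}" "B \<noteq> {}"
    and x: "x \<noteq> 0" "dir_space A \<inter> dir_space B = span {x}"
begin

lemma faces_span: "{y + z | y z. y \<in> dir_space A \<and> z \<in> dir_space B} = dir_space C"
  and dims_add: "dim (dir_space A) + dim (dir_space B) = k + 1" and dim_C: "dim (dir_space C) = k"
  and x_in: "x \<in> dir_space A" "x \<in> dir_space B" and AB_in: "A \<in> X" "B \<in> X"
  and AB_sub: "dir_space A \<subseteq> dir_space C" "dir_space B \<subseteq> dir_space C"
proof -
  show AB_sub: "dir_space A \<subseteq> dir_space C" "dir_space B \<subseteq> dir_space C"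
    using AB(1,2) dir_space_mono face_of_imp_subset by blast+
  show "A \<in> X" "B \<in> X" using face_in_complex[OF X C(1)] AB by blast+
  show "x \<in> dir_space A" "x \<in> dir_space B" using x(2) span_base[of x "{x}"] by auto
  have "C \<noteq> {}" using cell_in_complex[OF X C(1)] by blast
  then show C': "dim (dir_space C) = k" using dim_dir_space[of C] C(2) by simp
  show d: "dim (dir_space A) + dim (dir_space B) = k + 1"
    using dim_dir_space[OF AB(4)] dim_dir_space[OF AB(5)] AB(3) by linarith
  have "dim (dir_space A \<inter> dir_space B) = 1" unfolding x(2) using x(1) by (simp add: dim_singleton)
  then have "dim {y + z | y z. y \<in> dir_space A \<and> z \<in> dir_space B} = k"
    using dim_sums_Int[OF subspace_dir_space[of A] subspace_dir_space[of B]] d by simp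
  then show "{y + z | y z. y \<in> dir_space A \<and> z \<in> dir_space B} = dir_space C"
    using C' AB_sub by (intro subspace_dim_equal subspace_sums subspace_dir_space)
      (auto intro: subspace_add[OF subspace_dir_space])
qed

lemma ordered_basis_two_faces:
  assumes "span (set bs) = dir_space A" "span (insert x (set cs)) = dir_space B"
    "length (bs @ cs) = k"
  shows "ordered_basis (dir_space C) (bs @ cs)"
  unfolding ordered_basis_iff
proof
  have "x \<in> span (set bs)" using assms(1) x_in by simp
  then have "x \<in> span (set bs \<union> set cs)"
    using span_mono[of "set bs" "set bs \<union> set cs"] by blast
  then have "span (set bs \<union> set cs) = span (insert x (set bs \<union> set cs))"
    by (simp add: span_redundant)
  also have "\<dots> = span (set bs \<union> insert x (set cs))" by simp
  also have "\<dots> = dir_space C" unfolding span_Un assms(1,2) by (rule faces_span)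
  finally show "span (set (bs @ cs)) = dir_space C" by simp
  show "length (bs @ cs) = dim (dir_space C)" using assms(3) dim_C by simp
qed

text \<open>
  Complete \<open>x\<close> to a basis \<open>x, cs\<close> of the direction space of \<open>B\<close>. Completion by \<open>cs\<close> turns bases of the
  direction space of \<open>A\<close> into bases of that of \<open>C\<close> and so orients \<open>A\<close>. A facet \<open>F\<close> with basis
  \<open>bs\<close> contributes with the orientation of \<open>(bs, x, cs)\<close>; moving \<open>x\<close> to the front costs a sign
  \<open>\<kappa>\<close> that is common to all facets and is absorbed into the orientation of \<open>B\<close>.
\<close>

lemma pair_weight_balanced_first:
  "(\<Sum>F | F facet_of A \<and> exits A F x. pair_weight \<epsilon> r s F B) =
   (\<Sum>F | F facet_of A \<and> exits A F (- x). pair_weight \<epsilon> r s F B)"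
proof -
  define p q where "p = nat (aff_dim A) - 1" and "q = nat (aff_dim B)"
  have "dim (dir_space A) \<noteq> 0" using x(1) x_in(1) by (auto simp: dim_eq_0)
  moreover have "nat (aff_dim A) = dim (dir_space A)" using dim_dir_space[OF AB(4)] by (metis nat_int)
  ultimately have dA: "aff_dim A = int p + 1" "dim (dir_space A) = Suc p"
    using dim_dir_space[OF AB(4)] unfolding p_def by linarith+
  have dB: "aff_dim B = int q" "dim (dir_space B) = q"
    using dim_dir_space[OF AB(5)] by (auto simp: q_def)
  have k: "p + q = k" using dims_add dA(2) dB(2) by simp
  obtain cs where cs: "ordered_basis (dir_space B) (x # cs)"
    using ordered_basis_extend_vector[OF subspace_dir_space x_in(2) x(1)] .
  have lcs: "Suc (length cs) = q" using ordered_basis_length[OF cs] dB(2) by simp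
  have scs: "span (insert x (set cs)) = dir_space B" using cs by (simp add: ordered_basis_def)
  have obA: "ordered_basis (dir_space C) (as @ cs)" if "ordered_basis (dir_space A) as" for as
    using that lcs k dA(2) ordered_basis_length[OF that]
    by (intro ordered_basis_two_faces scs) (auto simp: ordered_basis_def)
  obtain as where as: "ordered_basis (dir_space A) as"
    using ordered_basis_exists[OF subspace_dir_space] by blast
  define \<omega> where "\<omega> = (\<lambda>as. if ordered_basis (dir_space A) as then \<epsilon> (as @ cs) else 0)"
  have \<omega>: "orientation (dir_space A) \<omega>"
    unfolding \<omega>_def
      using orientation_restrict[OF \<epsilon> _ as, of "[]" cs, unfolded append_Cons append_Nil append_Nil2] obA[OF as]
        by blast
  obtain \<kappa> :: real where \<kappa>: "\<kappa> = 1 \<or> \<kappa> = - 1"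
    "\<And>U \<epsilon> bs e. orientation U \<epsilon> \<Longrightarrow> ordered_basis U (bs @ [e]) \<Longrightarrow> ordered_basis U (e # bs) \<Longrightarrow>
      length bs = p \<Longrightarrow> \<epsilon> (bs @ [e :: 'a]) = \<kappa> * \<epsilon> (e # bs)"
    using orientation_rotate by blast
  obtain \<theta> where \<theta>: "orientation (dir_space B) \<theta>" "\<theta> (x # cs) = \<kappa>"
  proof -
    obtain \<theta> where "orientation (dir_space B) \<theta>" "\<theta> (x # cs) = 1"
      using orientation_exists[OF cs] .
    then show ?thesis using that[of \<theta>] that[of "- \<theta>"] orientation_uminus \<kappa>(1) by auto
  qed
  show ?thesis
  proof (rule cocycle_balanced[OF X r AB_in(1) dA(1) \<omega> x_in(1)])
    show "linear (\<lambda>z. z * s q B \<theta>)"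
      by (rule linearI) (simp_all add: distrib_right)
    fix F assume F: "F facet_of A"
    have dF: "aff_dim F = int p" "F \<noteq> {}" using F dA(1) by (auto simp: facet_of_def)
    then have dF': "dim (dir_space F) = p" using dim_dir_space[of F] by simp
    show "r p F \<eta> * s q B \<theta> = 0" if "x \<in> dir_space F" for \<eta>
      by (rule ext_power_mult_eq_0[OF R_deg_ext_power[OF r] R_deg_ext_power[OF s] _ _ that x_in(2) x(1)])
        (use dF' dB in auto)
    fix bs \<eta> assume \<eta>: "orientation (dir_space F) \<eta>" and bs: "ordered_basis (dir_space F) bs"
      and obx: "ordered_basis (dir_space A) (x # bs)" and eq: "\<omega> (x # bs) = \<eta> bs"
    have obx': "ordered_basis (dir_space A) (bs @ [x])" using obx by (simp add: ordered_basis_iff)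
    have lbs: "length bs = p" using ordered_basis_length[OF bs] dF' by simp
    have "\<epsilon> (bs @ (x # cs)) = \<omega> (bs @ [x])" using obx' by (simp add: \<omega>_def)
    also have "\<dots> = \<kappa> * \<omega> (x # bs)" by (rule \<kappa>(2)[OF \<omega> obx' obx lbs])
    also have "\<dots> = \<eta> bs * \<theta> (x # cs)" using eq \<theta>(2) by simp
    finally have "oriented_sum (dir_space F) \<eta> (dir_space B) \<theta> \<epsilon>"
      using obA[OF obx'] by (intro oriented_sum_if_bases[OF \<epsilon> \<eta> \<theta>(1) bs cs]) auto
    then have "(case orient_pair \<epsilon> F B of (\<epsilon>\<^sub>1, \<epsilon>\<^sub>2) \<Rightarrow> r p F \<epsilon>\<^sub>1 * s q B \<epsilon>\<^sub>2) = r p F \<eta> * s q B \<theta>"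
    proof (rule orient_pair_value)
      have "F \<in> X" using face_in_complex[OF X AB_in(1)] F dF(2) by (auto simp: facet_of_def)
      then show "r p F (- \<eta>) = - r p F \<eta>" if "orientation (dir_space F) \<eta>" for \<eta>
        using R_deg_uminus[OF r _ dF(1) that] by blast
      show "s q B (- \<eta>) = - s q B \<eta>" if "orientation (dir_space B) \<eta>" for \<eta>
        using R_deg_uminus[OF s AB_in(2) dB(1) that] .
    qed
    then show "pair_weight \<epsilon> r s F B = r p F \<eta> * s q B \<theta>"
      unfolding pair_weight_def using dF(1) dB(1) by simp
  qed
qed

text \<open>
  The same argument with a basis \<open>as, x\<close> of the direction space of \<open>A\<close>; here \<open>x\<close> already stands in front of the
  basis of the facet of \<open>B\<close>, and no sign appears.
\<close>

lemma pair_weight_balanced_second: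
  "(\<Sum>G | G facet_of B \<and> exits B G x. pair_weight \<epsilon> r s A G) =
   (\<Sum>G | G facet_of B \<and> exits B G (- x). pair_weight \<epsilon> r s A G)"
proof -
  define p q where "p = nat (aff_dim A)" and "q = nat (aff_dim B) - 1"
  have "dim (dir_space B) \<noteq> 0" using x(1) x_in(2) by (auto simp: dim_eq_0)
  moreover have "nat (aff_dim B) = dim (dir_space B)" using dim_dir_space[OF AB(5)] by (metis nat_int)
  ultimately have dB: "aff_dim B = int q + 1" "dim (dir_space B) = Suc q"
    using dim_dir_space[OF AB(5)] unfolding q_def by linarith+
  have dA: "aff_dim A = int p" "dim (dir_space A) = p"
    using dim_dir_space[OF AB(4)] by (auto simp: p_def)
  have k: "p + q = k" using dims_add dA(2) dB(2) by simp
  obtain as where as': "ordered_basis (dir_space A) (x # as)"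
    using ordered_basis_extend_vector[OF subspace_dir_space x_in(1) x(1)] .
  then have as: "ordered_basis (dir_space A) (as @ [x])" by (simp add: ordered_basis_iff)
  have las: "Suc (length as) = p" using ordered_basis_length[OF as] dA(2) by simp
  have obB: "ordered_basis (dir_space C) (as @ bs)" if b: "ordered_basis (dir_space B) bs" for bs
  proof -
    have "x \<in> span (set bs)" using b x_in(2) by (simp add: ordered_basis_def)
    then have "x \<in> span (set as \<union> set bs)"
      using span_mono[of "set bs" "set as \<union> set bs"] by blast
    then have "span (set as \<union> set bs) = span (insert x (set as \<union> set bs))"
      by (simp add: span_redundant)
    also have "\<dots> = span (set (as @ [x]) \<union> set bs)" by simp
    also have "\<dots> = dir_space C"
      using as b faces_span unfolding span_Un by (simp add: ordered_basis_def)
    finally show ?thesis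
      using las k dB(2) dim_C ordered_basis_length[OF b] by (simp add: ordered_basis_iff)
  qed
  obtain bs0 where bs0: "ordered_basis (dir_space B) bs0"
    using ordered_basis_exists[OF subspace_dir_space] by blast
  define \<omega> where "\<omega> = (\<lambda>bs. if ordered_basis (dir_space B) bs then \<epsilon> (as @ bs) else 0)"
  have \<omega>: "orientation (dir_space B) \<omega>"
    unfolding \<omega>_def
      using orientation_restrict[OF \<epsilon> _ bs0, of as "[]", unfolded append_Cons append_Nil append_Nil2] obB[OF bs0]
        by blast
  obtain \<theta> where \<theta>: "orientation (dir_space A) \<theta>" "\<theta> (as @ [x]) = 1"
    using orientation_exists[OF as] .
  show ?thesis
  proof (rule cocycle_balanced[OF X s AB_in(2) dB(1) \<omega> x_in(2)])
    show "linear (\<lambda>z. r p A \<theta> * z)"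
      by (rule linearI) (simp_all add: distrib_left)
    fix G assume G: "G facet_of B"
    have dG: "aff_dim G = int q" "G \<noteq> {}" using G dB(1) by (auto simp: facet_of_def)
    then have dG': "dim (dir_space G) = q" using dim_dir_space[of G] by simp
    show "r p A \<theta> * s q G \<eta> = 0" if "x \<in> dir_space G" for \<eta>
      by (rule ext_power_mult_eq_0[OF R_deg_ext_power[OF r] R_deg_ext_power[OF s] _ _ x_in(1) that x(1)])
        (use dG' dA in auto)
    fix cs \<eta> assume \<eta>: "orientation (dir_space G) \<eta>" and cs: "ordered_basis (dir_space G) cs"
      and obx: "ordered_basis (dir_space B) (x # cs)" and eq: "\<omega> (x # cs) = \<eta> cs"
    have "\<epsilon> ((as @ [x]) @ cs) = \<omega> (x # cs)" using obx by (simp add: \<omega>_def)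
    also have "\<dots> = \<theta> (as @ [x]) * \<eta> cs" using eq \<theta>(2) by simp
    finally have "oriented_sum (dir_space A) \<theta> (dir_space G) \<eta> \<epsilon>"
      using obB[OF obx] by (intro oriented_sum_if_bases[OF \<epsilon> \<theta>(1) \<eta> as cs]) auto
    then have "(case orient_pair \<epsilon> A G of (\<epsilon>\<^sub>1, \<epsilon>\<^sub>2) \<Rightarrow> r p A \<epsilon>\<^sub>1 * s q G \<epsilon>\<^sub>2) = r p A \<theta> * s q G \<eta>"
    proof (rule orient_pair_value)
      have "G \<in> X" using face_in_complex[OF X AB_in(2)] G dG(2) by (auto simp: facet_of_def)
      then show "s q G (- \<eta>) = - s q G \<eta>" if "orientation (dir_space G) \<eta>" for \<eta>
        using R_deg_uminus[OF s _ dG(1) that] by blast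
      show "r p A (- \<eta>) = - r p A \<eta>" if "orientation (dir_space A) \<eta>" for \<eta>
        using R_deg_uminus[OF r AB_in(1) dA(1) that] .
    qed
    then show "pair_weight \<epsilon> r s A G = r p A \<theta> * s q G \<eta>"
      unfolding pair_weight_def using dG(1) dA(1) by simp
  qed
qed

end

section \<open>Faces of products of polytopes\<close>

lemma dir_space_Times:
  assumes "A \<noteq> {}" "B \<noteq> {}"
  shows "dir_space (A \<times> B) = dir_space A \<times> dir_space B"
proof
  obtain a b where a: "a \<in> A" and b: "b \<in> B" using assms by blast
  show "dir_space (A \<times> B) \<subseteq> dir_space A \<times> dir_space B"
    unfolding dir_space_def[of "A \<times> B"]
    by (intro span_minimal subspace_Times subspace_dir_space) (auto intro: diff_in_dir_space)
  have "subspace {x. (x, 0) \<in> dir_space (A \<times> B)}"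
  proof (rule subspaceI)
    fix x y :: 'a and c :: real
    show "0 \<in> {x. (x, 0) \<in> dir_space (A \<times> B)}"
      using subspace_0[OF subspace_dir_space[of "A \<times> B"]] by (simp add: zero_prod_def)
    show "x + y \<in> {x. (x, 0) \<in> dir_space (A \<times> B)}"
      if "x \<in> {x. (x, 0) \<in> dir_space (A \<times> B)}" "y \<in> {x. (x, 0) \<in> dir_space (A \<times> B)}"
      using subspace_add[OF subspace_dir_space[of "A \<times> B"], of "(x, 0)" "(y, 0)"] that by simp
    show "c *\<^sub>R x \<in> {x. (x, 0) \<in> dir_space (A \<times> B)}"
      if "x \<in> {x. (x, 0) \<in> dir_space (A \<times> B)}"
      using subspace_scale[OF subspace_dir_space[of "A \<times> B"], of "(x, 0)" c] that by simp
  qed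
  then have 1: "dir_space A \<subseteq> {x. (x, 0) \<in> dir_space (A \<times> B)}"
    unfolding dir_space_def[of A]
  proof (intro span_minimal, clarify)
    fix x y assume "x \<in> A" "y \<in> A"
    then show "(x - y, 0) \<in> dir_space (A \<times> B)"
      using diff_in_dir_space[of "(x, b)" "A \<times> B" "(y, b)"] b by simp
  qed
  have "subspace {x. (0, x) \<in> dir_space (A \<times> B)}"
  proof (rule subspaceI)
    fix x y :: 'b and c :: real
    show "0 \<in> {x. (0, x) \<in> dir_space (A \<times> B)}"
      using subspace_0[OF subspace_dir_space[of "A \<times> B"]] by (simp add: zero_prod_def)
    show "x + y \<in> {x. (0, x) \<in> dir_space (A \<times> B)}"
      if "x \<in> {x. (0, x) \<in> dir_space (A \<times> B)}" "y \<in> {x. (0, x) \<in> dir_space (A \<times> B)}"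
      using subspace_add[OF subspace_dir_space[of "A \<times> B"], of "(0, x)" "(0, y)"] that by simp
    show "c *\<^sub>R x \<in> {x. (0, x) \<in> dir_space (A \<times> B)}"
      if "x \<in> {x. (0, x) \<in> dir_space (A \<times> B)}"
      using subspace_scale[OF subspace_dir_space[of "A \<times> B"], of "(0, x)" c] that by simp
  qed
  then have 2: "dir_space B \<subseteq> {x. (0, x) \<in> dir_space (A \<times> B)}"
    unfolding dir_space_def[of B]
  proof (intro span_minimal, clarify)
    fix x y assume "x \<in> B" "y \<in> B"
    then show "(0, x - y) \<in> dir_space (A \<times> B)"
      using diff_in_dir_space[of "(a, x)" "A \<times> B" "(a, y)"] a by simp
  qed
  show "dir_space A \<times> dir_space B \<subseteq> dir_space (A \<times> B)"
  proof clarify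
    fix x y assume "x \<in> dir_space A" "y \<in> dir_space B"
    then have "(x, 0) + (0, y) \<in> dir_space (A \<times> B)"
      using 1 2 by (intro subspace_add[OF subspace_dir_space]) auto
    then show "(x, y) \<in> dir_space (A \<times> B)" by simp
  qed
qed

lemma aff_dim_Times:
  fixes A :: "'a::euclidean_space set" and B :: "'b::euclidean_space set"
  assumes "A \<noteq> {}" "B \<noteq> {}"
  shows "aff_dim (A \<times> B) = aff_dim A + aff_dim B"
proof -
  have "int (dim (dir_space (A \<times> B))) = aff_dim (A \<times> B)"
    by (rule dim_dir_space) (use assms in blast)
  then show ?thesis
    using dim_dir_space[OF assms(1)] dim_dir_space[OF assms(2)]
      dim_Times[OF subspace_dir_space[of A] subspace_dir_space[of B]]
    by (simp add: dir_space_Times[OF assms])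
qed

lemma maximizers_Times:
  assumes "A \<noteq> {}" "B \<noteq> {}"
  shows "maximizers (A \<times> B) (a, b) = maximizers A a \<times> maximizers B b"
proof -
  have "x \<in> maximizers A a \<and> y \<in> maximizers B b"
    if "(x, y) \<in> maximizers (A \<times> B) (a, b)" for x y
  proof -
    have xy: "x \<in> A" "y \<in> B" "\<And>x' y'. x' \<in> A \<Longrightarrow> y' \<in> B \<Longrightarrow> a \<bullet> x' + b \<bullet> y' \<le> a \<bullet> x + b \<bullet> y"
      using that by (auto simp: maximizers_def)
    show ?thesis using xy(1,2) xy(3)[OF _ xy(2)] xy(3)[OF xy(1)] by (auto simp: maximizers_def)
  qed
  moreover have "(x, y) \<in> maximizers (A \<times> B) (a, b)"
    if "x \<in> maximizers A a" "y \<in> maximizers B b" for x y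
    using that by (auto simp: maximizers_def intro: add_mono)
  ultimately show ?thesis by auto
qed

text \<open>
  The dimension drops in exactly one factor.
\<close>

lemma facet_of_Times_iff:
  fixes A :: "'a::euclidean_space set" and B :: "'b::euclidean_space set"
  assumes A: "convex A" "A \<noteq> {}" and B: "convex B" "B \<noteq> {}"
  shows "H facet_of A \<times> B \<longleftrightarrow> (\<exists>F. F facet_of A \<and> H = F \<times> B) \<or> (\<exists>G. G facet_of B \<and> H = A \<times> G)"
proof
  assume H: "H facet_of A \<times> B"
  then have "H face_of A \<times> B" "H \<noteq> {}" by (auto simp: facet_of_def)
  then obtain F G where FG: "F face_of A" "G face_of B" "H = F \<times> G" "F \<noteq> {}" "G \<noteq> {}"
    by (auto simp: face_of_Times_decomp)
  have d: "aff_dim F + aff_dim G = aff_dim A + aff_dim B - 1"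
    using H aff_dim_Times[OF FG(4,5)] aff_dim_Times[OF A(2) B(2)] FG(3) by (simp add: facet_of_def)
  have F: "F = A \<or> aff_dim F < aff_dim A" and G: "G = B \<or> aff_dim G < aff_dim B"
    using face_of_aff_dim_lt[OF A(1) FG(1)] face_of_aff_dim_lt[OF B(1) FG(2)] by blast+
  show "(\<exists>F. F facet_of A \<and> H = F \<times> B) \<or> (\<exists>G. G facet_of B \<and> H = A \<times> G)"
  proof (cases "F = A")
    case True
    then show ?thesis using FG d by (auto simp: facet_of_def)
  next
    case False
    then have "G = B" using F G d by linarith
    then show ?thesis using FG d by (auto simp: facet_of_def)
  qed
next
  assume "(\<exists>F. F facet_of A \<and> H = F \<times> B) \<or> (\<exists>G. G facet_of B \<and> H = A \<times> G)"
  then show "H facet_of A \<times> B"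
  proof (elim disjE exE conjE)
    fix F assume F: "F facet_of A" "H = F \<times> B"
    then have "F \<noteq> {}" by (simp add: facet_of_def)
    then show ?thesis
      using F A B face_of_Times[OF _ face_of_refl[OF B(1)], of F A] aff_dim_Times[of F B] aff_dim_Times[of A B]
      by (simp add: facet_of_def)
  next
    fix G assume G: "G facet_of B" "H = A \<times> G"
    then have "G \<noteq> {}" by (simp add: facet_of_def)
    then show ?thesis
      using G A B face_of_Times[OF face_of_refl[OF A(1)], of G B] aff_dim_Times[of A G] aff_dim_Times[of A B]
      by (simp add: facet_of_def)
  qed
qed

lemma exits_Times_first:
  assumes "F \<noteq> {}" "B \<noteq> {}" "e2 \<in> dir_space B"
  shows "exits (A \<times> B) (F \<times> B) (e1, e2) \<longleftrightarrow> exits A F e1"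
proof
  assume "exits (A \<times> B) (F \<times> B) (e1, e2)"
  then obtain t :: real and x y where t: "t > 0" "x \<in> F \<times> B" "y \<in> A \<times> B - F \<times> B"
      "(e1, e2) - t *\<^sub>R (x - y) \<in> dir_space (F \<times> B)"
    unfolding exits_def by blast
  then have "e1 - t *\<^sub>R (fst x - fst y) \<in> dir_space F" "fst x \<in> F" "fst y \<in> A - F"
    unfolding dir_space_Times[OF assms(1,2)] by (auto simp: mem_Times_iff)
  then show "exits A F e1" unfolding exits_def using t(1) by blast
next
  assume "exits A F e1"
  then obtain t :: real and x y where t: "t > 0" "x \<in> F" "y \<in> A" "y \<notin> F" "e1 - t *\<^sub>R (x - y) \<in> dir_space F"
    unfolding exits_def by blast
  obtain b where b: "b \<in> B" using assms(2) by blast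
  have "(e1, e2) - t *\<^sub>R ((x, b) - (y, b)) \<in> dir_space (F \<times> B)"
    using t(5) assms(3) dir_space_Times[OF assms(1,2)] by simp
  then show "exits (A \<times> B) (F \<times> B) (e1, e2)"
    unfolding exits_def using t b by blast
qed

lemma exits_Times_second:
  assumes "A \<noteq> {}" "G \<noteq> {}" "e1 \<in> dir_space A"
  shows "exits (A \<times> B) (A \<times> G) (e1, e2) \<longleftrightarrow> exits B G e2"
proof
  assume "exits (A \<times> B) (A \<times> G) (e1, e2)"
  then obtain t :: real and x y where t: "t > 0" "x \<in> A \<times> G" "y \<in> A \<times> B - A \<times> G"
      "(e1, e2) - t *\<^sub>R (x - y) \<in> dir_space (A \<times> G)"
    unfolding exits_def by blast
  then have "e2 - t *\<^sub>R (snd x - snd y) \<in> dir_space G" "snd x \<in> G" "snd y \<in> B - G"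
    unfolding dir_space_Times[OF assms(1,2)] by (auto simp: mem_Times_iff)
  then show "exits B G e2" unfolding exits_def using t(1) by blast
next
  assume "exits B G e2"
  then obtain t :: real and x y where t: "t > 0" "x \<in> G" "y \<in> B" "y \<notin> G" "e2 - t *\<^sub>R (x - y) \<in> dir_space G"
    unfolding exits_def by blast
  obtain a where a: "a \<in> A" using assms(1) by blast
  have "(e1, e2) - t *\<^sub>R ((a, x) - (a, y)) \<in> dir_space (A \<times> G)"
    using t(5) assms(3) dir_space_Times[OF assms(1,2)] by simp
  then show "exits (A \<times> B) (A \<times> G) (e1, e2)"
    unfolding exits_def using t a by blast
qed

lemma sum_exit_facets_Times:
  fixes A :: "'a::euclidean_space set" and B :: "'b::euclidean_space set"
  assumes A: "polyhedron A" "A \<noteq> {}" and B: "polyhedron B" "B \<noteq> {}"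
    and e: "e1 \<in> dir_space A" "e2 \<in> dir_space B"
  shows "(\<Sum>H | H facet_of A \<times> B \<and> exits (A \<times> B) H (e1, e2). m H) =
    (\<Sum>F | F facet_of A \<and> exits A F e1. m (F \<times> B)) + (\<Sum>G | G facet_of B \<and> exits B G e2. m (A \<times> G))"
proof -
  let ?FA = "{F. F facet_of A \<and> exits A F e1}" and ?GB = "{G. G facet_of B \<and> exits B G e2}"
  note facet_iff = facet_of_Times_iff[OF polyhedron_imp_convex[OF A(1)] A(2) polyhedron_imp_convex[OF B(1)] B(2)]
  have neA: "F \<noteq> {}" if "F facet_of A" for F using that by (simp add: facet_of_def)
  have neB: "G \<noteq> {}" if "G facet_of B" for G using that by (simp add: facet_of_def)
  have "{H. H facet_of A \<times> B \<and> exits (A \<times> B) H (e1, e2)} = (\<lambda>F. F \<times> B) ` ?FA \<union> (\<lambda>G. A \<times> G) ` ?GB"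
  proof (intro Set.set_eqI iffI)
    fix H assume "H \<in> {H. H facet_of A \<times> B \<and> exits (A \<times> B) H (e1, e2)}"
    then have H: "H facet_of A \<times> B" "exits (A \<times> B) H (e1, e2)" by blast+
    from H(1) show "H \<in> (\<lambda>F. F \<times> B) ` ?FA \<union> (\<lambda>G. A \<times> G) ` ?GB"
      unfolding facet_iff
    proof (elim disjE exE conjE)
      fix F assume F: "F facet_of A" "H = F \<times> B"
      then have "F \<in> ?FA" using exits_Times_first[OF neA B(2) e(2)] H(2) by simp
      then show ?thesis using F(2) by blast
    next
      fix G assume G: "G facet_of B" "H = A \<times> G"
      then have "G \<in> ?GB" using exits_Times_second[OF A(2) neB e(1)] H(2) by simp
      then show ?thesis using G(2) by blast
    qed
  next
    fix H assume "H \<in> (\<lambda>F. F \<times> B) ` ?FA \<union> (\<lambda>G. A \<times> G) ` ?GB"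
    then show "H \<in> {H. H facet_of A \<times> B \<and> exits (A \<times> B) H (e1, e2)}"
    proof (elim UnE imageE)
      fix F assume F: "F \<in> ?FA" "H = F \<times> B"
      then have "exits (A \<times> B) H (e1, e2)" using exits_Times_first[OF neA B(2) e(2)] by simp
      moreover have "H facet_of A \<times> B" unfolding facet_iff using F by blast
      ultimately show ?thesis by blast
    next
      fix G assume G: "G \<in> ?GB" "H = A \<times> G"
      then have "exits (A \<times> B) H (e1, e2)" using exits_Times_second[OF A(2) neB e(1)] by simp
      moreover have "H facet_of A \<times> B" unfolding facet_iff using G by blast
      ultimately show ?thesis by blast
    qed
  qed
  moreover have "(\<lambda>F. F \<times> B) ` ?FA \<inter> (\<lambda>G. A \<times> G) ` ?GB = {}"
  proof (rule ccontr)
    assume "\<not> ?thesis"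
    then obtain F G where FG: "F facet_of A" "G facet_of B" "F \<times> B = A \<times> G" by blast
    then have "F = A" using neA[OF FG(1)] B(2) by (auto simp: times_eq_iff)
    then show False using FG(1) by (simp add: facet_of_def)
  qed
  moreover have "finite ?FA" "finite ?GB"
    using finite_polyhedron_facets[OF A(1)] finite_polyhedron_facets[OF B(1)] by simp_all
  moreover have "inj_on (\<lambda>F. F \<times> B) ?FA" "inj_on (\<lambda>G. A \<times> G) ?GB"
    using A(2) B(2) by (auto simp: inj_on_def times_eq_iff)
  ultimately show ?thesis by (simp add: sum.union_disjoint sum.reindex)
qed

section \<open>The balanced weight on the square of a cell\<close>

definition antidiagonal :: "'a::real_vector set \<Rightarrow> ('a \<times> 'a) set" where
  "antidiagonal U = (\<lambda>x. (- x, x)) ` U"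

lemma sliced_polytope_square:
  fixes C :: "'a::euclidean_space set"
  assumes "polytope C" "aff_dim C = int k"
  shows "sliced_polytope (C \<times> C) (antidiagonal (dir_space C)) k"
proof
  have ne: "C \<noteq> {}" using assms(2) by auto
  obtain S where "finite S" "C = convex hull S" using assms(1) by (auto simp: polytope_def)
  then show "polytope (C \<times> C)"
    unfolding polytope_def by (intro exI[of _ "S \<times> S"]) (simp add: convex_hull_Times)
  have lin: "linear (\<lambda>x. (- x, x) :: 'a \<times> 'a)" by (rule linearI) auto
  show "subspace (antidiagonal (dir_space C))"
    unfolding antidiagonal_def by (rule linear_subspace_image[OF lin subspace_dir_space])
  show "antidiagonal (dir_space C) \<subseteq> dir_space (C \<times> C)"
    unfolding dir_space_Times[OF ne ne] antidiagonal_def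
    using subspace_neg[OF subspace_dir_space[of C]] by auto
  show "C \<times> C \<noteq> {}" using ne by blast
  have "dim (antidiagonal (dir_space C)) = dim (dir_space C)"
    unfolding antidiagonal_def by (rule dim_image_eq[OF lin]) (auto simp: inj_on_def)
  moreover have "dim (dir_space C) = k" using dim_dir_space[OF ne] assms(2) by simp
  ultimately show "dim (dir_space (C \<times> C)) = dim (antidiagonal (dir_space C)) + k"
    unfolding dir_space_Times[OF ne ne] by (simp add: dim_Times subspace_dir_space)
qed

text \<open>
  A line in the direction of \<open>A \<times> B\<close> and in the antidiagonal is spanned by \<open>(-x, x)\<close>, where \<open>x\<close> spans the
  common directions of \<open>A\<close> and \<open>B\<close>. It leaves \<open>A \<times> B\<close> through \<open>F \<times> B\<close> iff \<open>-x\<close> leaves \<open>A\<close> through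
  \<open>F\<close>, and through \<open>A \<times> G\<close> iff \<open>x\<close> leaves \<open>B\<close> through \<open>G\<close>.
\<close>

lemma balanced_weight_square:
  fixes X :: "'a::euclidean_space set set"
  assumes X: "P_complex V X" and r: "\<And>p. r p \<in> R_deg V X p" and s: "\<And>p. s p \<in> R_deg V X p"
    and C: "C \<in> X" "aff_dim C = int k" and \<epsilon>: "orientation (dir_space C) \<epsilon>"
  shows "balanced_weight (C \<times> C) (antidiagonal (dir_space C)) k
    (\<lambda>H. pair_weight \<epsilon> r s (fst ` H) (snd ` H))" (is "balanced_weight _ ?\<Delta> k ?m")
  unfolding balanced_weight_def
proof (intro allI impI, elim conjE)
  fix H e assume H: "H face_of C \<times> C" "aff_dim H = int k + 1" and e: "e \<noteq> 0" "dir_space H \<inter> ?\<Delta> = span {e}"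
  have "H \<noteq> {}" using H(2) by auto
  then obtain A B where AB: "A face_of C" "B face_of C" "H = A \<times> B" "A \<noteq> {}" "B \<noteq> {}"
    using H(1) by (auto simp: face_of_Times_decomp)
  have poly: "polyhedron A" "polyhedron B"
    using face_of_polyhedron_polyhedron AB(1,2) cell_in_complex[OF X C(1)] by blast+
  have dims: "aff_dim A + aff_dim B = int k + 1" using H(2) AB aff_dim_Times by metis
  have dH: "dir_space H = dir_space A \<times> dir_space B" using AB dir_space_Times by metis
  have "e \<in> dir_space H \<inter> ?\<Delta>" unfolding e(2) by (rule span_base) simp
  then obtain x where x: "e = (- x, x)" "x \<in> dir_space B" "- x \<in> dir_space A"
    unfolding dH antidiagonal_def by auto
  have xA: "x \<in> dir_space A" using subspace_neg[OF subspace_dir_space x(3)] by simp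
  have x0: "x \<noteq> 0" using e(1) x(1) by (auto simp: zero_prod_def)
  have "dir_space A \<inter> dir_space B = span {x}"
  proof
    show "span {x} \<subseteq> dir_space A \<inter> dir_space B"
      using xA x(2) by (intro span_minimal subspace_inter subspace_dir_space) auto
    show "dir_space A \<inter> dir_space B \<subseteq> span {x}"
    proof
      fix y assume y: "y \<in> dir_space A \<inter> dir_space B"
      then have "y \<in> dir_space C" using dir_space_mono[OF face_of_imp_subset[OF AB(1)]] by blast
      then have "(- y, y) \<in> dir_space H \<inter> ?\<Delta>"
        using y subspace_neg[OF subspace_dir_space[of A]] unfolding dH antidiagonal_def by auto
      then obtain c where "(- y, y) = c *\<^sub>R e" unfolding e(2) span_singleton by blast
      then have "y = c *\<^sub>R x" unfolding x(1) by simp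
      then show "y \<in> span {x}" by (simp add: span_base span_scale)
    qed
  qed
  note bal = pair_weight_balanced_first[OF X r s C \<epsilon> AB(1,2) dims AB(4,5) x0 this]
    pair_weight_balanced_second[OF X r s C \<epsilon> AB(1,2) dims AB(4,5) x0 this]
  have m: "?m (F \<times> G) = pair_weight \<epsilon> r s F G"
    if "F \<noteq> {}" "G \<noteq> {}" for F G :: "'a set"
    using that by simp
  have sums: "(\<Sum>K | K facet_of H \<and> exits H K (- y, y). ?m K) =
      (\<Sum>F | F facet_of A \<and> exits A F (- y). pair_weight \<epsilon> r s F B) +
      (\<Sum>G | G facet_of B \<and> exits B G y. pair_weight \<epsilon> r s A G)" if "y \<in> dir_space A" "y \<in> dir_space B" for y
  proof -
    have "(\<Sum>F | F facet_of A \<and> exits A F (- y). ?m (F \<times> B)) =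
        (\<Sum>F | F facet_of A \<and> exits A F (- y). pair_weight \<epsilon> r s F B)"
      by (rule sum.cong[OF refl], rule m) (use AB in \<open>auto simp: facet_of_def\<close>)
    moreover have "(\<Sum>G | G facet_of B \<and> exits B G y. ?m (A \<times> G)) =
        (\<Sum>G | G facet_of B \<and> exits B G y. pair_weight \<epsilon> r s A G)"
      by (rule sum.cong[OF refl], rule m) (use AB in \<open>auto simp: facet_of_def\<close>)
    ultimately show ?thesis
      unfolding AB(3) using sum_exit_facets_Times[OF poly(1) AB(4) poly(2) AB(5), of "- y" y ?m] that
        subspace_neg[OF subspace_dir_space, of y A] by simp
  qed
  have "- e = (- (- x), - x)" by (simp add: x(1))
  then show "(\<Sum>K | K facet_of H \<and> exits H K e. ?m K) = (\<Sum>K | K facet_of H \<and> exits H K (- e). ?m K)"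
    using sums[OF xA x(2)] sums[of "- x"] subspace_neg[OF subspace_dir_space x(2)] x(3) bal x(1) by simp
qed

section \<open>Convenient points and generic functionals\<close>

text \<open>
  Restricts to the isomorphism of \<open>U\<close> with its dual that is given by the inner product, with functionals encoded as in
  \<open>dual_space\<close>.
\<close>

definition riesz :: "'a::euclidean_space set \<Rightarrow> 'a \<Rightarrow> 'a \<Rightarrow> real" where
  "riesz U a = dual_restrict U (\<lambda>y. a \<bullet> y)"

lemma linear_riesz: "linear (riesz U)"
  by (rule linearI) (auto simp: riesz_def dual_restrict_def fun_eq_iff inner_add_left scaleR_fun_def)

lemma riesz_in_dual_space: "subspace U \<Longrightarrow> riesz U a \<in> dual_space U"
  by (auto simp: riesz_def dual_restrict_def dual_space_def inner_add_right subspace_add subspace_scale)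

lemma inj_on_riesz: "subspace U \<Longrightarrow> inj_on (riesz U) U"
proof (rule inj_onI)
  fix a b assume U: "subspace U" and ab: "a \<in> U" "b \<in> U" "riesz U a = riesz U b"
  then have "a - b \<in> U" by (intro subspace_diff)
  then have "a \<bullet> (a - b) = b \<bullet> (a - b)"
    using fun_cong[OF ab(3), of "a - b"] by (simp add: riesz_def dual_restrict_def)
  then have "(a - b) \<bullet> (a - b) = 0" by (simp add: inner_diff_left)
  then show "a = b" by simp
qed

text \<open>
  The representing vector has the values on an orthonormal basis of \<open>U\<close> as its coordinates.
\<close>

lemma dual_space_riesz:
  assumes U: "subspace U" and w: "w \<in> dual_space U"
  obtains a where "a \<in> U" "w = riesz U a"
proof -
  have add: "w (x + y) = w x + w y" if "x \<in> U" "y \<in> U" for x y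
    using w that unfolding dual_space_def by blast
  have scale: "w (c *\<^sub>R x) = c * w x" if "x \<in> U" for c x
    using w that unfolding dual_space_def by blast
  have out: "w x = 0" if "x \<notin> U" for x using w that unfolding dual_space_def by blast
  obtain B where B: "B \<subseteq> U" "pairwise Linear_Algebra.orthogonal B" "\<And>x. x \<in> B \<Longrightarrow> norm x = 1"
      "independent B" "card B = dim U" "span B = U"
    using orthonormal_basis_subspace[OF U] by metis
  have fin: "finite B" using B(4) independent_imp_finite by blast
  define a where "a = (\<Sum>b\<in>B. w b *\<^sub>R b)"
  have aU: "a \<in> U" unfolding a_def using B(1) by (intro subspace_sum[OF U] subspace_scale[OF U]) auto
  have ab: "a \<bullet> b = w b" if "b \<in> B" for b
  proof -
    have "a \<bullet> b = (\<Sum>c\<in>B. w c * (c \<bullet> b))" by (simp add: a_def inner_sum_left)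
    also have "\<dots> = (\<Sum>c\<in>B. if c = b then w b else 0)"
    proof (rule sum.cong[OF refl])
      fix c assume c: "c \<in> B"
      show "w c * (c \<bullet> b) = (if c = b then w b else 0)"
      proof (cases "c = b")
        case True
        have "b \<bullet> b = 1" using B(3)[OF that] by (simp add: dot_square_norm)
        then show ?thesis using True by simp
      next
        case False
        then have "c \<bullet> b = 0"
          using B(2) c that by (auto simp: pairwise_def Linear_Algebra.orthogonal_def)
        then show ?thesis using False by simp
      qed
    qed
    also have "\<dots> = w b" using fin that by simp
    finally show ?thesis .
  qed
  have w0: "w 0 = 0" using scale[of 0 0] subspace_0[OF U] by simp
  have "subspace {x \<in> U. a \<bullet> x = w x}"
    by (rule subspaceI) (auto simp: subspace_0[OF U] w0 add scale inner_add_right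
        intro: subspace_add[OF U] subspace_scale[OF U])
  then have "span B \<subseteq> {x \<in> U. a \<bullet> x = w x}" using B(1) ab by (intro span_minimal) auto
  then have "w = riesz U a"
    unfolding riesz_def dual_restrict_def using B(6) out by (auto simp: fun_eq_iff)
  then show ?thesis using aU that by blast
qed

lemma dual_space_inner:
  fixes U :: "'a::euclidean_space set"
  assumes "subspace U" "w \<in> dual_space U"
  shows "\<exists>a. \<forall>x\<in>U. w x = a \<bullet> x"
proof -
  obtain a where "w = riesz U a" using dual_space_riesz[OF assms] by blast
  then show ?thesis by (auto simp: riesz_def dual_restrict_def)
qed

lemma riesz_in_dual_cone_iff:
  assumes "F \<subseteq> C"
  shows "riesz (dir_space C) a \<in> dual_cone C F \<longleftrightarrow> F \<subseteq> maximizers C a"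
proof -
  have "riesz (dir_space C) a (y - x) = a \<bullet> y - a \<bullet> x" if "x \<in> F" "y \<in> C" for x y
    using diff_in_dir_space[of y C x] that assms by (auto simp: riesz_def dual_restrict_def inner_diff_right)
  then show ?thesis
    using assms riesz_in_dual_space[OF subspace_dir_space, of C a]
    by (auto simp: dual_cone_def maximizers_def)
qed

lemma dual_cone_riesz:
  fixes C :: "'a::euclidean_space set"
  assumes "w \<in> dual_cone C F"
  shows "\<exists>a\<in>dir_space C. w = riesz (dir_space C) a"
proof -
  have "w \<in> dual_space (dir_space C)" using assms by (simp add: dual_cone_def)
  then show ?thesis using dual_space_riesz[OF subspace_dir_space] by metis
qed

text \<open>
  The vectors \<open>a\<close> and \<open>b\<close> represent a point of the dual cone of \<open>F\<close> and its translate by \<open>v\<close>, which is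
  to lie in the dual cone of \<open>G\<close>.
\<close>

lemma face_pairs_iff:
  fixes C :: "'a::euclidean_space set"
  assumes rep: "\<forall>x\<in>dir_space C. v x = w \<bullet> x"
  shows "(F, G) \<in> face_pairs p q C v \<longleftrightarrow>
    F face_of C \<and> aff_dim F = int p \<and> G face_of C \<and> aff_dim G = int q \<and>
    (\<exists>a b. (\<forall>x\<in>dir_space C. (b - a) \<bullet> x = w \<bullet> x) \<and> F \<subseteq> maximizers C a \<and> G \<subseteq> maximizers C b)"
proof -
  let ?U = "dir_space C"
  note v = rep[rule_format]
  have meet: "(+) (dual_restrict ?U v) ` dual_cone C F \<inter> dual_cone C G \<noteq> {} \<longleftrightarrow>
      (\<exists>a b. (\<forall>x\<in>?U. (b - a) \<bullet> x = w \<bullet> x) \<and> F \<subseteq> maximizers C a \<and> G \<subseteq> maximizers C b)"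
    if "F \<subseteq> C" "G \<subseteq> C"
  proof
    assume "(+) (dual_restrict ?U v) ` dual_cone C F \<inter> dual_cone C G \<noteq> {}"
    then obtain f g where fg: "f \<in> dual_cone C F" "g \<in> dual_cone C G" "g = dual_restrict ?U v + f"
      by blast
    obtain a where a: "f = riesz ?U a" using dual_cone_riesz[OF fg(1)] by blast
    obtain b where b: "g = riesz ?U b" using dual_cone_riesz[OF fg(2)] by blast
    have "(b - a) \<bullet> x = w \<bullet> x" if "x \<in> ?U" for x
      using fun_cong[OF fg(3), of x] that v unfolding a b
      by (simp add: riesz_def dual_restrict_def inner_diff_left)
    moreover have "F \<subseteq> maximizers C a" "G \<subseteq> maximizers C b"
      using fg(1,2) riesz_in_dual_cone_iff that unfolding a b by blast+
    ultimately show "\<exists>a b. (\<forall>x\<in>?U. (b - a) \<bullet> x = w \<bullet> x) \<and> F \<subseteq> maximizers C a \<and> G \<subseteq> maximizers C b"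
      by blast
  next
    assume "\<exists>a b. (\<forall>x\<in>?U. (b - a) \<bullet> x = w \<bullet> x) \<and> F \<subseteq> maximizers C a \<and> G \<subseteq> maximizers C b"
    then obtain a b where ab: "\<And>x. x \<in> ?U \<Longrightarrow> (b - a) \<bullet> x = w \<bullet> x" "F \<subseteq> maximizers C a" "G \<subseteq> maximizers C b"
      by blast
    have "riesz ?U b = dual_restrict ?U v + riesz ?U a"
    proof
      fix x
      show "riesz ?U b x = (dual_restrict ?U v + riesz ?U a) x"
        using ab(1)[of x] v[of x] by (auto simp: riesz_def dual_restrict_def inner_diff_left)
    qed
    moreover have "riesz ?U a \<in> dual_cone C F" "riesz ?U b \<in> dual_cone C G"
      using ab(2,3) riesz_in_dual_cone_iff that by blast+
    ultimately show "(+) (dual_restrict ?U v) ` dual_cone C F \<inter> dual_cone C G \<noteq> {}" by blast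
  qed
  have def: "(F, G) \<in> face_pairs p q C v \<longleftrightarrow>
      F face_of C \<and> aff_dim F = int p \<and> G face_of C \<and> aff_dim G = int q \<and>
      (+) (dual_restrict ?U v) ` dual_cone C F \<inter> dual_cone C G \<noteq> {}"
    by (simp add: face_pairs_def)
  show ?thesis
    unfolding def by (metis meet face_of_imp_subset)
qed

text \<open>
  Dimensions of subspaces of the dual are computed on the Euclidean side.
\<close>

lemma riesz_preimage:
  fixes U :: "'a::euclidean_space set"
  assumes U: "subspace U" and S: "subspace S" "S \<subseteq> dual_space U"
  shows "subspace {a \<in> U. riesz U a \<in> S}" "dim S = dim {a \<in> U. riesz U a \<in> S}"
proof -
  show P: "subspace {a \<in> U. riesz U a \<in> S}"
    by (rule subspaceI)
      (auto simp: linear_0[OF linear_riesz] linear_add[OF linear_riesz] linear_scale[OF linear_riesz]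
        intro: subspace_add[OF U] subspace_add[OF S(1)] subspace_scale[OF U] subspace_scale[OF S(1)]
          subspace_0[OF U] subspace_0[OF S(1)])
  have "S = riesz U ` {a \<in> U. riesz U a \<in> S}"
  proof
    show "S \<subseteq> riesz U ` {a \<in> U. riesz U a \<in> S}"
    proof
      fix w assume w: "w \<in> S"
      then obtain a where "a \<in> U" "w = riesz U a" using dual_space_riesz[OF U] S(2) by blast
      then show "w \<in> riesz U ` {a \<in> U. riesz U a \<in> S}" using w by blast
    qed
  qed auto
  moreover have "inj_on (riesz U) (span {a \<in> U. riesz U a \<in> S})"
    unfolding span_eq_iff[THEN iffD2, OF P] by (rule inj_on_subset[OF inj_on_riesz[OF U]]) auto
  ultimately show "dim S = dim {a \<in> U. riesz U a \<in> S}"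
    using dim_image_eq[OF linear_riesz] by metis
qed

lemma subspace_dual_space: "subspace U \<Longrightarrow> subspace (dual_space U)"
  by (rule subspaceI) (auto simp: dual_space_def scaleR_fun_def algebra_simps subspace_add subspace_scale)

lemma dim_dual_space:
  fixes U :: "'a::euclidean_space set"
  assumes "subspace U" shows "dim (dual_space U) = dim U"
proof -
  have "{a \<in> U. riesz U a \<in> dual_space U} = U" using riesz_in_dual_space[OF assms] by auto
  then show ?thesis using riesz_preimage(2)[OF assms subspace_dual_space[OF assms]] by simp
qed

lemma dir_space_translation: "dir_space ((+) v ` S) = dir_space S"
proof -
  have "{x - y |x y. x \<in> (+) v ` S \<and> y \<in> (+) v ` S} = {x - y |x y. x \<in> S \<and> y \<in> S}"
  proof (intro Set.set_eqI iffI)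
    fix z assume "z \<in> {x - y |x y. x \<in> (+) v ` S \<and> y \<in> (+) v ` S}"
    then obtain x y where "x \<in> S" "y \<in> S" "z = (v + x) - (v + y)" by blast
    then have "z = x - y" "x \<in> S" "y \<in> S" by simp_all
    then show "z \<in> {x - y |x y. x \<in> S \<and> y \<in> S}" by blast
  next
    fix z assume "z \<in> {x - y |x y. x \<in> S \<and> y \<in> S}"
    then obtain x y where "x \<in> S" "y \<in> S" "z = x - y" by blast
    then have "z = (v + x) - (v + y)" "x \<in> S" "y \<in> S" by simp_all
    then show "z \<in> {x - y |x y. x \<in> (+) v ` S \<and> y \<in> (+) v ` S}" by blast
  qed
  then show ?thesis by (simp only: dir_space_def)
qed

lemma dim_orthogonal_in:
  fixes U :: "'a::euclidean_space set"
  assumes "subspace L" "subspace U" "L \<subseteq> U"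
  shows "dim {a \<in> U. \<forall>e\<in>L. a \<bullet> e = 0} + dim L = dim U"
proof -
  have "{a \<in> U. \<forall>e\<in>L. a \<bullet> e = 0} = {y \<in> U. \<forall>x\<in>L. Linear_Algebra.orthogonal x y}"
    by (auto simp: Linear_Algebra.orthogonal_def inner_commute)
  then show ?thesis using dim_subspace_orthogonal_to_vectors[OF assms] by simp
qed

text \<open>
  A functional that is maximal on all of \<open>F\<close> is constant on \<open>F\<close>.
\<close>

lemma dual_cone_dir_orthogonal:
  fixes C :: "'a::euclidean_space set"
  assumes "F \<subseteq> C" "a \<in> dir_space C" "riesz (dir_space C) a \<in> dir_space (dual_cone C F)" "e \<in> dir_space F"
  shows "a \<bullet> e = 0"
proof -
  have eC: "e \<in> dir_space C" using assms(4) dir_space_mono[OF assms(1)] by blast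
  have cone: "w e = 0" if w: "w \<in> dual_cone C F" for w
  proof -
    obtain b where b: "w = riesz (dir_space C) b" using dual_cone_riesz[OF w] by blast
    then have "F \<subseteq> maximizers C b" using riesz_in_dual_cone_iff[OF assms(1)] w by blast
    then have "e \<in> dir_space (maximizers C b)" using dir_space_mono assms(4) by blast
    then show ?thesis using orthogonal_maximizers[of e C b] eC b by (simp add: riesz_def dual_restrict_def)
  qed
  have "subspace {w :: 'a \<Rightarrow> real. w e = 0}"
    by (rule subspaceI) (auto simp: scaleR_fun_def)
  moreover have "{x - y |x y. x \<in> dual_cone C F \<and> y \<in> dual_cone C F} \<subseteq> {w. w e = 0}"
  proof clarify
    fix x y assume "x \<in> dual_cone C F" "y \<in> dual_cone C F"
    from cone[OF this(1)] cone[OF this(2)] show "(x - y) e = 0" by simp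
  qed
  ultimately have "dir_space (dual_cone C F) \<subseteq> {w. w e = 0}"
    unfolding dir_space_def[of "dual_cone C F"] by (rule span_minimal[rotated])
  then have "riesz (dir_space C) a e = 0" using assms(3) by blast
  then show ?thesis using eC by (simp add: riesz_def dual_restrict_def)
qed

lemma dual_cone_subset_dual_space: "dir_space (dual_cone C F) \<subseteq> dual_space (dir_space C)"
  unfolding dir_space_def[of "dual_cone C F"]
  by (rule span_minimal)
    (auto simp: dual_cone_def intro: subspace_diff[OF subspace_dual_space[OF subspace_dir_space]]
      subspace_dual_space subspace_dir_space)

text \<open>
  Let \<open>F\<close> and \<open>G\<close> be the faces of maximizers of \<open>a\<close> and \<open>b\<close>, with \<open>dim F + dim G \<ge> k\<close>. Their dual cones span
  subspaces of dimensions at most \<open>k - dim F\<close> and \<open>k - dim G\<close>, and these add up to at most \<open>k\<close>. Since the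
  translated cone of \<open>F\<close> meets the cone of \<open>G\<close>, transversality says that the dimensions add up to at
  least \<open>k\<close>. So equality holds everywhere: the spans are the full annihilators of the directions of
  \<open>F\<close> and \<open>G\<close>, they meet in zero only, and dually the directions of \<open>F\<close> and \<open>G\<close> are complementary.
\<close>

lemma convenient_imp_generic:
  fixes C :: "'a::euclidean_space set"
  assumes v: "v \<in> convenient V X" and C: "C \<in> X" "aff_dim C = int k" "polytope C"
    and rep: "\<forall>x\<in>dir_space C. v x = w \<bullet> x"
  shows "generic_functional (C \<times> C) (antidiagonal (dir_space C)) k (0, w)"
  unfolding generic_functional_def
proof (intro allI impI, elim conjE)
  fix c :: "'a \<times> 'a"
  assume c: "\<forall>x\<in>antidiagonal (dir_space C). c \<bullet> x = (0, w) \<bullet> x"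
    and kc: "int k \<le> aff_dim (maximizers (C \<times> C) c)"
  let ?U = "dir_space C"
  note w = rep[rule_format]
  have ne: "C \<noteq> {}" using C(2) by auto
  have cC: "convex C" "compact C" using C(3) by (auto intro: polytope_imp_convex polytope_imp_compact)
  obtain a b where ab: "c = (a, b)" by (cases c)
  have ab': "(b - a) \<bullet> x = w \<bullet> x" if "x \<in> ?U" for x
    using c that by (auto simp: ab antidiagonal_def inner_diff_left)
  define F G where "F = maximizers C a" and "G = maximizers C b"
  have F: "F face_of C" "F \<noteq> {}" "F \<subseteq> C" and G: "G face_of C" "G \<noteq> {}" "G \<subseteq> C"
    unfolding F_def G_def using maximizers_face_of[OF cC(1)] maximizers_nonempty[OF cC(2) ne]
    by (auto simp: maximizers_def)
  have M: "maximizers (C \<times> C) c = F \<times> G"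
    unfolding ab F_def G_def by (rule maximizers_Times[OF ne ne])
  have sU: "subspace ?U" by (rule subspace_dir_space)
  have dU: "dim ?U = k" using dim_dir_space[OF ne] C(2) by simp
  have FU: "dir_space F \<subseteq> ?U" "dir_space G \<subseteq> ?U" using dir_space_mono F(3) G(3) by blast+
  let ?f = "dim (dir_space F)" and ?g = "dim (dir_space G)"
  have dF: "aff_dim F = int ?f" and dG: "aff_dim G = int ?g" using dim_dir_space F(2) G(2) by metis+
  have fgk: "k \<le> ?f + ?g" using kc M aff_dim_Times[OF F(2) G(2)] dF dG by simp
  have fk: "?f \<le> k" "?g \<le> k" using dim_subset[OF FU(1)] dim_subset[OF FU(2)] dU by auto
  \<comment> \<open>Any such degrees serve: the convenience for \<open>(p, q)\<close> puts both dual cones into the skeleta.\<close>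
  obtain p q where pq: "p \<le> ?f" "q \<le> ?g" "p + q = k"
    using fgk fk
      by (metis add_diff_inverse_nat diff_le_self le_add_diff_inverse le_diff_conv add.commute not_le order.refl)
  define D1 D2 where "D1 = dual_cone C F" and "D2 = dual_cone C G"
  define P1 P2 where "P1 = {x \<in> ?U. riesz ?U x \<in> dir_space D1}" and "P2 = {x \<in> ?U. riesz ?U x \<in> dir_space D2}"
  have D: "dir_space D1 \<subseteq> dual_space ?U" "dir_space D2 \<subseteq> dual_space ?U"
    unfolding D1_def D2_def by (rule dual_cone_subset_dual_space)+
  have P1: "subspace P1" "dim (dir_space D1) = dim P1" and P2: "subspace P2" "dim (dir_space D2) = dim P2"
    unfolding P1_def P2_def using riesz_preimage[OF sU subspace_dir_space] D by blast+
  define N1 N2 where "N1 = {x \<in> ?U. \<forall>e\<in>dir_space F. x \<bullet> e = 0}" and "N2 = {x \<in> ?U. \<forall>e\<in>dir_space G. x \<bullet> e = 0}"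
  have PN: "P1 \<subseteq> N1" "P2 \<subseteq> N2"
    unfolding P1_def P2_def N1_def N2_def D1_def D2_def
    using dual_cone_dir_orthogonal[OF F(3)] dual_cone_dir_orthogonal[OF G(3)] by blast+
  have dN: "dim N1 + ?f = k" "dim N2 + ?g = k"
    unfolding N1_def N2_def using dim_orthogonal_in[OF subspace_dir_space sU] FU dU by simp_all
  have dP: "dim P1 \<le> dim N1" "dim P2 \<le> dim N2" using PN dim_subset by blast+
  have sk: "D1 \<in> skeleton q (dual_fan C)" "D2 \<in> skeleton p (dual_fan C)"
    unfolding skeleton_def dual_fan_def
    using F G dP dN pq P1(2) P2(2) unfolding D1_def D2_def by auto
  have "F \<subseteq> maximizers C a" "G \<subseteq> maximizers C b" by (simp_all add: F_def G_def)
  then have "riesz ?U a \<in> D1" "riesz ?U b \<in> D2"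
    unfolding D1_def D2_def using riesz_in_dual_cone_iff F(3) G(3) by blast+
  moreover have "riesz ?U b = dual_restrict ?U v + riesz ?U a"
  proof
    fix x
    show "riesz ?U b x = (dual_restrict ?U v + riesz ?U a) x"
      using ab'[of x] w[of x] by (auto simp: riesz_def dual_restrict_def inner_diff_left)
  qed
  ultimately have meet: "(+) (dual_restrict ?U v) ` D1 \<inter> D2 \<noteq> {}" by blast
  have "v \<in> pq_convenient V X p q" using v by (auto simp: convenient_def)
  then have transv: "transversal (dual_space ?U) ((\<lambda>D. (+) (dual_restrict ?U v) ` D) ` skeleton q (dual_fan C))
      (skeleton p (dual_fan C))"
    using C(1,2) pq(3) unfolding pq_convenient_def by auto
  have "codim_in (dual_space ?U) (dir_space ((+) (dual_restrict ?U v) ` D1) \<inter> dir_space D2) =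
      codim_in (dual_space ?U) (dir_space ((+) (dual_restrict ?U v) ` D1)) + codim_in (dual_space ?U) (dir_space D2)"
    using transv[unfolded transversal_def, rule_format, OF imageI[OF sk(1)] sk(2) meet] .
  then have "int (dim (dir_space D1)) + int (dim (dir_space D2)) = int k + int (dim (dir_space D1 \<inter> dir_space D2))"
    unfolding codim_in_def dir_space_translation dim_dual_space[OF sU] dU by linarith
  moreover have "dim (dir_space D1 \<inter> dir_space D2) = dim (P1 \<inter> P2)"
  proof -
    have "P1 \<inter> P2 = {x \<in> ?U. riesz ?U x \<in> dir_space D1 \<inter> dir_space D2}"
      unfolding P1_def P2_def by blast
    then show ?thesis
      using riesz_preimage(2)[OF sU subspace_inter[OF subspace_dir_space subspace_dir_space], of D1 D2] D
        by auto
  qed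
  ultimately have eq: "dim P1 = dim N1" "dim P2 = dim N2" "?f + ?g = k" "dim (P1 \<inter> P2) = 0"
    using P1(2) P2(2) dP dN fgk by linarith+
  let ?S = "{x + y |x y. x \<in> dir_space F \<and> y \<in> dir_space G}"
  have sN: "subspace N1" "subspace N2"
    unfolding N1_def N2_def
    by (auto intro!: subspaceI simp: inner_add_left intro: subspace_add[OF sU] subspace_scale[OF sU] subspace_0[OF sU])
  have "P1 = N1" "P2 = N2"
    using subspace_dim_equal[OF P1(1) sN(1) PN(1)] subspace_dim_equal[OF P2(1) sN(2) PN(2)] eq(1,2)
      by simp_all
  then have N0: "dim (N1 \<inter> N2) = 0" using eq(4) by simp
  have sS: "subspace ?S" by (intro subspace_sums subspace_dir_space)
  have SU: "?S \<subseteq> ?U" using FU by (auto intro: subspace_add[OF sU])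
  have "{x \<in> ?U. \<forall>e\<in>?S. x \<bullet> e = 0} \<subseteq> N1 \<inter> N2"
  proof -
    have "dir_space F \<subseteq> ?S" using subspace_0[OF subspace_dir_space[of G]] by force
    moreover have "dir_space G \<subseteq> ?S" using subspace_0[OF subspace_dir_space[of F]] by force
    ultimately show ?thesis unfolding N1_def N2_def by blast
  qed
  then have "dim {x \<in> ?U. \<forall>e\<in>?S. x \<bullet> e = 0} \<le> dim (N1 \<inter> N2)"
    by (rule dim_subset)
  then have "dim ?S = k" using dim_orthogonal_in[OF sS sU SU] dU N0 by linarith
  then have "dim (dir_space F \<inter> dir_space G) = 0"
    using dim_sums_Int[OF subspace_dir_space[of F] subspace_dir_space[of G]] eq(3) by linarith
  then have FG0: "dir_space F \<inter> dir_space G \<subseteq> {0}" by (simp add: dim_eq_0)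
  have "dir_space (F \<times> G) \<inter> antidiagonal ?U = {0}"
  proof
    show "dir_space (F \<times> G) \<inter> antidiagonal ?U \<subseteq> {0}"
    proof
      fix z assume z: "z \<in> dir_space (F \<times> G) \<inter> antidiagonal ?U"
      then obtain x where x: "z = (- x, x)" "- x \<in> dir_space F" "x \<in> dir_space G"
        unfolding dir_space_Times[OF F(2) G(2)] antidiagonal_def by auto
      then have "x \<in> dir_space F" using subspace_neg[OF subspace_dir_space x(2)] by simp
      then show "z \<in> {0}" using x FG0 by (auto simp: zero_prod_def)
    qed
    show "{0} \<subseteq> dir_space (F \<times> G) \<inter> antidiagonal ?U"
      using subspace_0[OF sU] subspace_0[OF subspace_dir_space[of "F \<times> G"]]
      by (auto simp: antidiagonal_def zero_prod_def intro!: image_eqI[of _ _ 0])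
  qed
  then show "aff_dim (maximizers (C \<times> C) c) = int k \<and> dir_space (maximizers (C \<times> C) c) \<inter> antidiagonal ?U = {0}"
    unfolding M using aff_dim_Times[OF F(2) G(2)] dF dG eq(3) by simp
qed

section \<open>Independence of the convenient point\<close>

lemma selected_faces_square:
  fixes C :: "'a::euclidean_space set"
  assumes rep: "\<forall>x\<in>dir_space C. v x = w \<bullet> x" and ne: "C \<noteq> {}"
  shows "selected_faces (C \<times> C) (antidiagonal (dir_space C)) k (0, w) =
    (\<lambda>(F, G). F \<times> G) ` (\<Union>p\<le>k. face_pairs p (k - p) C v)"
proof (intro Set.set_eqI iffI)
  fix H assume "H \<in> selected_faces (C \<times> C) (antidiagonal (dir_space C)) k (0, w)"
  then obtain c where H: "H face_of C \<times> C" "aff_dim H = int k"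
      "\<forall>x\<in>antidiagonal (dir_space C). c \<bullet> x = (0, w) \<bullet> x" "H \<subseteq> maximizers (C \<times> C) c"
    unfolding selected_faces_def by blast
  obtain a b where ab: "c = (a, b)" by (cases c)
  have "H \<noteq> {}" using H(2) by auto
  then obtain F G where FG: "F face_of C" "G face_of C" "H = F \<times> G" "F \<noteq> {}" "G \<noteq> {}"
    using H(1) by (auto simp: face_of_Times_decomp)
  let ?p = "dim (dir_space F)" and ?q = "dim (dir_space G)"
  have d: "aff_dim F = int ?p" "aff_dim G = int ?q" using dim_dir_space FG(4,5) by metis+
  then have k: "?p + ?q = k" using H(2) FG(3) aff_dim_Times[OF FG(4,5)] by simp
  have "(b - a) \<bullet> x = w \<bullet> x" if "x \<in> dir_space C" for x
    using H(3) that by (auto simp: ab antidiagonal_def inner_diff_left)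
  moreover have "F \<subseteq> maximizers C a" "G \<subseteq> maximizers C b"
    using H(4) FG(4,5) unfolding ab FG(3) maximizers_Times[OF ne ne] by blast+
  ultimately have "(F, G) \<in> face_pairs ?p ?q C v"
    unfolding face_pairs_iff[OF rep] using FG(1,2) d by blast
  moreover have "?q = k - ?p" "?p \<le> k" using k by auto
  ultimately show "H \<in> (\<lambda>(F, G). F \<times> G) ` (\<Union>p\<le>k. face_pairs p (k - p) C v)"
    unfolding FG(3) by auto
next
  fix H assume "H \<in> (\<lambda>(F, G). F \<times> G) ` (\<Union>p\<le>k. face_pairs p (k - p) C v)"
  then obtain p F G where p: "p \<le> k" "(F, G) \<in> face_pairs p (k - p) C v" "H = F \<times> G" by auto
  then obtain a b where FG: "F face_of C" "aff_dim F = int p" "G face_of C" "aff_dim G = int (k - p)"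
      "\<forall>x\<in>dir_space C. (b - a) \<bullet> x = w \<bullet> x" "F \<subseteq> maximizers C a" "G \<subseteq> maximizers C b"
    unfolding face_pairs_iff[OF rep] by blast
  have "F \<noteq> {}" "G \<noteq> {}" using FG(2,4) by auto
  then have "aff_dim H = int k" unfolding p(3) using aff_dim_Times[of F G] FG(2,4) p(1) by simp
  moreover have "H face_of C \<times> C" unfolding p(3) by (rule face_of_Times[OF FG(1,3)])
  moreover have "\<forall>x\<in>antidiagonal (dir_space C). (a, b) \<bullet> x = (0, w) \<bullet> x"
    using FG(5) by (auto simp: antidiagonal_def inner_diff_left)
  moreover have "H \<subseteq> maximizers (C \<times> C) (a, b)"
    unfolding p(3) maximizers_Times[OF ne ne] using FG(6,7) by blast
  ultimately show "H \<in> selected_faces (C \<times> C) (antidiagonal (dir_space C)) k (0, w)"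
    unfolding selected_faces_def by blast
qed

lemma cup_eq_sum_selected:
  fixes C :: "'a::euclidean_space set"
  assumes rep: "\<forall>x\<in>dir_space C. v x = w \<bullet> x" and C: "polytope C"
    and or: "oriented_cell X k C \<epsilon>"
  shows "cup X v r s k C \<epsilon> =
    (\<Sum>H\<in>selected_faces (C \<times> C) (antidiagonal (dir_space C)) k (0, w).
      pair_weight \<epsilon> r s (fst ` H) (snd ` H))"
proof -
  have dim: "aff_dim C = int k" using or by (simp add: oriented_cell_def)
  then have ne: "C \<noteq> {}" by auto
  let ?P = "\<lambda>p. face_pairs p (k - p) C v"
  have fp: "F \<noteq> {} \<and> G \<noteq> {} \<and> aff_dim F = int p \<and> aff_dim G = int (k - p)"
    if "(F, G) \<in> ?P p" for F G p
    using that by (auto simp: face_pairs_def)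
  have fin: "finite (?P p)" for p
  proof (rule finite_subset)
    show "?P p \<subseteq> {F. F face_of C} \<times> {F. F face_of C}" by (auto simp: face_pairs_def)
  qed (use finite_polytope_faces[OF C] in simp)
  have "cup X v r s k C \<epsilon> = (\<Sum>p\<le>k. \<Sum>(F, G)\<in>?P p. pair_weight \<epsilon> r s F G)"
    unfolding cup_def
  proof (rule sum.cong[OF refl])
    fix p assume p: "p \<in> {..k}"
    have "cup_pq X v p (k - p) (r p) (s (k - p)) C \<epsilon> =
        (\<Sum>(F, G)\<in>?P p. case orient_pair \<epsilon> F G of (\<epsilon>\<^sub>1, \<epsilon>\<^sub>2) \<Rightarrow> r p F \<epsilon>\<^sub>1 * s (k - p) G \<epsilon>\<^sub>2)"
      using p or by (simp add: cup_pq_def)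
    also have "\<dots> = (\<Sum>(F, G)\<in>?P p. pair_weight \<epsilon> r s F G)"
      by (rule sum.cong[OF refl]) (use fp in \<open>auto simp: pair_weight_def\<close>)
    finally show "cup_pq X v p (k - p) (r p) (s (k - p)) C \<epsilon> = (\<Sum>(F, G)\<in>?P p. pair_weight \<epsilon> r s F G)" .
  qed
  also have "\<dots> = (\<Sum>(F, G)\<in>(\<Union>p\<le>k. ?P p). pair_weight \<epsilon> r s F G)"
  proof (rule sum.UNION_disjoint[symmetric])
    show "\<forall>p\<in>{..k}. \<forall>p'\<in>{..k}. p \<noteq> p' \<longrightarrow> ?P p \<inter> ?P p' = {}"
    proof (intro ballI impI, rule ccontr)
      fix p p' assume "p \<noteq> p'" "?P p \<inter> ?P p' \<noteq> {}"
      then obtain F G where "(F, G) \<in> ?P p" "(F, G) \<in> ?P p'" by auto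
      from fp[OF this(1)] fp[OF this(2)] \<open>p \<noteq> p'\<close> show False by simp
    qed
  qed (use fin in auto)
  also have "\<dots> = (\<Sum>H\<in>(\<lambda>(F, G). F \<times> G) ` (\<Union>p\<le>k. ?P p). pair_weight \<epsilon> r s (fst ` H) (snd ` H))"
  proof (subst sum.reindex)
    show "inj_on (\<lambda>(F, G). F \<times> G) (\<Union>p\<le>k. ?P p)"
    proof (rule inj_onI, clarify)
      fix F G F' G' p p' assume "(F, G) \<in> ?P p" "(F', G') \<in> ?P p'" "F \<times> G = F' \<times> G'"
      then show "F = F' \<and> G = G'" using fp by (metis times_eq_iff)
    qed
    show "(\<Sum>(F, G)\<in>(\<Union>p\<le>k. ?P p). pair_weight \<epsilon> r s F G) =
        sum ((\<lambda>H. pair_weight \<epsilon> r s (fst ` H) (snd ` H)) \<circ> (\<lambda>(F, G). F \<times> G)) (\<Union>p\<le>k. ?P p)"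
      by (rule sum.cong[OF refl]) (use fp in auto)
  qed
  finally show ?thesis unfolding selected_faces_square[OF rep ne] .
qed

lemma zero_in_R_deg: "(\<lambda>C \<epsilon>. 0) \<in> R_deg V X p"
  by (auto simp: R_deg_def cochains_def coboundary_def ext_alg_def ext_power_def span_zero fun_eq_iff)

lemma R_ring_component:
  assumes "r \<in> R_ring V X" shows "r p \<in> R_deg V X p"
proof (cases "p \<le> dim V")
  case False
  then have "r p = (\<lambda>C \<epsilon>. 0)" using assms by (simp add: R_ring_def)
  then show ?thesis using zero_in_R_deg by simp
qed (use assms in \<open>simp add: R_ring_def\<close>)

theorem proposition2:
  fixes V :: "'a::euclidean_space set" and X :: "'a set set"
    and u v :: "'a \<Rightarrow> real" and r s :: "nat \<Rightarrow> 'a cochain"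
  assumes "subspace V"
    and "P_complex V X"
    and "\<forall>C\<in>X. compact C"
    and "u \<in> convenient V X" and "v \<in> convenient V X"
    and "r \<in> R_ring V X" and "s \<in> R_ring V X"
  shows "cup X u r s = cup X v r s"
proof (intro ext)
  fix k C \<epsilon>
  show "cup X u r s k C \<epsilon> = cup X v r s k C \<epsilon>"
  proof (cases "oriented_cell X k C \<epsilon>")
    case False
    then show ?thesis by (simp add: cup_def cup_pq_def)
  next
    case True
    then have C: "C \<in> X" "aff_dim C = int k" "orientation (dir_space C) \<epsilon>"
      by (simp_all add: oriented_cell_def)
    have "polyhedron C" "C \<noteq> {}" "C \<subseteq> V" using cell_in_complex[OF assms(2) C(1)] by blast+
    moreover have "compact C" using assms(3) C(1) by blast
    ultimately have poly: "polytope C" by (simp add: polytope_eq_bounded_polyhedron compact_imp_bounded)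
    have sub: "dir_space C \<subseteq> V"
      unfolding dir_space_def
        using \<open>C \<subseteq> V\<close>
          by (intro span_minimal assms(1)) (auto intro: subspace_diff[OF assms(1)])
    have dual: "u \<in> dual_space V" "v \<in> dual_space V"
      using assms(4,5) by (auto simp: convenient_def pq_convenient_def)
    obtain a where a: "\<forall>x\<in>V. u x = a \<bullet> x"
      using dual_space_inner[OF assms(1) dual(1)] by blast
    obtain b where b: "\<forall>x\<in>V. v x = b \<bullet> x"
      using dual_space_inner[OF assms(1) dual(2)] by blast
    have a': "\<forall>x\<in>dir_space C. u x = a \<bullet> x" and b': "\<forall>x\<in>dir_space C. v x = b \<bullet> x"
      using sub a b by blast+
    interpret sliced_polytope "C \<times> C" "antidiagonal (dir_space C)" k
      by (rule sliced_polytope_square[OF poly C(2)])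
    show ?thesis
      unfolding cup_eq_sum_selected[OF a' poly True] cup_eq_sum_selected[OF b' poly True]
      by (rule sum_selected_independent[OF
            convenient_imp_generic[OF assms(4) C(1,2) poly a']
            convenient_imp_generic[OF assms(5) C(1,2) poly b']
            balanced_weight_square[OF assms(2) R_ring_component[OF assms(6)] R_ring_component[OF assms(7)] C]])
  qed
qed

end
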